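(* Let $(\mathcal M,\rho)$ be an infinite doubling metric space and let $0<\alpha<1$, $0<p\le 1$. Then the Lipschitz free $p$-space $\mathcal F_p(\mathcal M,\rho^\alpha)$ over the metric space $(\mathcal M,\rho^\alpha)$ (with any choice of base point) is isomorphic to the space $\ell_p$; that is, there is a linear bijection $\mathcal F_p(\mathcal M,\rho^\alpha)\to\ell_p$ which is bounded with bounded inverse.
   Context: Vector spaces are real. For $0<p\le1$, a $p$-norm on $X$ is a map $\|\cdot\|:X\to[0,\infty)$ with $\|x\|>0$ for $x\ne0$, $\|ax\|=|a|\|x\|$, and $\|x+y\|^p\le\|x\|^p+\|y\|^p$; $X$ is $p$-Banach if it is complete for the metric $\|x-y\|^p$. Here $\ell_p=\ell_p(\mathbb N)$ with $\|(a_n)\|=(\sum|a_n|^p)^{1/p}$. Lipschitz free $p$-space: for a metric space $(\mathcal M,\sigma)$ with base point $0$, let $\mathcal P(\mathcal M)$ be the vector space with linear basis $\{\delta(x):x\in\mathcal M\setminus\{0\}\}$, and put $\delta(0)=0$. For $m\in\mathcal P(\mathcal M)$ let $\|m\|=\inf\left(\sum_{i=1}^n|a_i|^p\right)^{1/p}$, the infimum over all finite representations $m=\sum_{i=1}^n a_i\frac{\delta(x_i)-\delta(y_i)}{\sigma(x_i,y_i)}$ with $a_i\in\mathbb R$, $x_i\neq y_i$ in $\mathcal M$. This is a $p$-norm, and $\mathcal F_p(\mathcal M)=\mathcal F_p(\mathcal M,\sigma)$ is the completion of $\mathcal P(\mathcal M)$, a $p$-Banach space in which $\delta:\mathcal M\to\mathcal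 F_p(\mathcal M)$ is an isometric embedding. A metric space $(\mathcal M,\rho)$ is doubling if there is $\lambda\in\mathbb N$ such that every closed ball of radius $2r>0$ can be covered by $\lambda$ closed balls of radius $r$. For $0<\alpha<1$, $\rho^\alpha$ is the metric $(x,y)\mapsto\rho(x,y)^\alpha$. *)

theory Defs
  imports "HOL-Analysis.Analysis"
begin

text \<open>
  The spaces involved depend on term parameters (\<open>M\<close>, the metric, \<open>p\<close>), so real vector spaces
  with a \<open>p\<close>-norm are given by explicit carriers and operations instead of type classes.
\<close>

record 'v pspace =
  pcarrier :: "'v set"
  padd :: "'v \<Rightarrow> 'v \<Rightarrow> 'v"
  pscale :: "real \<Rightarrow> 'v \<Rightarrow> 'v"
  pnorm :: "'v \<Rightarrow> real"

definition pdist :: "real \<Rightarrow> 'v pspace \<Rightarrow> 'v \<Rightarrow> 'v \<Rightarrow> real" where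
  "pdist p X x y = pnorm X (padd X x (pscale X (- 1) y)) powr p"

definition isomorphic :: "'v pspace \<Rightarrow> 'w pspace \<Rightarrow> bool" where
  "isomorphic X Y \<longleftrightarrow>
    (\<exists>T. bij_betw T (pcarrier X) (pcarrier Y) \<and>
         (\<forall>x\<in>pcarrier X. \<forall>y\<in>pcarrier X. T (padd X x y) = padd Y (T x) (T y)) \<and>
         (\<forall>a. \<forall>x\<in>pcarrier X. T (pscale X a x) = pscale Y a (T x)) \<and>
         (\<exists>C. \<forall>x\<in>pcarrier X. pnorm Y (T x) \<le> C * pnorm X x) \<and>
         (\<exists>C. \<forall>y\<in>pcarrier Y. pnorm X (inv_into (pcarrier X) T y) \<le> C * pnorm Y y))"

text \<open>
  The completion for the metric \<open>pdist p X\<close>: Cauchy sequences modulo sequences at distance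
  tending to \<open>0\<close>. The unions in \<open>padd\<close> and \<open>pscale\<close> are over representatives; for a \<open>p\<close>-norm
  the resulting class does not depend on them, so each union is a single class. Likewise the
  norms along any representative converge, to the same limit.
\<close>

definition cauchy_class :: "real \<Rightarrow> 'v pspace \<Rightarrow> (nat \<Rightarrow> 'v) \<Rightarrow> (nat \<Rightarrow> 'v) set" where
  "cauchy_class p X u =
    {v. Metric_space.MCauchy (pcarrier X) (pdist p X) v \<and>
        (\<lambda>n. pdist p X (u n) (v n)) \<longlonglongrightarrow> 0}"

definition completion :: "real \<Rightarrow> 'v pspace \<Rightarrow> (nat \<Rightarrow> 'v) set pspace" where
  "completion p X =
    \<lparr> pcarrier = cauchy_class p X ` {u. Metric_space.MCauchy (pcarrier X) (pdist p X) u},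
      padd = (\<lambda>A B. \<Union>u\<in>A. \<Union>v\<in>B. cauchy_class p X (\<lambda>n. padd X (u n) (v n))),
      pscale = (\<lambda>a A. \<Union>u\<in>A. cauchy_class p X (\<lambda>n. pscale X a (u n))),
      pnorm = (\<lambda>A. THE l. \<forall>u\<in>A. (\<lambda>n. pnorm X (u n)) \<longlonglongrightarrow> l) \<rparr>"

text \<open>
  The vector space with basis \<open>M - {z}\<close> is represented by the finitely supported real functions
  vanishing outside \<open>M - {z}\<close>.
\<close>

definition delta :: "'a \<Rightarrow> 'a \<Rightarrow> 'a \<Rightarrow> real" where
  "delta z x = (\<lambda>w. if w = x \<and> x \<noteq> z then 1 else 0)"

definition free_pnorm ::
    "real \<Rightarrow> 'a set \<Rightarrow> ('a \<Rightarrow> 'a \<Rightarrow> real) \<Rightarrow> 'a \<Rightarrow> ('a \<Rightarrow> real) \<Rightarrow> real" where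
  "free_pnorm p M \<sigma> z m =
    Inf {(\<Sum>i<n. \<bar>a i\<bar> powr p) powr (1 / p) | (n::nat) a x y.
          (\<forall>i<n. x i \<in> M \<and> y i \<in> M \<and> x i \<noteq> y i) \<and>
          m = (\<lambda>w. \<Sum>i<n. a i * ((delta z (x i) w - delta z (y i) w) / \<sigma> (x i) (y i)))}"

definition free_prespace ::
    "real \<Rightarrow> 'a set \<Rightarrow> ('a \<Rightarrow> 'a \<Rightarrow> real) \<Rightarrow> 'a \<Rightarrow> ('a \<Rightarrow> real) pspace" where
  "free_prespace p M \<sigma> z =
    \<lparr> pcarrier = {m. finite {x. m x \<noteq> 0} \<and> {x. m x \<noteq> 0} \<subseteq> M - {z}},
      padd = (\<lambda>m m' x. m x + m' x),
      pscale = (\<lambda>a m x. a * m x),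
      pnorm = free_pnorm p M \<sigma> z \<rparr>"

definition lipschitz_free_pspace ::
    "real \<Rightarrow> 'a set \<Rightarrow> ('a \<Rightarrow> 'a \<Rightarrow> real) \<Rightarrow> 'a \<Rightarrow> (nat \<Rightarrow> 'a \<Rightarrow> real) set pspace" where
  "lipschitz_free_pspace p M \<sigma> z = completion p (free_prespace p M \<sigma> z)"

definition lp_space :: "real \<Rightarrow> (nat \<Rightarrow> real) pspace" where
  "lp_space p =
    \<lparr> pcarrier = {a. summable (\<lambda>n. \<bar>a n\<bar> powr p)},
      padd = (\<lambda>a b n. a n + b n),
      pscale = (\<lambda>c a n. c * a n),
      pnorm = (\<lambda>a. (\<Sum>n. \<bar>a n\<bar> powr p) powr (1 / p)) \<rparr>"

definition doubling :: "'a set \<Rightarrow> ('a \<Rightarrow> 'a \<Rightarrow> real) \<Rightarrow> bool" where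
  "doubling M d \<longleftrightarrow>
    (\<exists>N::nat. \<forall>x\<in>M. \<forall>r>0. \<exists>C\<subseteq>M. finite C \<and> card C \<le> N \<and>
      Metric_space.mcball M d x (2 * r) \<subseteq> (\<Union>c\<in>C. Metric_space.mcball M d c r))"

end

(*
Let \<sigma> = \<rho>^\<alpha>. At each dyadic scale 2^-k take a maximal separated set with points u(k,i) and a Lipschitz
partition of unity \<phi>(k,i), and put P_k(\<delta> x) = \<Sum>_i \<phi>(k,i)(x) \<delta>(u(k,i)). Then P_{k+1} - P_k is a combination
of molecules between neighbouring net points, with at most N^4 of them involved at each x. Since \<alpha> < 1, the
resulting coefficient map S from the free space to \<ell>_p is bounded, uniformly in both coarse and fine
scales, and the telescoping sum shows that the map R sending unit vectors to molecules satisfies R S = id.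
Hence the free space is complemented in \<ell>_p. Conversely it contains a complemented copy of \<ell>_p, spanned by
molecules that are biorthogonal to disjointly supported bumps, and Pelczynski's decomposition method finishes
the proof. For p \<le> 1 an operator on \<ell>_p is bounded as soon as its columns are, so all operators are given
by matrices, and it suffices to work with finitely supported elements of the free space: E = S R is a
projection of \<ell>_p whose range is the closure of the image of S.
*)

theory Submission
  imports Defs "HOL-Library.Function_Algebras"
begin

section \<open>The spaces lp and their bounded operators\<close>

text \<open>Everything is measured by \<open>p\<close>-th powers, which are subadditive for
  \<open>p \<le> 1\<close>. For points at distance \<open>t\<close> the coefficients at scale
  \<open>2^-k\<close> differ by at most a constant times
  \<open>min 1 (t / 2^-k) * 2^(-k \<alpha>)\<close>. The \<open>p\<close>-th powers of these sum
  over all integers \<open>k\<close> to a multiple of \<open>t^(\<alpha> p)\<close>: fine scales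
  need \<alpha> > 0, coarse scales \<alpha> < 1. The obstacle is that \<open>S m\<close> may have
  infinite support, so that \<open>R (S m) = m\<close> is an identity in the completion. It is
  replaced by an approximation: one finitely supported \<open>a\<close> is close to
  \<open>S m\<close> in \<open>lp\<close> while \<open>R a\<close> is close to \<open>m\<close> in
  the free norm. The operators built from \<open>S\<close> and \<open>R\<close> on \<open>lp\<close>
  are then compared on unit vectors. The completion is treated once, in \<open>lp_embedding\<close>:
  a linear map that is bounded above and below and has dense range in \<open>lp\<close> over
  \<open>nat\<close> identifies its classes with vectors. The complemented copy of \<open>lp\<close>
  comes from a function \<delta> that behaves like the distance to a point, possibly outside the
  space, and takes lacunary values along a sequence. Bumps depending on \<delta> alone are then
  disjointly supported.\<close>

lemma powr_add_le:
  fixes x y p :: real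
  assumes "0 \<le> x" "0 \<le> y" "0 < p" "p \<le> 1"
  shows "(x + y) powr p \<le> x powr p + y powr p"
proof (cases "x + y = 0")
  case True
  then have "x = 0" "y = 0" using assms by auto
  then show ?thesis using assms by simp
next
  case False
  define s where "s = x + y"
  have s: "s > 0" using False assms by (auto simp: s_def)
  \<comment> \<open>After division by \<open>s\<close> both numbers lie in [0,1], where passing to
    the power \<open>p \<le> 1\<close> does not decrease them.\<close>
  have "x / s \<le> (x / s) powr p" "y / s \<le> (y / s) powr p"
    using powr_mono'[of p 1 "x/s"] powr_mono'[of p 1 "y/s"] assms s
    by (auto simp: s_def)
  moreover have "x / s + y / s = 1" using s unfolding add_divide_distrib[symmetric] s_def by simp
  ultimately have "1 \<le> (x powr p + y powr p) / s powr p"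
    using assms s by (simp add: powr_divide add_divide_distrib)
  then show ?thesis using s by (simp add: s_def[symmetric] field_simps)
qed

lemma abs_add_powr_le:
  fixes x y p :: real
  assumes "0 < p" "p \<le> 1"
  shows "\<bar>x + y\<bar> powr p \<le> \<bar>x\<bar> powr p + \<bar>y\<bar> powr p"
proof -
  have "\<bar>x + y\<bar> powr p \<le> (\<bar>x\<bar> + \<bar>y\<bar>) powr p"
    using assms by (intro powr_mono2) auto
  also have "\<dots> \<le> \<bar>x\<bar> powr p + \<bar>y\<bar> powr p" using assms by (intro powr_add_le) auto
  finally show ?thesis .
qed

lemma abs_diff_powr_le:
  fixes x y p :: real
  assumes "0 \<le> x" "0 \<le> y" "0 < p" "p \<le> 1"
  shows "\<bar>x powr p - y powr p\<bar> \<le> \<bar>x - y\<bar> powr p"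
  using abs_add_powr_le[of p "x - y" y] abs_add_powr_le[of p "y - x" x] assms
  by (auto simp: abs_minus_commute)

lemma sum_fun_apply: "(\<Sum>x\<in>A. f x) i = (\<Sum>x\<in>A. f x i)"
  for f :: "'b \<Rightarrow> 'c \<Rightarrow> 'd::comm_monoid_add"
  by (induction A rule: infinite_finite_induct) auto

section \<open>Sequence spaces over an arbitrary index type\<close>

definition fscale :: "real \<Rightarrow> ('i \<Rightarrow> real) \<Rightarrow> 'i \<Rightarrow> real" where
  "fscale c a = (\<lambda>i. c * a i)"

lemma fscale_apply [simp]: "fscale c a i = c * a i"
  by (simp add: fscale_def)

lemma fscale_simps [simp]: "fscale c (fscale d a) = fscale (c * d) a" "fscale 1 a = a" "fscale 0 a = 0"
  "fscale c 0 = 0"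
  by (auto simp: fscale_def)

lemma fscale_add: "fscale c (a + b) = fscale c a + fscale c b"
  and fscale_diff: "fscale c (a - b) = fscale c a - fscale c b"
  by (auto simp: fscale_def algebra_simps)

text \<open>This is the \<open>p\<close>-th power of the norm, chosen because it is subadditive.
  With values in \<open>ennreal\<close> no summability side conditions arise, and sums over products
  of index types may be interchanged by Tonelli.\<close>

definition lpn :: "real \<Rightarrow> ('i \<Rightarrow> real) \<Rightarrow> ennreal" where
  "lpn p a = (\<integral>\<^sup>+ i. ennreal (\<bar>a i\<bar> powr p) \<partial>count_space UNIV)"

definition lp :: "real \<Rightarrow> ('i \<Rightarrow> real) set" where
  "lp p = {a. lpn p a < \<infinity>}"

definition unitv :: "'i \<Rightarrow> 'i \<Rightarrow> real" where
  "unitv j = (\<lambda>i. if i = j then 1 else 0)"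

definition restr :: "('i \<Rightarrow> real) \<Rightarrow> 'i set \<Rightarrow> 'i \<Rightarrow> real" where
  "restr a F = (\<lambda>i. if i \<in> F then a i else 0)"

locale exponent =
  fixes p :: real
  assumes p_pos: "0 < p" and p_le_1: "p \<le> 1"
begin

lemma lpn_zero [simp]: "lpn p 0 = 0" "lpn p (\<lambda>i. 0) = 0"
  using p_pos by (auto simp: lpn_def zero_fun_def)

lemma lpn_add: "lpn p (a + b) \<le> lpn p a + lpn p b"
  unfolding lpn_def
  by (subst nn_integral_add[symmetric])
     (auto intro!: nn_integral_mono ennreal_leI abs_add_powr_le p_pos p_le_1
       simp flip: ennreal_plus simp del: ennreal_plus)

lemma lpn_scale: "lpn p (fscale c a) = ennreal (\<bar>c\<bar> powr p) * lpn p a"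
  unfolding lpn_def
  by (subst nn_integral_cmult[symmetric])
     (auto simp: abs_mult powr_mult ennreal_mult)

lemma lpn_uminus [simp]: "lpn p (- a) = lpn p a"
  by (simp add: lpn_def)

lemma lpn_diff: "lpn p (a - b) \<le> lpn p a + lpn p b"
  using lpn_add[of a "- b"] by simp

lemma lpn_minus_commute: "lpn p (a - b) = lpn p (b - a)"
  using lpn_uminus[of "a - b"] by simp

lemma lpn_triangle: "lpn p (a - c) \<le> lpn p (a - b) + lpn p (b - c)"
  using lpn_add[of "a - b" "b - c"] by simp

lemma lpn_point: "ennreal (\<bar>a i\<bar> powr p) \<le> lpn p a"
  unfolding lpn_def
  by (rule nn_integral_ge_point[where p="\<lambda>i. ennreal (\<bar>a i\<bar> powr p)"]) auto

lemma lpn_eq_0_iff [simp]: "lpn p a = 0 \<longleftrightarrow> a = 0"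
proof
  assume "lpn p a = 0"
  then have "ennreal (\<bar>a i\<bar> powr p) = 0" for i using lpn_point[of a i] by simp
  then show "a = 0" by (simp add: fun_eq_iff)
qed simp

lemma lpn_mono: "(\<And>i. \<bar>a i\<bar> \<le> \<bar>b i\<bar>) \<Longrightarrow> lpn p a \<le> lpn p b"
  unfolding lpn_def using p_pos by (intro nn_integral_mono ennreal_leI powr_mono2) auto

lemma lpn_sum: "lpn p (\<Sum>x\<in>A. f x) \<le> (\<Sum>x\<in>A. lpn p (f x))"
proof (induction A rule: infinite_finite_induct)
  case (insert x F)
  have "lpn p (f x + sum f F) \<le> lpn p (f x) + (\<Sum>x\<in>F. lpn p (f x))"
    using order_trans[OF lpn_add add_left_mono[OF insert.IH]] .
  then show ?case unfolding sum.insert[OF insert.hyps] .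
qed auto

lemma lpn_finite:
  assumes "finite F" "\<And>i. i \<notin> F \<Longrightarrow> a i = 0"
  shows "lpn p a = ennreal (\<Sum>i\<in>F. \<bar>a i\<bar> powr p)"
  unfolding lpn_def using assms p_pos by (subst nn_integral_count_space'[of F]) auto

lemma lpn_unitv [simp]: "lpn p (unitv j) = 1"
  by (subst lpn_finite[of "{j}"]) (auto simp: unitv_def)

lemma lp_add [intro]: "a \<in> lp p \<Longrightarrow> b \<in> lp p \<Longrightarrow> a + b \<in> lp p"
  using lpn_add[of a b] by (auto simp: lp_def intro: le_less_trans)

lemma lp_diff [intro]: "a \<in> lp p \<Longrightarrow> b \<in> lp p \<Longrightarrow> a - b \<in> lp p"
  using lpn_diff[of a b] by (auto simp: lp_def intro: le_less_trans)

lemma lp_scale [intro]: "a \<in> lp p \<Longrightarrow> fscale c a \<in> lp p"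
  by (auto simp: lp_def lpn_scale ennreal_mult_less_top)

lemma lp_zero [simp, intro]: "0 \<in> lp p"
  by (simp add: lp_def)

lemma lp_unitv [simp, intro]: "unitv j \<in> lp p"
  by (simp add: lp_def)

lemma lp_sum: "(\<And>x. x \<in> A \<Longrightarrow> f x \<in> lp p) \<Longrightarrow> (\<Sum>x\<in>A. f x) \<in> lp p"
  by (induction A rule: infinite_finite_induct) auto

lemma lp_finite: "finite {i. a i \<noteq> 0} \<Longrightarrow> a \<in> lp p"
  unfolding lp_def mem_Collect_eq by (subst lpn_finite[of "{i. a i \<noteq> 0}"]) auto

text \<open>Dominated convergence with majorant \<open>\<bar>a i\<bar> powr p\<close>. The sets
  \<open>F n\<close> need not be finite: later they are bands of scales, each containing infinitely
  many indices.\<close>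

lemma lpn_restr_tendsto:
  fixes a :: "'i \<Rightarrow> real"
  assumes a: "a \<in> lp p" and F: "\<And>i. eventually (\<lambda>n. i \<in> F n) sequentially"
  shows "(\<lambda>n. lpn p (a - restr a (F n))) \<longlonglongrightarrow> 0"
proof -
  define u where "u = (\<lambda>n i. ennreal (\<bar>(a - restr a (F n)) i\<bar> powr p))"
  have u: "(\<lambda>n. u n i) \<longlonglongrightarrow> 0" for i
  proof (rule tendsto_eventually)
    show "eventually (\<lambda>n. u n i = 0) sequentially"
      using F[of i] by eventually_elim (simp add: u_def restr_def)
  qed
  have "(\<lambda>n. \<integral>\<^sup>+ i. u n i \<partial>count_space UNIV) \<longlonglongrightarrow> (\<integral>\<^sup>+ (i::'i). 0 \<partial>count_space UNIV)"
  proof (rule nn_integral_dominated_convergence[where w="\<lambda>i. ennreal (\<bar>a i\<bar> powr p)"])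
    show "AE i in count_space UNIV. u n i \<le> ennreal (\<bar>a i\<bar> powr p)" for n
      by (auto simp: u_def restr_def)
  qed (use a u in \<open>simp_all add: lp_def lpn_def\<close>)
  then show ?thesis by (simp add: lpn_def u_def)
qed

lemma lp_dense:
  fixes a :: "'i::countable \<Rightarrow> real"
  assumes a: "a \<in> lp p" and e: "e > 0"
  obtains F where "finite F" "lpn p (a - restr a F) < e"
proof -
  have "(\<lambda>n. lpn p (a - restr a {i. to_nat i < n})) \<longlonglongrightarrow> 0"
    by (intro lpn_restr_tendsto a) (auto simp: eventually_at_top_dense)
  then have "eventually (\<lambda>n. lpn p (a - restr a {i. to_nat i < n}) < e) sequentially"
    using e by (rule order_tendstoD)
  then obtain n where "lpn p (a - restr a {i. to_nat i < n}) < e"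
    by (auto simp: eventually_at_top_linorder)
  moreover have "finite {i::'i. to_nat i < n}"
    using finite_vimageI[of "{..<n}" "to_nat :: 'i \<Rightarrow> nat"] by (simp add: vimage_def)
  ultimately show ?thesis using that by blast
qed

lemma restr_eq_sum: "finite F \<Longrightarrow> restr a F = (\<Sum>j\<in>F. fscale (a j) (unitv j))"
  by (auto simp: fun_eq_iff restr_def sum_fun_apply unitv_def if_distrib cong: if_cong)

lemma lp_restr: "a \<in> lp p \<Longrightarrow> restr a F \<in> lp p"
  unfolding lp_def using le_less_trans[OF lpn_mono[of "restr a F" a]] by (auto simp: restr_def)

text \<open>A coordinate is dominated by \<open>lpn\<close>, so coordinatewise limits exist; Fatou's
  lemma then passes the Cauchy estimate for \<open>a m - a n\<close> to the limit in
  \<open>n\<close>.\<close>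

lemma lp_complete:
  fixes a :: "nat \<Rightarrow> 'i \<Rightarrow> real"
  assumes lp: "\<And>n. a n \<in> lp p"
    and cauchy: "\<And>e. e > 0 \<Longrightarrow> \<exists>N. \<forall>m\<ge>N. \<forall>n\<ge>N. lpn p (a m - a n) < ennreal e"
  obtains l where "l \<in> lp p" "(\<lambda>n. lpn p (a n - l)) \<longlonglongrightarrow> 0"
proof -
  have "Cauchy (\<lambda>n. a n i)" for i
  proof (rule CauchyI)
    fix e :: real assume e: "e > 0"
    then obtain N where N: "\<forall>m\<ge>N. \<forall>n\<ge>N. lpn p (a m - a n) < ennreal (e powr p)"
      using cauchy[of "e powr p"] by auto
    have "\<bar>a m i - a n i\<bar> < e" if "m \<ge> N" "n \<ge> N" for m n
    proof -
      have "ennreal (\<bar>a m i - a n i\<bar> powr p) < ennreal (e powr p)"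
        using N that lpn_point[of "a m - a n" i] by (auto intro: le_less_trans)
      then have "\<bar>a m i - a n i\<bar> powr p < e powr p" by (simp add: ennreal_less_iff)
      then show ?thesis using powr_mono2[of p e "\<bar>a m i - a n i\<bar>"] p_pos e by linarith
    qed
    then show "\<exists>M. \<forall>m\<ge>M. \<forall>n\<ge>M. norm (a m i - a n i) < e" by auto
  qed
  then have "\<exists>x. (\<lambda>n. a n i) \<longlonglongrightarrow> x" for i
    by (simp add: Cauchy_convergent_iff convergent_def)
  then obtain l where l: "\<And>i. (\<lambda>n. a n i) \<longlonglongrightarrow> l i" by metis
  have *: "lpn p (a m - l) \<le> ennreal e"
    if N: "\<forall>m\<ge>N. \<forall>n\<ge>N. lpn p (a m - a n) < ennreal e" and m: "m \<ge> N" for N e m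
  proof -
    have "lpn p (a m - l) = (\<integral>\<^sup>+ i. liminf (\<lambda>n. ennreal (\<bar>(a m - a n) i\<bar> powr p)) \<partial>count_space UNIV)"
      unfolding lpn_def
    proof (intro nn_integral_cong)
      fix i
      have "(\<lambda>n. ennreal (\<bar>(a m - a n) i\<bar> powr p)) \<longlonglongrightarrow> ennreal (\<bar>(a m - l) i\<bar> powr p)"
        using p_pos by (intro tendsto_ennrealI tendsto_powr' tendsto_rabs) (auto intro!: tendsto_intros l)
      then show "ennreal (\<bar>(a m - l) i\<bar> powr p) = liminf (\<lambda>n. ennreal (\<bar>(a m - a n) i\<bar> powr p))"
        by (rule lim_imp_Liminf[symmetric, rotated]) auto
    qed
    also have "\<dots> \<le> liminf (\<lambda>n. lpn p (a m - a n))"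
      unfolding lpn_def by (rule nn_integral_liminf) auto
    also have "\<dots> \<le> liminf (\<lambda>n. ennreal e)"
      by (rule Liminf_mono) (use N m in \<open>auto simp: eventually_at_top_linorder intro!: exI[of _ N] less_imp_le\<close>)
    also have "\<dots> = ennreal e" by (simp add: Liminf_const)
    finally show ?thesis .
  qed
  have lim: "(\<lambda>n. lpn p (a n - l)) \<longlonglongrightarrow> 0"
  proof (rule tendsto_0_if_Limsup_eq_0_ennreal, rule antisym)
    show "limsup (\<lambda>n. lpn p (a n - l)) \<le> 0"
    proof (rule ennreal_le_epsilon)
      fix e :: real assume "e > 0"
      then obtain N where "\<forall>m\<ge>N. \<forall>n\<ge>N. lpn p (a m - a n) < ennreal e" using cauchy by blast
      then have "\<forall>n\<ge>N. lpn p (a n - l) \<le> ennreal e" using * by blast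
      then have "limsup (\<lambda>n. lpn p (a n - l)) \<le> ennreal e"
        by (intro Limsup_bounded) (auto simp: eventually_at_top_linorder)
      then show "limsup (\<lambda>n. lpn p (a n - l)) \<le> 0 + ennreal e" by simp
    qed
  qed simp
  obtain N where "lpn p (a N - l) \<le> ennreal 1" using * cauchy[of 1] by (metis order_refl zero_less_one)
  then have "a N - l \<in> lp p" by (auto simp: lp_def intro: le_less_trans)
  then have "a N - (a N - l) \<in> lp p" using lp[of N] by blast
  then show ?thesis using that lim by simp
qed

lemma lpn_tendsto_unique:
  assumes "(\<lambda>n. lpn p (a n - l)) \<longlonglongrightarrow> 0" "(\<lambda>n. lpn p (a n - l')) \<longlonglongrightarrow> 0"
  shows "l = l'"
proof -
  have "(\<lambda>n. lpn p (a n - l) + lpn p (a n - l')) \<longlonglongrightarrow> 0"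
    using tendsto_add[OF assms] by simp
  then have "lpn p (l - l') \<le> 0"
  proof (rule tendsto_lowerbound)
    show "eventually (\<lambda>n. lpn p (l - l') \<le> lpn p (a n - l) + lpn p (a n - l')) sequentially"
      using lpn_triangle[of l l'] by (simp add: lpn_minus_commute[of _ l])
  qed simp
  then show ?thesis by simp
qed

text \<open>The inclusion of \<open>lp\<close> in \<open>l1\<close>, with norm at most one. If
  \<open>S\<close> is the value of \<open>lpn p t\<close>, each
  \<open>\<bar>t i\<bar> powr p\<close> is at most \<open>S\<close>, hence \<open>\<bar>t i\<bar>
  \<le> \<bar>t i\<bar> powr p * S powr ((1 - p) / p)\<close>, and the sum over \<open>i\<close> is
  at most \<open>S powr (1 / p)\<close>. It controls the rows of matrices.\<close>

lemma nn_integral_powr_le: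
  fixes t :: "'i \<Rightarrow> real"
  assumes t: "t \<in> lp p"
  shows "integrable (count_space UNIV) t"
    and "ennreal (\<bar>\<integral>i. t i \<partial>count_space UNIV\<bar> powr p) \<le> lpn p t"
proof -
  obtain S where S: "lpn p t = ennreal S" "S \<ge> 0"
    using t by (cases "lpn p t") (auto simp: lp_def)
  have *: "\<bar>t i\<bar> \<le> \<bar>t i\<bar> powr p * S powr ((1 - p) / p)" for i
  proof -
    have "\<bar>t i\<bar> powr p \<le> S" using lpn_point[of t i] S by (simp add: ennreal_le_iff)
    then have "(\<bar>t i\<bar> powr p) powr ((1 - p) / p) \<le> S powr ((1 - p) / p)"
      using p_pos p_le_1 by (intro powr_mono2) auto
    then have "\<bar>t i\<bar> powr (1 - p) \<le> S powr ((1 - p) / p)"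
      using p_pos by (simp add: powr_powr)
    then have "\<bar>t i\<bar> powr p * \<bar>t i\<bar> powr (1 - p) \<le> \<bar>t i\<bar> powr p * S powr ((1 - p) / p)"
      by (intro mult_left_mono) auto
    then show ?thesis by (simp add: powr_add[symmetric])
  qed
  have "(\<integral>\<^sup>+ i. ennreal \<bar>t i\<bar> \<partial>count_space UNIV)
      \<le> (\<integral>\<^sup>+ i. ennreal (\<bar>t i\<bar> powr p) * ennreal (S powr ((1 - p) / p)) \<partial>count_space UNIV)"
    using * by (intro nn_integral_mono) (auto simp: ennreal_mult[symmetric] intro!: ennreal_leI)
  also have "\<dots> = ennreal S * ennreal (S powr ((1 - p) / p))"
    by (subst nn_integral_multc) (auto simp: S(1)[symmetric] lpn_def)
  also have "\<dots> = ennreal (S powr (1 / p))"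
  proof (cases "S = 0")
    case False
    then have "S * S powr ((1 - p) / p) = S powr (1 + (1 - p) / p)" using S by (simp add: powr_add)
    also have "1 + (1 - p) / p = 1 / p" using p_pos by (simp add: field_simps)
    finally show ?thesis using S by (simp add: ennreal_mult[symmetric])
  qed auto
  finally have bd: "(\<integral>\<^sup>+ i. ennreal \<bar>t i\<bar> \<partial>count_space UNIV) \<le> ennreal (S powr (1 / p))" .
  show int: "integrable (count_space UNIV) t"
    using bd by (intro integrableI_bounded) (auto intro: le_less_trans)
  have "ennreal \<bar>\<integral>i. t i \<partial>count_space UNIV\<bar> \<le> ennreal (\<integral>i. \<bar>t i\<bar> \<partial>count_space UNIV)"
    using integral_norm_bound[of "count_space UNIV" t] by (intro ennreal_leI) simp
  also have "\<dots> = (\<integral>\<^sup>+ i. ennreal \<bar>t i\<bar> \<partial>count_space UNIV)"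
    using int by (intro nn_integral_eq_integral[symmetric]) auto
  finally have "ennreal \<bar>\<integral>i. t i \<partial>count_space UNIV\<bar> \<le> ennreal (S powr (1 / p))"
    using bd by (rule order_trans)
  then have "\<bar>\<integral>i. t i \<partial>count_space UNIV\<bar> \<le> S powr (1 / p)"
    by (subst (asm) ennreal_le_iff) auto
  then have "\<bar>\<integral>i. t i \<partial>count_space UNIV\<bar> powr p \<le> (S powr (1 / p)) powr p"
    using p_pos by (intro powr_mono2) auto
  also have "\<dots> = S" using p_pos S by (simp add: powr_powr)
  finally show "ennreal (\<bar>\<integral>i. t i \<partial>count_space UNIV\<bar> powr p) \<le> lpn p t" using S by (simp add: ennreal_leI)
qed

end

section \<open>Bounded operators and their matrices\<close>

definition lin_on :: "('a \<Rightarrow> real) set \<Rightarrow> (('a \<Rightarrow> real) \<Rightarrow> ('b \<Rightarrow> real)) \<Rightarrow> bool" where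
  "lin_on V L \<longleftrightarrow> (\<forall>x\<in>V. \<forall>y\<in>V. L (x + y) = L x + L y) \<and> (\<forall>c. \<forall>x\<in>V. L (fscale c x) = fscale c (L x))"

definition blin :: "real \<Rightarrow> (('a \<Rightarrow> real) \<Rightarrow> ('b \<Rightarrow> real)) \<Rightarrow> bool" where
  "blin p L \<longleftrightarrow> lin_on (lp p) L \<and> (\<exists>C::real. \<forall>a\<in>lp p. lpn p (L a) \<le> ennreal C * lpn p a)"

text \<open>The operator with matrix columns \<open>c j\<close>, the images of the unit vectors. The
  integral is total, with value 0 for a row that is not summable; uniformly bounded columns rule
  such rows out for \<open>a\<close> in \<open>lp\<close>.\<close>

definition matop :: "('j \<Rightarrow> 'i \<Rightarrow> real) \<Rightarrow> ('j \<Rightarrow> real) \<Rightarrow> 'i \<Rightarrow> real" where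
  "matop c a = (\<lambda>i. \<integral>j. a j * c j i \<partial>count_space UNIV)"

context exponent
begin

lemma
  assumes L: "blin p L" and a: "a \<in> lp p"
  shows blin_plus: "b \<in> lp p \<Longrightarrow> L (a + b) = L a + L b"
    and blin_fscale: "L (fscale c a) = fscale c (L a)"
    and blin_minus: "b \<in> lp p \<Longrightarrow> L (a - b) = L a - L b"
    and blin_zero: "L 0 = 0"
    and blin_lp: "L a \<in> lp p"
proof -
  have *: "L (x + y) = L x + L y" "L (fscale c x) = fscale c (L x)" if "x \<in> lp p" "y \<in> lp p" for x y c
    using L that by (auto simp: blin_def lin_on_def)
  show "b \<in> lp p \<Longrightarrow> L (a + b) = L a + L b" "L (fscale c a) = fscale c (L a)" using * a by auto
  show "L (a - b) = L a - L b" if b: "b \<in> lp p"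
  proof -
    have "L (a + fscale (-1) b) = L a + fscale (-1) (L b)"
      using *(1)[OF a lp_scale[OF b]] *(2)[OF b b] by simp
    then show ?thesis by (simp add: fscale_def fun_diff_def plus_fun_def)
  qed
  show "L 0 = 0" using *(2)[of 0 0 0] by simp
  obtain C :: real where "lpn p (L a) \<le> ennreal C * lpn p a" using L a by (auto simp: blin_def)
  moreover have "ennreal C * lpn p a < \<infinity>" using a by (auto simp: lp_def ennreal_mult_less_top)
  ultimately show "L a \<in> lp p" unfolding lp_def by (auto intro: le_less_trans)
qed

lemma blin_sum:
  assumes "blin p L" "\<And>x. x \<in> A \<Longrightarrow> f x \<in> lp p"
  shows "L (\<Sum>x\<in>A. f x) = (\<Sum>x\<in>A. L (f x))"
  using assms(2)
proof (induction A rule: infinite_finite_induct)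
  case (insert x F)
  then show ?case using blin_plus[OF assms(1), of "f x" "sum f F"] lp_sum[of F f]
    by (simp only: sum.insert insertI1 insertI2 not_False_eq_True)
qed (simp_all add: blin_zero[OF assms(1) lp_zero])

lemma blin_bound:
  assumes "blin p L"
  obtains C where "C > 0" "\<And>a. a \<in> lp p \<Longrightarrow> lpn p (L a) \<le> ennreal C * lpn p a"
proof -
  obtain C :: real where C: "\<And>a. a \<in> lp p \<Longrightarrow> lpn p (L a) \<le> ennreal C * lpn p a"
    using assms by (auto simp: blin_def)
  have "lpn p (L a) \<le> ennreal (max C 1) * lpn p a" if "a \<in> lp p" for a
    by (rule order_trans[OF C[OF that]]) (intro mult_right_mono ennreal_leI; simp)
  then show ?thesis using that[of "max C 1"] by simp
qed

lemma blinI: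
  assumes "\<And>a b. a \<in> lp p \<Longrightarrow> b \<in> lp p \<Longrightarrow> L (a + b) = L a + L b"
    "\<And>c a. a \<in> lp p \<Longrightarrow> L (fscale c a) = fscale c (L a)"
    "\<And>a. a \<in> lp p \<Longrightarrow> lpn p (L a) \<le> ennreal C * lpn p a"
  shows "blin p L"
  unfolding blin_def lin_on_def using assms by blast

lemma blin_id: "blin p (\<lambda>a. a)"
  by (rule blinI[where C=1]) auto

lemma blin_compose:
  assumes "blin p L" "blin p L'"
  shows "blin p (\<lambda>a. L (L' a))"
proof -
  obtain C C' where C: "C > 0" "\<And>a. a \<in> lp p \<Longrightarrow> lpn p (L a) \<le> ennreal C * lpn p a"
     "C' > 0" "\<And>a. a \<in> lp p \<Longrightarrow> lpn p (L' a) \<le> ennreal C' * lpn p a"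
    using blin_bound assms by metis
  show ?thesis
  proof (rule blinI[where C="C * C'"])
    fix a :: "'c \<Rightarrow> real" assume a: "a \<in> lp p"
    have "lpn p (L (L' a)) \<le> ennreal C * lpn p (L' a)" using C(2) blin_lp[OF assms(2) a] by auto
    also have "\<dots> \<le> ennreal C * (ennreal C' * lpn p a)" using C(4) a by (intro mult_left_mono) auto
    finally show "lpn p (L (L' a)) \<le> ennreal (C * C') * lpn p a"
      using C by (simp add: ennreal_mult mult.assoc)
  qed (simp_all add: blin_plus[OF assms(1)] blin_plus[OF assms(2)] blin_fscale[OF assms(1)] blin_fscale[OF assms(2)] blin_lp[OF assms(2)])
qed

lemma blin_add:
  assumes "blin p L" "blin p L'"
  shows "blin p (\<lambda>a. L a + L' a)"
proof -
  obtain C C' where C: "C > 0" "\<And>a. a \<in> lp p \<Longrightarrow> lpn p (L a) \<le> ennreal C * lpn p a"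
     "C' > 0" "\<And>a. a \<in> lp p \<Longrightarrow> lpn p (L' a) \<le> ennreal C' * lpn p a"
    using blin_bound assms by metis
  show ?thesis
  proof (rule blinI[where C="C + C'"])
    fix a :: "'a \<Rightarrow> real" assume a: "a \<in> lp p"
    have "lpn p (L a + L' a) \<le> ennreal C * lpn p a + ennreal C' * lpn p a"
      by (rule order_trans[OF lpn_add]) (intro add_mono C a)
    then show "lpn p (L a + L' a) \<le> ennreal (C + C') * lpn p a"
      using C by (simp add: ennreal_plus distrib_right)
  next
    fix a b :: "'a \<Rightarrow> real" assume "a \<in> lp p" "b \<in> lp p"
    then show "L (a + b) + L' (a + b) = (L a + L' a) + (L b + L' b)"
      using blin_plus[OF assms(1)] blin_plus[OF assms(2)] by (simp add: fun_eq_iff)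
  next
    fix c and a :: "'a \<Rightarrow> real" assume "a \<in> lp p"
    then show "L (fscale c a) + L' (fscale c a) = fscale c (L a + L' a)"
      using blin_fscale[OF assms(1)] blin_fscale[OF assms(2)] by (simp add: fscale_add)
  qed
qed

lemma blin_uminus: "blin p L \<Longrightarrow> blin p (\<lambda>a. - L a)"
  unfolding blin_def lin_on_def
  by (elim conjE exE, intro conjI exI) (auto simp: fun_eq_iff)

lemma blin_diff: "blin p L \<Longrightarrow> blin p L' \<Longrightarrow> blin p (\<lambda>a. L a - L' a)"
  using blin_add[of L "\<lambda>a. - L' a"] blin_uminus[of L'] by simp

text \<open>Unit vectors span a dense subspace and both operators are continuous. Together with
  \<open>matop_unitv\<close> this reduces the identities between the operators \<open>E\<close>,
  \<open>J\<close>, \<open>K\<close> below to identities between columns.\<close>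

lemma blin_eqI:
  fixes L L' :: "('i::countable \<Rightarrow> real) \<Rightarrow> 'k \<Rightarrow> real"
  assumes L: "blin p L" and L': "blin p L'" and eq: "\<And>j. L (unitv j) = L' (unitv j)" and a: "a \<in> lp p"
  shows "L a = L' a"
proof -
  define D where "D = (\<lambda>a. L a - L' a)"
  have D: "blin p D" unfolding D_def by (intro blin_diff L L')
  obtain C where C: "C > 0" "\<And>a. a \<in> lp p \<Longrightarrow> lpn p (D a) \<le> ennreal C * lpn p a"
    using blin_bound[OF D] by blast
  have D0: "D (restr a F) = 0" if "finite F" for F
  proof -
    have "D (restr a F) = (\<Sum>j\<in>F. D (fscale (a j) (unitv j)))"
      unfolding restr_eq_sum[OF that] by (rule blin_sum[OF D]) auto
    also have "\<dots> = (\<Sum>j\<in>F. 0)"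
      by (intro sum.cong refl) (simp add: blin_fscale[OF D], simp add: D_def eq)
    finally show ?thesis by simp
  qed
  have "lpn p (D a) \<le> 0"
  proof (rule ennreal_le_epsilon)
    fix e :: real assume e: "e > 0"
    obtain F where F: "finite F" "lpn p (a - restr a F) < ennreal (e / C)"
      using lp_dense[OF a, of "ennreal (e / C)"] e C by auto
    have "D a = D (a - restr a F)"
      using D0[OF F(1)] by (simp add: blin_minus[OF D a] lp_restr a)
    then have "lpn p (D a) \<le> ennreal C * lpn p (a - restr a F)"
      using C(2)[of "a - restr a F"] a lp_restr[OF a] by auto
    also have "\<dots> \<le> ennreal C * ennreal (e / C)" using F by (intro mult_left_mono) auto
    also have "\<dots> = ennreal e" using C e by (simp add: ennreal_mult[symmetric])
    finally show "lpn p (D a) \<le> 0 + ennreal e" by simp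
  qed
  then show ?thesis by (simp add: D_def)
qed

text \<open>By \<open>nn_integral_powr_le\<close> the \<open>p\<close>-th power of a row sum is at
  most the sum of the \<open>p\<close>-th powers; after interchanging the sums, each
  \<open>\<bar>a j\<bar> powr p\<close> is multiplied by the bound of its column.\<close>

lemma matop_blin:
  fixes c :: "'j \<Rightarrow> 'i \<Rightarrow> real"
  assumes C: "\<And>j. lpn p (c j) \<le> ennreal C"
  shows "blin p (matop c)"
proof -
  have row: "(\<lambda>j. a j * c j i) \<in> lp p" and bnd: "lpn p (matop c a) \<le> ennreal C * lpn p a"
    if a: "a \<in> lp p" for a i
  proof -
    have "ennreal (\<bar>c j i\<bar> powr p) \<le> ennreal C" for i j
      using lpn_point[of "c j" i] C[of j] by (rule order_trans)
    then have "lpn p (\<lambda>j. a j * c j i) \<le> (\<integral>\<^sup>+ j. ennreal (\<bar>a j\<bar> powr p) * ennreal C \<partial>count_space UNIV)" for i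
      unfolding lpn_def
      by (intro nn_integral_mono) (auto simp: abs_mult powr_mult ennreal_mult intro!: mult_left_mono)
    also have "\<dots> = lpn p a * ennreal C" unfolding lpn_def by (rule nn_integral_multc) auto
    also have "\<dots> < \<infinity>" using a by (auto simp: lp_def ennreal_mult_less_top)
    finally show row: "(\<lambda>j. a j * c j i) \<in> lp p" for i unfolding lp_def by simp
    have "(\<integral>\<^sup>+ i. ennreal (\<bar>matop c a i\<bar> powr p) \<partial>count_space UNIV) \<le> (\<integral>\<^sup>+ i. (\<integral>\<^sup>+ j. ennreal (\<bar>a j * c j i\<bar> powr p) \<partial>count_space UNIV) \<partial>count_space UNIV)"
      unfolding matop_def
      by (intro nn_integral_mono) (use nn_integral_powr_le(2)[OF row] in \<open>simp add: lpn_def\<close>)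
    also have "\<dots> = (\<integral>\<^sup>+ j. (\<integral>\<^sup>+ i. ennreal (\<bar>a j * c j i\<bar> powr p) \<partial>count_space UNIV) \<partial>count_space UNIV)"
      using nn_integral_fst_count_space[of "\<lambda>(i, j). ennreal (\<bar>a j * c j i\<bar> powr p)"]
        nn_integral_snd_count_space[of "\<lambda>(i, j). ennreal (\<bar>a j * c j i\<bar> powr p)"] by simp
    also have "\<dots> = (\<integral>\<^sup>+ j. lpn p (fscale (a j) (c j)) \<partial>count_space UNIV)"
      by (simp add: lpn_def)
    also have "\<dots> \<le> (\<integral>\<^sup>+ j. ennreal (\<bar>a j\<bar> powr p) * ennreal C \<partial>count_space UNIV)"
      by (intro nn_integral_mono) (auto simp: lpn_scale intro!: mult_left_mono C)
    also have "\<dots> = lpn p a * ennreal C" unfolding lpn_def by (rule nn_integral_multc) auto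
    finally show "lpn p (matop c a) \<le> ennreal C * lpn p a" by (simp add: mult.commute lpn_def[of p "matop c a"])
  qed
  show ?thesis
  proof (rule blinI[OF _ _ bnd])
    fix a b :: "'j \<Rightarrow> real" assume "a \<in> lp p" "b \<in> lp p"
    then show "matop c (a + b) = matop c a + matop c b"
      by (auto simp: matop_def fun_eq_iff distrib_right
          intro!: Bochner_Integration.integral_add nn_integral_powr_le(1) row)
  next
    fix a :: "'j \<Rightarrow> real" and r
    show "matop c (fscale r a) = fscale r (matop c a)"
      by (auto simp: matop_def fun_eq_iff mult.assoc)
  qed auto
qed

lemma matop_unitv [simp]: "matop c (unitv j) = c j"
proof
  fix i
  have "matop c (unitv j) i = (\<integral>j'. c j i * indicator {j} j' \<partial>count_space UNIV)"
    unfolding matop_def unitv_def by (intro Bochner_Integration.integral_cong) (auto simp: indicator_def)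
  also have "\<dots> = c j i" by simp
  finally show "matop c (unitv j) i = c j i" .
qed

end

section \<open>Completions of spaces that embed densely in lp\<close>

lemma ennreal_squeeze_0:
  fixes f g :: "nat \<Rightarrow> ennreal"
  assumes "g \<longlonglongrightarrow> 0" "\<And>n. f n \<le> g n"
  shows "f \<longlonglongrightarrow> 0"
  by (rule tendsto_sandwich[OF _ _ tendsto_const assms(1)]) (simp_all add: assms(2))

text \<open>\<open>N_uminus\<close> is required off \<open>V\<close> as well, because
  \<open>Metric_space\<close> demands symmetry of the distance for all arguments and not only for
  points of the carrier.\<close>

locale pnormed = exponent p for p +
  fixes V :: "('a \<Rightarrow> real) set" and N :: "('a \<Rightarrow> real) \<Rightarrow> real"
  assumes V_zero: "0 \<in> V"
    and V_add: "x \<in> V \<Longrightarrow> y \<in> V \<Longrightarrow> x + y \<in> V"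
    and V_scale: "x \<in> V \<Longrightarrow> fscale c x \<in> V"
    and N_nonneg: "x \<in> V \<Longrightarrow> 0 \<le> N x"
    and N_uminus: "N (- x) = N x"
    and N_pos: "x \<in> V \<Longrightarrow> x \<noteq> 0 \<Longrightarrow> 0 < N x"
    and N_scale: "x \<in> V \<Longrightarrow> N (fscale c x) = \<bar>c\<bar> * N x"
    and N_triangle: "x \<in> V \<Longrightarrow> y \<in> V \<Longrightarrow> N (x + y) powr p \<le> N x powr p + N y powr p"
begin

definition space :: "('a \<Rightarrow> real) pspace" where
  "space = \<lparr> pcarrier = V, padd = (\<lambda>m m' x. m x + m' x), pscale = (\<lambda>a m x. a * m x), pnorm = N \<rparr>"

lemma space_sel [simp]: "pcarrier space = V" "padd space x y = x + y" "pscale space c x = fscale c x"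
  "pnorm space = N"
  by (simp_all add: space_def fscale_def fun_eq_iff)

lemma V_diff: "x \<in> V \<Longrightarrow> y \<in> V \<Longrightarrow> x - y \<in> V"
  using V_add[of x "fscale (-1) y"] V_scale[of y "-1"] by (simp add: fscale_def fun_diff_def plus_fun_def)

lemma pdist_eq: "pdist p space x y = N (x - y) powr p"
proof -
  have "x + fscale (- 1) y = x - y" by (simp add: fscale_def fun_eq_iff)
  then show ?thesis by (simp add: pdist_def)
qed

lemma N_0: "N 0 = 0"
  using N_scale[OF V_zero, of 0] by simp

lemma metric: "Metric_space V (pdist p space)"
proof
  show "pdist p space x y = pdist p space y x" for x y
    using N_uminus[of "x - y"] by (simp add: pdist_eq)
  show "pdist p space x y = 0 \<longleftrightarrow> x = y" if "x \<in> V" "y \<in> V" for x y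
  proof (cases "x = y")
    case False
    then have "N (x - y) > 0" by (intro N_pos V_diff that) auto
    then show ?thesis using False by (simp add: pdist_eq)
  qed (use p_pos in \<open>simp add: pdist_eq N_0\<close>)
  show "pdist p space x z \<le> pdist p space x y + pdist p space y z" if "x \<in> V" "y \<in> V" "z \<in> V" for x y z
    using N_triangle[OF V_diff[OF that(1,2)] V_diff[OF that(2,3)]] by (simp add: pdist_eq)
qed (simp add: pdist_eq)

end

text \<open>A criterion for the completion of \<open>V\<close> to be \<open>lp\<close>: a linear
  \<open>T\<close> bounded above and below, with dense range. The bounds compare \<open>p\<close>-th
  powers, since these are what \<open>pdist\<close> and \<open>lpn\<close> measure.\<close>

locale lp_embedding = pnormed p V N for p V and N :: "('a \<Rightarrow> real) \<Rightarrow> real" +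
  fixes T :: "('a \<Rightarrow> real) \<Rightarrow> nat \<Rightarrow> real" and C c :: real
  assumes T_lin: "lin_on V T"
    and T_upper: "x \<in> V \<Longrightarrow> lpn p (T x) \<le> ennreal (C * N x powr p)"
    and T_lower: "x \<in> V \<Longrightarrow> ennreal (N x powr p) \<le> ennreal c * lpn p (T x)"
    and T_dense: "a \<in> lp p \<Longrightarrow> e > 0 \<Longrightarrow> \<exists>x\<in>V. lpn p (a - T x) < ennreal e"
    and C_pos: "C > 0" and c_pos: "c > 0"
begin

lemma T_add: "x \<in> V \<Longrightarrow> y \<in> V \<Longrightarrow> T (x + y) = T x + T y"
  and T_scale: "x \<in> V \<Longrightarrow> T (fscale r x) = fscale r (T x)"
  using T_lin by (auto simp: lin_on_def)

lemma T_diff: "x \<in> V \<Longrightarrow> y \<in> V \<Longrightarrow> T (x - y) = T x - T y"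
  using T_add[of "x - y" y] V_diff[of x y] by (simp add: algebra_simps)

lemma T_lp: "x \<in> V \<Longrightarrow> T x \<in> lp p"
  using T_upper[of x] by (auto simp: lp_def intro: le_less_trans)

definition cauchy :: "(nat \<Rightarrow> 'a \<Rightarrow> real) \<Rightarrow> bool" where
  "cauchy = Metric_space.MCauchy V (pdist p space)"

lemma cauchy_iff:
  "cauchy u \<longleftrightarrow> range u \<subseteq> V \<and> (\<forall>e>0. \<exists>K. \<forall>m n. K \<le> m \<longrightarrow> K \<le> n \<longrightarrow> N (u m - u n) powr p < e)"
  unfolding cauchy_def Metric_space.MCauchy_def[OF metric] pdist_eq by simp

definition tends :: "(nat \<Rightarrow> 'a \<Rightarrow> real) \<Rightarrow> (nat \<Rightarrow> real) \<Rightarrow> bool" where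
  "tends u a \<longleftrightarrow> (\<lambda>n. lpn p (T (u n) - a)) \<longlonglongrightarrow> 0"

text \<open>The point of the completion that corresponds to the vector \<open>a\<close>;
  \<open>cls\<close> will be the inverse of the isomorphism.\<close>

definition cls :: "(nat \<Rightarrow> real) \<Rightarrow> (nat \<Rightarrow> 'a \<Rightarrow> real) set" where
  "cls a = {u. cauchy u \<and> tends u a}"

lemma cauchy_limit:
  assumes "cauchy u"
  obtains a where "a \<in> lp p" "tends u a"
proof (rule lp_complete[of "\<lambda>n. T (u n)"])
  have V: "u n \<in> V" for n using assms by (auto simp: cauchy_iff)
  show "T (u n) \<in> lp p" for n using V by (rule T_lp)
  show "\<exists>K. \<forall>m\<ge>K. \<forall>n\<ge>K. lpn p (T (u m) - T (u n)) < ennreal e" if "e > 0" for e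
  proof -
    from assms that C_pos obtain K where K: "\<And>m n. K \<le> m \<Longrightarrow> K \<le> n \<Longrightarrow> N (u m - u n) powr p < e / C"
      unfolding cauchy_iff by (metis divide_pos_pos)
    have "lpn p (T (u m) - T (u n)) < ennreal e" if "m \<ge> K" "n \<ge> K" for m n
    proof -
      have "C * N (u m - u n) powr p < e" using K[OF that] C_pos by (simp add: field_simps)
      then have "ennreal (C * N (u m - u n) powr p) < ennreal e"
        using C_pos by (simp add: ennreal_less_iff)
      then show ?thesis using T_upper[OF V_diff[OF V[of m] V[of n]]] by (simp add: T_diff V)
    qed
    then show ?thesis by blast
  qed
qed (use that in \<open>auto simp: tends_def\<close>)

lemma tends_cauchy:
  assumes V: "\<And>n. u n \<in> V" and t: "tends u a"
  shows "cauchy u"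
  unfolding cauchy_iff
proof safe
  fix e :: real assume e: "e > 0"
  have "eventually (\<lambda>n. lpn p (T (u n) - a) < ennreal (e / (2 * c))) sequentially"
    using t e c_pos unfolding tends_def by (intro order_tendstoD) auto
  then obtain K where K: "\<And>n. n \<ge> K \<Longrightarrow> lpn p (T (u n) - a) < ennreal (e / (2 * c))"
    by (auto simp: eventually_at_top_linorder)
  have "N (u m - u n) powr p < e" if "K \<le> m" "K \<le> n" for m n
  proof -
    have "ennreal (N (u m - u n) powr p) \<le> ennreal c * lpn p (T (u m) - T (u n))"
      using T_lower[OF V_diff[OF V[of m] V[of n]]] by (simp add: T_diff V)
    also have "\<dots> \<le> ennreal c * (lpn p (T (u m) - a) + lpn p (a - T (u n)))"
      by (intro mult_left_mono lpn_triangle) auto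
    also have "\<dots> < ennreal c * (ennreal (e / (2 * c)) + ennreal (e / (2 * c)))"
      using K[OF that(1)] K[OF that(2)] c_pos lpn_minus_commute[of a "T (u n)"]
      by (intro ennreal_mult_strict_left_mono add_strict_mono) auto
    also have "\<dots> = ennreal e"
      using c_pos e by (simp flip: ennreal_plus ennreal_mult add: field_simps)
    finally show ?thesis using e by (simp add: ennreal_less_iff)
  qed
  then show "\<exists>K. \<forall>m n. K \<le> m \<longrightarrow> K \<le> n \<longrightarrow> N (u m - u n) powr p < e" by blast
qed (use V in auto)

text \<open>No class is empty. Beyond the density of \<open>V\<close>, this is what makes
  \<open>cls\<close> injective and the unions over representatives in \<open>completion\<close>
  single classes.\<close>

lemma tends_exists:
  assumes "a \<in> lp p"
  obtains u where "u \<in> cls a"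
proof -
  have "\<forall>n. \<exists>x\<in>V. lpn p (a - T x) < ennreal (1 / real (Suc n))"
    using T_dense[OF assms] by auto
  then obtain u where u: "\<And>n. u n \<in> V" "\<And>n. lpn p (a - T (u n)) < ennreal (1 / real (Suc n))" by metis
  have "(\<lambda>n. ennreal (1 / real (Suc n))) \<longlonglongrightarrow> ennreal 0"
    by (intro tendsto_ennrealI LIMSEQ_Suc[OF lim_1_over_n])
  then have "(\<lambda>n. lpn p (a - T (u n))) \<longlonglongrightarrow> 0"
    using ennreal_squeeze_0[of "\<lambda>n. ennreal (1 / real (Suc n))" "\<lambda>n. lpn p (a - T (u n))"] less_imp_le[OF u(2)]
    by (simp del: of_nat_Suc)
  then have "tends u a" unfolding tends_def by (subst lpn_minus_commute)
  then show ?thesis using that tends_cauchy[of u a] u(1) by (auto simp: cls_def)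
qed

lemma cls_V: "u \<in> cls a \<Longrightarrow> u n \<in> V"
  by (auto simp: cls_def cauchy_iff)

text \<open>By the two bounds on \<open>T\<close>, the distance between \<open>u\<close> and
  \<open>v\<close> tends to 0 exactly when the \<open>lpn\<close> distance of their images does,
  that is, when the images share the limit \<open>a\<close>.\<close>

lemma cauchy_class_eq:
  assumes u: "u \<in> cls a"
  shows "cauchy_class p space u = cls a"
proof -
  have V: "u n \<in> V" for n using u by (rule cls_V)
  have tu: "(\<lambda>n. lpn p (T (u n) - a)) \<longlonglongrightarrow> 0" using u by (simp add: cls_def tends_def)
  have "(\<lambda>n. N (u n - v n) powr p) \<longlonglongrightarrow> 0 \<longleftrightarrow> tends v a" if v: "cauchy v" for v
  proof -
    have V': "v n \<in> V" for n using v by (auto simp: cauchy_iff)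
    have "(\<lambda>n. N (u n - v n) powr p) \<longlonglongrightarrow> 0 \<longleftrightarrow> (\<lambda>n. lpn p (T (u n) - T (v n))) \<longlonglongrightarrow> 0"
    proof
      assume "(\<lambda>n. N (u n - v n) powr p) \<longlonglongrightarrow> 0"
      then have "(\<lambda>n. ennreal (C * N (u n - v n) powr p)) \<longlonglongrightarrow> ennreal (C * 0)"
        by (intro tendsto_intros)
      then show "(\<lambda>n. lpn p (T (u n) - T (v n))) \<longlonglongrightarrow> 0"
        using T_upper[OF V_diff[OF V V']]
        by (simp add: ennreal_squeeze_0[of "\<lambda>n. ennreal (C * N (u n - v n) powr p)" "\<lambda>n. lpn p (T (u n) - T (v n))"] T_diff V V')
    next
      assume "(\<lambda>n. lpn p (T (u n) - T (v n))) \<longlonglongrightarrow> 0"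
      then have *: "(\<lambda>n. ennreal c * lpn p (T (u n) - T (v n))) \<longlonglongrightarrow> ennreal c * 0"
        by (intro ennreal_tendsto_cmult) auto
      have "(\<lambda>n. ennreal (N (u n - v n) powr p)) \<longlonglongrightarrow> ennreal 0"
        unfolding ennreal_0
        by (rule ennreal_squeeze_0[OF *[unfolded mult_zero_right]])
           (use T_lower[OF V_diff[OF V V']] in \<open>simp add: T_diff V V'\<close>)
      then show "(\<lambda>n. N (u n - v n) powr p) \<longlonglongrightarrow> 0"
        by (rule tendsto_ennrealD) (auto intro!: always_eventually)
    qed
    also have "\<dots> \<longleftrightarrow> tends v a"
    proof
      assume "(\<lambda>n. lpn p (T (u n) - T (v n))) \<longlonglongrightarrow> 0"
      from tendsto_add[OF this tu] show "tends v a"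
        unfolding tends_def add_0_left
        by (rule ennreal_squeeze_0) (subst lpn_minus_commute, rule lpn_triangle)
    next
      assume "tends v a"
      then have "(\<lambda>n. lpn p (T (v n) - a)) \<longlonglongrightarrow> 0" by (simp add: tends_def)
      from tendsto_add[OF tu this] show "(\<lambda>n. lpn p (T (u n) - T (v n))) \<longlonglongrightarrow> 0"
        unfolding add_0_left
        by (rule ennreal_squeeze_0) (subst (3) lpn_minus_commute, rule lpn_triangle)
    qed
    finally show ?thesis .
  qed
  then show ?thesis
    unfolding cauchy_class_def cls_def by (auto simp: pdist_eq cauchy_def)
qed

lemma cls_unique: "u \<in> cls a \<Longrightarrow> u \<in> cls b \<Longrightarrow> a = b"
  using lpn_tendsto_unique by (auto simp: cls_def tends_def)

lemma inj_cls: "inj_on cls (lp p)"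
  by (rule inj_onI) (metis tends_exists cls_unique)

lemma carrier_completion: "pcarrier (completion p space) = cls ` lp p"
proof -
  have "cauchy_class p space ` {u. cauchy u} = cls ` lp p"
  proof safe
    fix u assume u: "cauchy u"
    then obtain a where "a \<in> lp p" "tends u a" by (rule cauchy_limit)
    then show "cauchy_class p space u \<in> cls ` lp p"
      using u cauchy_class_eq[of u a] by (simp add: cls_def)
  next
    fix a :: "nat \<Rightarrow> real" assume a: "a \<in> lp p"
    then obtain u where "u \<in> cls a" by (rule tends_exists)
    then show "cls a \<in> cauchy_class p space ` {u. cauchy u}"
      using cauchy_class_eq[of u a] by (intro image_eqI[of _ _ u]) (simp_all add: cls_def)
  qed
  then show ?thesis by (simp add: completion_def cauchy_def)
qed

lemma cls_add:
  assumes "u \<in> cls a" "v \<in> cls b"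
  shows "(\<lambda>n. u n + v n) \<in> cls (a + b)"
proof -
  have V: "u n \<in> V" "v n \<in> V" for n using assms cls_V by auto
  have *: "T (u n + v n) - (a + b) = (T (u n) - a) + (T (v n) - b)" for n
    using V by (simp add: T_add algebra_simps)
  have "(\<lambda>n. lpn p (T (u n) - a) + lpn p (T (v n) - b)) \<longlonglongrightarrow> 0 + 0"
    using assms by (intro tendsto_add) (auto simp: cls_def tends_def)
  then have "tends (\<lambda>n. u n + v n) (a + b)" unfolding tends_def
    unfolding * add_0_left by (rule ennreal_squeeze_0) (rule lpn_add)
  then show ?thesis using tends_cauchy[of "\<lambda>n. u n + v n"] V V_add by (auto simp: cls_def)
qed

lemma cls_scale:
  assumes "u \<in> cls a"
  shows "(\<lambda>n. fscale r (u n)) \<in> cls (fscale r a)"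
proof -
  have V: "u n \<in> V" for n using assms cls_V by auto
  have *: "T (fscale r (u n)) - fscale r a = fscale r (T (u n) - a)" for n
    using V by (simp add: T_scale fscale_diff)
  have "(\<lambda>n. ennreal (\<bar>r\<bar> powr p) * lpn p (T (u n) - a)) \<longlonglongrightarrow> ennreal (\<bar>r\<bar> powr p) * 0"
    using assms by (intro ennreal_tendsto_cmult) (auto simp: cls_def tends_def)
  then have "tends (\<lambda>n. fscale r (u n)) (fscale r a)"
    unfolding tends_def * lpn_scale by simp
  then show ?thesis using tends_cauchy[of "\<lambda>n. fscale r (u n)"] V V_scale by (auto simp: cls_def)
qed

lemma padd_completion:
  assumes "a \<in> lp p" "b \<in> lp p"
  shows "padd (completion p space) (cls a) (cls b) = cls (a + b)"
proof -
  obtain u v where "u \<in> cls a" "v \<in> cls b" using assms tends_exists by metis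
  moreover have "cauchy_class p space (\<lambda>n. padd space (u n) (v n)) = cls (a + b)"
    if "u \<in> cls a" "v \<in> cls b" for u v
    using cauchy_class_eq[OF cls_add[OF that]] by simp
  ultimately show ?thesis by (auto simp: completion_def simp del: space_sel)
qed

lemma pscale_completion:
  assumes "a \<in> lp p"
  shows "pscale (completion p space) r (cls a) = cls (fscale r a)"
proof -
  obtain u where "u \<in> cls a" using assms tends_exists by metis
  moreover have "cauchy_class p space (\<lambda>n. pscale space r (u n)) = cls (fscale r a)"
    if "u \<in> cls a" for u
    using cauchy_class_eq[OF cls_scale[OF that]] by simp
  ultimately show ?thesis by (auto simp: completion_def simp del: space_sel)
qed

lemma N_powr_diff:
  assumes "x \<in> V" "y \<in> V"
  shows "\<bar>N x powr p - N y powr p\<bar> \<le> N (x - y) powr p"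
  using N_triangle[OF V_diff[OF assms] assms(2)] N_triangle[OF V_diff[OF assms(2,1)] assms(1)]
    N_uminus[of "x - y"] by simp

lemma pnorm_completion:
  assumes a: "a \<in> lp p"
  shows "lpn p a \<le> ennreal (C * pnorm (completion p space) (cls a) powr p)"
    and "ennreal (pnorm (completion p space) (cls a) powr p) \<le> ennreal c * lpn p a"
    and "pnorm (completion p space) (cls a) \<ge> 0"
proof -
  obtain u where u: "u \<in> cls a" using a tends_exists by metis
  have V: "u n \<in> V" for n using u by (rule cls_V)
  \<comment> \<open>The limit is taken of \<open>p\<close>-th powers, where the reverse triangle
    inequality is available; the root is extracted afterwards.\<close>
  have "Cauchy (\<lambda>n. N (u n) powr p)"
  proof (rule CauchyI)
    fix e :: real assume e: "e > 0"
    have "cauchy u" using u by (simp add: cls_def)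
    then obtain K where "\<And>m n. K \<le> m \<Longrightarrow> K \<le> n \<Longrightarrow> N (u m - u n) powr p < e"
      using e unfolding cauchy_iff by meson
    then show "\<exists>K. \<forall>m\<ge>K. \<forall>n\<ge>K. norm (N (u m) powr p - N (u n) powr p) < e"
      using N_powr_diff[OF V V] by (metis le_less_trans real_norm_def)
  qed
  then obtain s where s: "(\<lambda>n. N (u n) powr p) \<longlonglongrightarrow> s"
    by (auto simp: Cauchy_convergent_iff convergent_def)
  have s0: "s \<ge> 0" using s by (rule LIMSEQ_le_const) auto
  define l where "l = s powr (1 / p)"
  have lp: "l powr p = s" using s0 p_pos by (simp add: l_def powr_powr)
  have lim: "(\<lambda>n. N (v n)) \<longlonglongrightarrow> l" if v: "v \<in> cls a" for v
  proof -
    have V': "v n \<in> V" for n using v by (rule cls_V)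
    have "v \<in> cauchy_class p space u" using v cauchy_class_eq[OF u] by simp
    then have "(\<lambda>n. N (u n - v n) powr p) \<longlonglongrightarrow> 0"
      by (simp add: cauchy_class_def pdist_eq)
    then have "(\<lambda>n. N (u n) powr p - N (v n) powr p) \<longlonglongrightarrow> 0"
      by (rule Lim_null_comparison[rotated]) (auto intro!: always_eventually N_powr_diff V V')
    from tendsto_diff[OF s this] have "(\<lambda>n. N (v n) powr p) \<longlonglongrightarrow> s" by simp
    then have "(\<lambda>n. (N (v n) powr p) powr (1 / p)) \<longlonglongrightarrow> s powr (1 / p)"
      using p_pos by (intro tendsto_powr' tendsto_const) auto
    then show ?thesis using p_pos N_nonneg[OF V'] by (simp add: powr_powr l_def)
  qed
  have pn: "pnorm (completion p space) (cls a) = l"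
    unfolding completion_def
    by (simp, rule the_equality) (use lim u LIMSEQ_unique in blast)+
  show "pnorm (completion p space) (cls a) \<ge> 0" by (simp add: pn l_def)
  have t: "(\<lambda>n. lpn p (T (u n) - a)) \<longlonglongrightarrow> 0" using u by (simp add: cls_def tends_def)
  have "(\<lambda>n. lpn p (T (u n) - a) + ennreal (C * N (u n) powr p)) \<longlonglongrightarrow> 0 + ennreal (C * s)"
    by (intro tendsto_add t tendsto_intros s)
  moreover have "lpn p a \<le> lpn p (T (u n) - a) + ennreal (C * N (u n) powr p)" for n
    using lpn_add[of "a - T (u n)" "T (u n)"] T_upper[OF V[of n]] lpn_minus_commute[of a "T (u n)"]
    by (auto intro: order_trans add_left_mono)
  ultimately show "lpn p a \<le> ennreal (C * pnorm (completion p space) (cls a) powr p)"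
    unfolding pn lp by (intro tendsto_lowerbound[of _ "ennreal (C * s)"]) auto
  have "(\<lambda>n. ennreal c * (lpn p (T (u n) - a) + lpn p a)) \<longlonglongrightarrow> ennreal c * (0 + lpn p a)"
    by (intro ennreal_tendsto_cmult tendsto_add t tendsto_const) auto
  moreover have "ennreal (N (u n) powr p) \<le> ennreal c * (lpn p (T (u n) - a) + lpn p a)" for n
    by (rule order_trans[OF T_lower[OF V]]) (use lpn_add[of "T (u n) - a" a] in \<open>auto intro: mult_left_mono\<close>)
  moreover have "(\<lambda>n. ennreal (N (u n) powr p)) \<longlonglongrightarrow> ennreal s"
    by (intro tendsto_ennrealI s)
  ultimately show "ennreal (pnorm (completion p space) (cls a) powr p) \<le> ennreal c * lpn p a"
    unfolding pn lp by (intro tendsto_le[of sequentially]) auto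
qed

end

context exponent
begin

lemma
  fixes a :: "nat \<Rightarrow> real"
  shows lp_iff_summable: "a \<in> lp p \<longleftrightarrow> summable (\<lambda>n. \<bar>a n\<bar> powr p)"
    and lpn_nat: "a \<in> lp p \<Longrightarrow> lpn p a = ennreal (\<Sum>n. \<bar>a n\<bar> powr p)"
proof -
  have eq: "lpn p a = (\<Sum>n. ennreal (\<bar>a n\<bar> powr p))" for a :: "nat \<Rightarrow> real"
    by (simp add: lpn_def nn_integral_count_space_nat)
  show *: "a \<in> lp p \<longleftrightarrow> summable (\<lambda>n. \<bar>a n\<bar> powr p)"
  proof
    assume "a \<in> lp p"
    then show "summable (\<lambda>n. \<bar>a n\<bar> powr p)"
      by (intro summable_suminf_not_top) (auto simp: lp_def eq)
  next
    assume "summable (\<lambda>n. \<bar>a n\<bar> powr p)"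
    then show "a \<in> lp p" by (simp add: lp_def eq suminf_ennreal2)
  qed
  show "lpn p a = ennreal (\<Sum>n. \<bar>a n\<bar> powr p)" if "a \<in> lp p"
    using that by (simp add: * eq suminf_ennreal2)
qed

end

lemma (in lp_embedding) isomorphic_lp: "isomorphic (completion p space) (lp_space p)"
proof -
  define S where "S = inv_into (lp p) cls"
  have car: "pcarrier (lp_space p) = (lp p :: (nat \<Rightarrow> real) set)"
    by (auto simp: lp_space_def lp_iff_summable)
  have S: "S (cls a) = a" if "a \<in> lp p" for a
    using that inj_cls by (simp add: S_def inv_into_f_f)
  have bij: "bij_betw S (pcarrier (completion p space)) (pcarrier (lp_space p))"
    unfolding S_def carrier_completion car by (intro bij_betw_inv_into inj_on_imp_bij_betw inj_cls)
  have S_inv: "inv_into (pcarrier (completion p space)) S a = cls a" if "a \<in> lp p" for a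
    using bij that by (intro inv_into_f_eq) (auto simp: bij_betw_def carrier_completion S)
  have nrm: "pnorm (lp_space p) a = enn2real (lpn p a) powr (1 / p)" if "a \<in> lp p" for a :: "nat \<Rightarrow> real"
    using that by (simp add: lp_space_def lpn_nat suminf_nonneg lp_iff_summable)
  have fin: "lpn p a = ennreal (enn2real (lpn p a))" if "a \<in> lp p" for a :: "nat \<Rightarrow> real"
    using that by (simp add: lp_def)
  have U: "pnorm (lp_space p) a \<le> C powr (1 / p) * pnorm (completion p space) (cls a)" if a: "a \<in> lp p" for a
  proof -
    have "enn2real (lpn p a) \<le> C * pnorm (completion p space) (cls a) powr p"
      using pnorm_completion(1)[OF a] C_pos by (subst (asm) fin[OF a]) (simp add: ennreal_le_iff)
    then have "enn2real (lpn p a) powr (1 / p) \<le> (C * pnorm (completion p space) (cls a) powr p) powr (1 / p)"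
      using p_pos by (intro powr_mono2) auto
    also have "\<dots> = C powr (1 / p) * pnorm (completion p space) (cls a)"
      using p_pos C_pos pnorm_completion(3)[OF a] by (simp add: powr_mult powr_powr)
    finally show ?thesis by (simp add: nrm[OF a])
  qed
  have L: "pnorm (completion p space) (cls a) \<le> c powr (1 / p) * pnorm (lp_space p) a" if a: "a \<in> lp p" for a
  proof -
    have "ennreal (pnorm (completion p space) (cls a) powr p) \<le> ennreal (c * enn2real (lpn p a))"
      using pnorm_completion(2)[OF a] c_pos by (subst (asm) fin[OF a]) (simp add: ennreal_mult)
    then have "pnorm (completion p space) (cls a) powr p \<le> c * enn2real (lpn p a)"
      using c_pos by (simp add: ennreal_le_iff)
    then have "(pnorm (completion p space) (cls a) powr p) powr (1 / p) \<le> (c * enn2real (lpn p a)) powr (1 / p)"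
      using p_pos by (intro powr_mono2) auto
    then show ?thesis
      using p_pos c_pos pnorm_completion(3)[OF a] by (simp add: powr_mult powr_powr nrm[OF a])
  qed
  have add: "padd (lp_space p) a b = a + b" and scale: "pscale (lp_space p) r a = fscale r a"
    for a b :: "nat \<Rightarrow> real" and r
    by (auto simp: lp_space_def fun_eq_iff)
  show ?thesis
    unfolding isomorphic_def
  proof (intro exI conjI ballI allI)
    show "bij_betw S (pcarrier (completion p space)) (pcarrier (lp_space p))" by (fact bij)
  next
    fix x y assume "x \<in> pcarrier (completion p space)" "y \<in> pcarrier (completion p space)"
    then show "S (padd (completion p space) x y) = padd (lp_space p) (S x) (S y)"
      by (auto simp: carrier_completion S padd_completion lp_add add)
  next
    fix r x assume "x \<in> pcarrier (completion p space)"
    then show "S (pscale (completion p space) r x) = pscale (lp_space p) r (S x)"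
      by (auto simp: carrier_completion S pscale_completion lp_scale scale)
  next
    fix x assume "x \<in> pcarrier (completion p space)"
    then show "pnorm (lp_space p) (S x) \<le> C powr (1 / p) * pnorm (completion p space) x"
      using U by (auto simp: carrier_completion S)
  next
    fix a assume "a \<in> pcarrier (lp_space p)"
    then show "pnorm (completion p space) (inv_into (pcarrier (completion p space)) S a)
        \<le> c powr (1 / p) * pnorm (lp_space p) a"
      using L by (simp add: car S_inv)
  qed
qed

section \<open>The free p-norm\<close>

lemma lin_on_add: "lin_on V L \<Longrightarrow> x \<in> V \<Longrightarrow> y \<in> V \<Longrightarrow> L (x + y) = L x + L y"
  and lin_on_scale: "lin_on V L \<Longrightarrow> x \<in> V \<Longrightarrow> L (fscale c x) = fscale c (L x)"
  by (auto simp: lin_on_def)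

definition finsupp :: "('a \<Rightarrow> real) set" where
  "finsupp = {m. finite {x. m x \<noteq> 0}}"

text \<open>Linear extension from a basis. Over an infinite support the sum is 0 by convention, so
  linearity is asserted on \<open>finsupp\<close>.\<close>

definition fext :: "('a \<Rightarrow> 'i \<Rightarrow> real) \<Rightarrow> ('a \<Rightarrow> real) \<Rightarrow> 'i \<Rightarrow> real" where
  "fext f m = (\<Sum>x | m x \<noteq> 0. fscale (m x) (f x))"

lemma fext_eq:
  assumes "finite A" "{x. m x \<noteq> 0} \<subseteq> A"
  shows "fext f m = (\<Sum>x\<in>A. fscale (m x) (f x))"
  unfolding fext_def using assms by (intro sum.mono_neutral_left) auto

lemma finsupp_add: "x \<in> finsupp \<Longrightarrow> y \<in> finsupp \<Longrightarrow> x + y \<in> finsupp"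
proof -
  assume "x \<in> finsupp" "y \<in> finsupp"
  moreover have "{i. (x + y) i \<noteq> 0} \<subseteq> {i. x i \<noteq> 0} \<union> {i. y i \<noteq> 0}" by auto
  ultimately show "x + y \<in> finsupp" unfolding finsupp_def mem_Collect_eq
    by (meson finite_UnI finite_subset)
qed

lemma finsupp_scale: "x \<in> finsupp \<Longrightarrow> fscale c x \<in> finsupp"
  unfolding finsupp_def by (auto intro: finite_subset[of _ "{i. x i \<noteq> 0}"])

lemma fext_lin: "lin_on finsupp (fext f)" for f :: "'a \<Rightarrow> 'i \<Rightarrow> real"
  unfolding lin_on_def
proof (intro conjI ballI allI)
  fix x y :: "'a \<Rightarrow> real" assume xy: "x \<in> finsupp" "y \<in> finsupp"
  define A where "A = {w. x w \<noteq> 0} \<union> {w. y w \<noteq> 0}"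
  have A: "finite A" using xy by (auto simp: A_def finsupp_def)
  have "fext f (x + y) = (\<Sum>w\<in>A. fscale ((x + y) w) (f w))"
    by (rule fext_eq[OF A]) (auto simp: A_def)
  also have "\<dots> = (\<Sum>w\<in>A. fscale (x w) (f w)) + (\<Sum>w\<in>A. fscale (y w) (f w))"
    by (simp add: fun_eq_iff sum_fun_apply sum.distrib[symmetric] algebra_simps)
  also have "\<dots> = fext f x + fext f y"
    using fext_eq[OF A, of x f] fext_eq[OF A, of y f] by (auto simp: A_def)
  finally show "fext f (x + y) = fext f x + fext f y" .
next
  fix c and x :: "'a \<Rightarrow> real" assume x: "x \<in> finsupp"
  have A: "finite {w. x w \<noteq> 0}" using x by (auto simp: finsupp_def)
  have "fext f (fscale c x) = (\<Sum>w | x w \<noteq> 0. fscale (fscale c x w) (f w))"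
    by (rule fext_eq[OF A]) auto
  also have "\<dots> = fscale c (fext f x)"
    by (simp add: fext_def fun_eq_iff sum_fun_apply sum_distrib_left mult.assoc)
  finally show "fext f (fscale c x) = fscale c (fext f x)" .
qed

locale pfree = exponent p + Metric_space M \<sigma> for p :: real and M :: "'a set" and \<sigma> +
  fixes z :: 'a
  assumes z_in [simp]: "z \<in> M"
begin

definition V :: "('a \<Rightarrow> real) set" where
  "V = {m. finite {x. m x \<noteq> 0} \<and> {x. m x \<noteq> 0} \<subseteq> M - {z}}"

abbreviation dl :: "'a \<Rightarrow> 'a \<Rightarrow> real" where
  "dl \<equiv> delta z"

definition mol :: "'a \<Rightarrow> 'a \<Rightarrow> 'a \<Rightarrow> real" where
  "mol x y = fscale (1 / \<sigma> x y) (dl x - dl y)"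

text \<open>The \<open>p\<close>-th power of the free norm, introduced because it is subadditive;
  the estimates in the free space are made for \<open>G\<close>.\<close>

definition G :: "('a \<Rightarrow> real) \<Rightarrow> real" where
  "G m = free_pnorm p M \<sigma> z m powr p"

definition rep_values :: "('a \<Rightarrow> real) \<Rightarrow> real set" where
  "rep_values m = {s. \<exists>(n::nat) a x y. (\<forall>i<n. x i \<in> M \<and> y i \<in> M \<and> x i \<noteq> y i) \<and>
     m = (\<Sum>i<n. fscale (a i) (mol (x i) (y i))) \<and> s = (\<Sum>i<n. \<bar>a i\<bar> powr p)}"

lemma free_pnorm_eq: "free_pnorm p M \<sigma> z m = Inf ((\<lambda>s. s powr (1 / p)) ` rep_values m)"
proof -
  have *: "(\<lambda>w. \<Sum>i<n. a i * ((delta z (x i) w - delta z (y i) w) / \<sigma> (x i) (y i)))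
      = (\<Sum>i<n. fscale (a i) (mol (x i) (y i)))" for n :: nat and a x y
    by (simp add: fun_eq_iff sum_fun_apply mol_def)
  show ?thesis
    unfolding free_pnorm_def rep_values_def * image_def by (rule arg_cong[where f=Inf]) blast
qed

lemma rep_valuesI:
  fixes n :: nat
  assumes "\<And>i. i < n \<Longrightarrow> x i \<in> M \<and> y i \<in> M \<and> x i \<noteq> y i"
    and "m = (\<Sum>i<n. fscale (a i) (mol (x i) (y i)))"
  shows "(\<Sum>i<n. \<bar>a i\<bar> powr p) \<in> rep_values m"
  unfolding rep_values_def using assms by blast

lemma rep_values_nonneg: "s \<in> rep_values m \<Longrightarrow> 0 \<le> s"
  by (auto simp: rep_values_def intro!: sum_nonneg)

lemma V_zero: "0 \<in> V"
  by (auto simp: V_def)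

lemma V_add: "x \<in> V \<Longrightarrow> y \<in> V \<Longrightarrow> x + y \<in> V"
proof -
  assume "x \<in> V" "y \<in> V"
  moreover have "{i. (x + y) i \<noteq> 0} \<subseteq> {i. x i \<noteq> 0} \<union> {i. y i \<noteq> 0}" by auto
  ultimately show "x + y \<in> V" unfolding V_def mem_Collect_eq
    by (meson Un_least finite_UnI finite_subset subset_trans)
qed

lemma V_scale: "x \<in> V \<Longrightarrow> fscale c x \<in> V"
  unfolding V_def by (auto intro: finite_subset[of _ "{i. x i \<noteq> 0}"])

lemma V_diff: "x \<in> V \<Longrightarrow> y \<in> V \<Longrightarrow> x - y \<in> V"
  using V_add[of x "fscale (-1) y"] V_scale[of y "-1"] by (simp add: fscale_def fun_diff_def plus_fun_def)

lemma V_sum: "(\<And>i. i \<in> A \<Longrightarrow> f i \<in> V) \<Longrightarrow> sum f A \<in> V"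
  by (induction A rule: infinite_finite_induct) (auto simp: V_zero V_add)

lemma dl_V: "x \<in> M \<Longrightarrow> dl x \<in> V"
  by (auto simp: V_def delta_def)

lemma dl_z [simp]: "dl z = 0"
  by (auto simp: delta_def)

lemma mol_V: "x \<in> M \<Longrightarrow> y \<in> M \<Longrightarrow> mol x y \<in> V"
  by (simp add: mol_def V_scale V_diff dl_V)

text \<open>Also valid for \<open>x = y\<close>, where both sides are 0. This matters because net
  points of neighbouring scales may coincide.\<close>

lemma scale_mol: "x \<in> M \<Longrightarrow> y \<in> M \<Longrightarrow> fscale (\<sigma> x y) (mol x y) = dl x - dl y"
  by (cases "x = y") (auto simp: mol_def)

lemma V_expand:
  assumes "m \<in> V" "finite A" "{x. m x \<noteq> 0} \<subseteq> A"
  shows "m = (\<Sum>x\<in>A. fscale (m x) (dl x))"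
proof
  fix w
  have "(\<Sum>x\<in>A. fscale (m x) (dl x)) w = (\<Sum>x\<in>A. if x = w then m x * (if w = z then 0 else 1) else 0)"
    unfolding sum_fun_apply by (intro sum.cong) (auto simp: delta_def)
  also have "\<dots> = m w" using assms by (auto simp: V_def)
  finally show "m w = (\<Sum>x\<in>A. fscale (m x) (dl x)) w" by simp
qed

text \<open>Representations in \<open>free_pnorm\<close> are indexed by an initial segment and use
  distinct points. An arbitrary finite family is brought to that form by dropping the terms with
  \<open>x t = y t\<close>, whose molecule is 0, and enumerating the others.\<close>

lemma sum_rep_value:
  assumes F: "finite F" and M: "\<And>t. t \<in> F \<Longrightarrow> x t \<in> M \<and> y t \<in> M"
  shows "\<exists>s\<in>rep_values (\<Sum>t\<in>F. fscale (a t) (mol (x t) (y t))). s \<le> (\<Sum>t\<in>F. \<bar>a t\<bar> powr p)"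
proof -
  define F' where "F' = {t\<in>F. x t \<noteq> y t}"
  have F': "finite F'" "F' \<subseteq> F" using F by (auto simp: F'_def)
  obtain h where h: "bij_betw h {0..<card F'} F'" using ex_bij_betw_nat_finite[OF F'(1)] by blast
  have h: "bij_betw h {..<card F'} F'" using h by (simp add: atLeast0LessThan)
  have hF: "h i \<in> F'" if "i < card F'" for i using h that by (auto simp: bij_betw_def)
  have "(\<Sum>t\<in>F. fscale (a t) (mol (x t) (y t))) = (\<Sum>t\<in>F'. fscale (a t) (mol (x t) (y t)))"
    by (rule sum.mono_neutral_right) (use F in \<open>auto simp: F'_def mol_def\<close>)
  also have "\<dots> = (\<Sum>i<card F'. fscale (a (h i)) (mol (x (h i)) (y (h i))))"
    by (rule sum.reindex_bij_betw[OF h, symmetric])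
  finally have "(\<Sum>i<card F'. \<bar>a (h i)\<bar> powr p) \<in> rep_values (\<Sum>t\<in>F. fscale (a t) (mol (x t) (y t)))"
    using hF M by (intro rep_valuesI) (auto simp: F'_def)
  moreover have "(\<Sum>i<card F'. \<bar>a (h i)\<bar> powr p) = (\<Sum>t\<in>F'. \<bar>a t\<bar> powr p)"
    by (rule sum.reindex_bij_betw[OF h])
  moreover have "\<dots> \<le> (\<Sum>t\<in>F. \<bar>a t\<bar> powr p)" using F F' by (intro sum_mono2) auto
  ultimately show ?thesis by metis
qed

lemma G_le_sum:
  assumes F: "finite F" and M: "\<And>t. t \<in> F \<Longrightarrow> x t \<in> M \<and> y t \<in> M"
  shows "G (\<Sum>t\<in>F. fscale (a t) (mol (x t) (y t))) \<le> (\<Sum>t\<in>F. \<bar>a t\<bar> powr p)"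
proof -
  let ?m = "\<Sum>t\<in>F. fscale (a t) (mol (x t) (y t))"
  obtain s where s: "s \<in> rep_values ?m" "s \<le> (\<Sum>t\<in>F. \<bar>a t\<bar> powr p)"
    using sum_rep_value[OF F M, of "\<lambda>t. t" a] by blast
  have "free_pnorm p M \<sigma> z ?m \<le> s powr (1 / p)"
    unfolding free_pnorm_eq using s(1) by (intro cInf_lower) (auto intro!: bdd_belowI[of _ 0])
  moreover have "0 \<le> free_pnorm p M \<sigma> z ?m"
    unfolding free_pnorm_eq using s(1) by (intro cInf_greatest) auto
  ultimately have "G ?m \<le> (s powr (1 / p)) powr p"
    unfolding G_def using p_pos by (intro powr_mono2) auto
  also have "\<dots> = s" using p_pos rep_values_nonneg[OF s(1)] by (simp add: powr_powr)
  finally show ?thesis using s(2) by simp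
qed

text \<open>Guards the infimum against the empty set. The representation joins every support point
  to the base point, using \<open>dl z = 0\<close>.\<close>

lemma rep_values_nonempty:
  assumes "m \<in> V"
  shows "rep_values m \<noteq> {}"
proof -
  let ?F = "{x. m x \<noteq> 0}"
  have F: "finite ?F" "?F \<subseteq> M" using assms by (auto simp: V_def)
  have "m = (\<Sum>x\<in>?F. fscale (m x) (dl x))" by (rule V_expand) (use assms F in auto)
  also have "\<dots> = (\<Sum>x\<in>?F. fscale (m x * \<sigma> x z) (mol x z))"
  proof (rule sum.cong[OF refl])
    fix x assume "x \<in> ?F"
    then have "fscale (\<sigma> x z) (mol x z) = dl x" using scale_mol[of x z] F by auto
    then show "fscale (m x) (dl x) = fscale (m x * \<sigma> x z) (mol x z)" by (metis fscale_simps(1))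
  qed
  finally have *: "m = \<dots>" .
  show ?thesis using sum_rep_value[OF F(1), of "\<lambda>x. x" "\<lambda>_. z" "\<lambda>x. m x * \<sigma> x z"] F(2)
    by (subst *) auto
qed

lemma pnorm_nonneg: "m \<in> V \<Longrightarrow> 0 \<le> free_pnorm p M \<sigma> z m"
  unfolding free_pnorm_eq using rep_values_nonempty by (intro cInf_greatest) auto

lemma G_approx:
  assumes m: "m \<in> V" and e: "e > 0"
  shows "\<exists>(n::nat) a x y. (\<forall>i<n. x i \<in> M \<and> y i \<in> M \<and> x i \<noteq> y i) \<and>
    m = (\<Sum>i<n. fscale (a i) (mol (x i) (y i))) \<and> (\<Sum>i<n. \<bar>a i\<bar> powr p) < G m + e"
proof -
  have "free_pnorm p M \<sigma> z m = G m powr (1 / p)"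
    using p_pos pnorm_nonneg[OF m] by (simp add: G_def powr_powr)
  also have "\<dots> < (G m + e) powr (1 / p)"
    using p_pos e by (intro powr_less_mono2) (auto simp: G_def)
  finally have "Inf ((\<lambda>s. s powr (1 / p)) ` rep_values m) < (G m + e) powr (1 / p)"
    unfolding free_pnorm_eq .
  from cInf_lessD[OF _ this] rep_values_nonempty[OF m]
  obtain s where s: "s \<in> rep_values m" "s powr (1 / p) < (G m + e) powr (1 / p)" by auto
  have "s < G m + e"
  proof (rule ccontr)
    assume "\<not> s < G m + e"
    then have "(G m + e) powr (1 / p) \<le> s powr (1 / p)"
      using p_pos e by (intro powr_mono2) (auto simp: G_def)
    then show False using s(2) by simp
  qed
  then show ?thesis using s(1) unfolding rep_values_def mem_Collect_eq by blast
qed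

lemma G_nonneg [simp]: "0 \<le> G m"
  by (simp add: G_def)

lemma G_add:
  assumes "m \<in> V" "m' \<in> V"
  shows "G (m + m') \<le> G m + G m'"
proof (rule field_le_epsilon)
  fix e :: real assume e: "e > 0"
  then have e2: "e / 2 > 0" by simp
  obtain n :: nat and a x y where 1: "\<forall>i<n. x i \<in> M \<and> y i \<in> M \<and> x i \<noteq> y i"
    "m = (\<Sum>i<n. fscale (a i) (mol (x i) (y i)))" "(\<Sum>i<n. \<bar>a i\<bar> powr p) < G m + e / 2"
    using G_approx[OF assms(1) e2] by blast
  obtain n' :: nat and a' x' y' where 2: "\<forall>i<n'. x' i \<in> M \<and> y' i \<in> M \<and> x' i \<noteq> y' i"
    "m' = (\<Sum>i<n'. fscale (a' i) (mol (x' i) (y' i)))" "(\<Sum>i<n'. \<bar>a' i\<bar> powr p) < G m' + e / 2"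
    using G_approx[OF assms(2) e2] by blast
  let ?F = "{..<n} <+> {..<n'}"
  have "m + m' = (\<Sum>t\<in>?F. fscale (case_sum a a' t) (mol (case_sum x x' t) (case_sum y y' t)))"
    by (simp add: sum.Plus 1(2)[symmetric] 2(2)[symmetric])
  moreover have "G \<dots> \<le> (\<Sum>t\<in>?F. \<bar>case_sum a a' t\<bar> powr p)"
    by (rule G_le_sum) (use 1(1) 2(1) in auto)
  moreover have "\<dots> = (\<Sum>i<n. \<bar>a i\<bar> powr p) + (\<Sum>i<n'. \<bar>a' i\<bar> powr p)"
    by (simp add: sum.Plus)
  ultimately show "G (m + m') \<le> G m + G m' + e" using 1(3) 2(3) by simp
qed

lemma G_zero [simp]: "G 0 = 0"
proof -
  have "G 0 \<le> 0" using G_le_sum[of "{}" "\<lambda>_. z" "\<lambda>_. z"] by simp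
  then show ?thesis using G_nonneg[of 0] by linarith
qed

lemma G_scale_le:
  assumes "m \<in> V"
  shows "G (fscale c m) \<le> \<bar>c\<bar> powr p * G m"
proof (cases "c = 0")
  case False
  show ?thesis
  proof (rule field_le_epsilon)
    fix e :: real assume e: "e > 0"
    then have e2: "e / \<bar>c\<bar> powr p > 0" using False by simp
    obtain n :: nat and a x y where 1: "\<forall>i<n. x i \<in> M \<and> y i \<in> M \<and> x i \<noteq> y i"
      "m = (\<Sum>i<n. fscale (a i) (mol (x i) (y i)))" "(\<Sum>i<n. \<bar>a i\<bar> powr p) < G m + e / \<bar>c\<bar> powr p"
      using G_approx[OF assms e2] by blast
    have "fscale c m = (\<Sum>i<n. fscale (c * a i) (mol (x i) (y i)))"
      unfolding 1(2) by (simp add: fun_eq_iff sum_fun_apply sum_distrib_left mult.assoc)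
    moreover have "G \<dots> \<le> (\<Sum>i<n. \<bar>c * a i\<bar> powr p)"
      by (rule G_le_sum) (use 1(1) in auto)
    moreover have "\<dots> = \<bar>c\<bar> powr p * (\<Sum>i<n. \<bar>a i\<bar> powr p)"
      by (simp add: abs_mult powr_mult sum_distrib_left)
    moreover have "\<dots> \<le> \<bar>c\<bar> powr p * (G m + e / \<bar>c\<bar> powr p)"
      using 1(3) by (intro mult_left_mono) auto
    moreover have "\<dots> = \<bar>c\<bar> powr p * G m + e" using False by (simp add: distrib_left)
    ultimately show "G (fscale c m) \<le> \<bar>c\<bar> powr p * G m + e" by simp
  qed
qed (use p_pos in auto)

lemma G_scale:
  assumes "m \<in> V"
  shows "G (fscale c m) = \<bar>c\<bar> powr p * G m"
proof (cases "c = 0")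
  case False
  have "G m \<le> \<bar>1 / c\<bar> powr p * G (fscale c m)"
    using G_scale_le[OF V_scale[OF assms, of c], of "1 / c"] False by simp
  then have "\<bar>c\<bar> powr p * G m \<le> G (fscale c m)"
    using False by (simp add: powr_divide field_simps)
  then show ?thesis using G_scale_le[OF assms, of c] by simp
qed (use p_pos in auto)

lemma pnorm_uminus: "free_pnorm p M \<sigma> z (- m) = free_pnorm p M \<sigma> z m"
proof -
  have "rep_values m \<subseteq> rep_values (- m)" for m
  proof
    fix s assume "s \<in> rep_values m"
    then obtain n :: nat and a x y where 1: "\<forall>i<n. x i \<in> M \<and> y i \<in> M \<and> x i \<noteq> y i"
      "m = (\<Sum>i<n. fscale (a i) (mol (x i) (y i)))" "s = (\<Sum>i<n. \<bar>a i\<bar> powr p)"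
      unfolding rep_values_def by blast
    have "- m = (\<Sum>i<n. fscale (- a i) (mol (x i) (y i)))"
      unfolding 1(2) by (simp add: fun_eq_iff sum_fun_apply sum_negf)
    then show "s \<in> rep_values (- m)"
      using 1(1,3) rep_valuesI[of n x y "- m" "\<lambda>i. - a i"] by simp
  qed
  from this[of m] this[of "- m"] have "rep_values (- m) = rep_values m" by auto
  then show ?thesis by (simp add: free_pnorm_eq)
qed

lemma G_diff: "m \<in> V \<Longrightarrow> m' \<in> V \<Longrightarrow> G (m - m') \<le> G m + G m'"
  using G_add[of m "fscale (-1) m'"] G_scale[of m' "-1"] V_scale[of m' "-1"]
  by (simp add: fscale_def fun_diff_def plus_fun_def)

lemma G_sum: "(\<And>i. i \<in> A \<Longrightarrow> f i \<in> V) \<Longrightarrow> G (sum f A) \<le> (\<Sum>i\<in>A. G (f i))"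
proof (induction A rule: infinite_finite_induct)
  case (insert x F)
  have "G (f x + sum f F) \<le> G (f x) + (\<Sum>i\<in>F. G (f i))"
    using G_add[OF insert.prems[of x] V_sum[of F f]] insert.IH insert.prems by simp
  then show ?case unfolding sum.insert[OF insert.hyps] .
qed auto

lemma G_mol: "x \<in> M \<Longrightarrow> y \<in> M \<Longrightarrow> G (mol x y) \<le> 1"
  using G_le_sum[of "{()}" "\<lambda>_. x" "\<lambda>_. y" "\<lambda>_. 1"] by simp

lemma G_dl: "x \<in> M \<Longrightarrow> y \<in> M \<Longrightarrow> G (dl x - dl y) \<le> \<sigma> x y powr p"
  using G_le_sum[of "{()}" "\<lambda>_. x" "\<lambda>_. y" "\<lambda>_. \<sigma> x y"] by (simp add: scale_mol)

text \<open>The linear map sending \<open>dl x\<close> to \<open>F x - F z\<close>. Subtracting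
  \<open>F z\<close> respects \<open>dl z = 0\<close>, and it means that only differences of
  \<open>F\<close> have to lie in \<open>lp\<close>.\<close>

definition Lin :: "('a \<Rightarrow> 'i \<Rightarrow> real) \<Rightarrow> ('a \<Rightarrow> real) \<Rightarrow> 'i \<Rightarrow> real" where
  "Lin F = fext (\<lambda>x. F x - F z)"

lemma V_finsupp: "V \<subseteq> finsupp"
  by (auto simp: V_def finsupp_def)

lemma Lin_lin: "lin_on V (Lin F)"
  using fext_lin[of "\<lambda>x. F x - F z"] V_finsupp unfolding lin_on_def Lin_def by blast

lemma Lin_zero: "Lin F 0 = 0"
  by (simp add: Lin_def fext_def)

lemma Lin_sum: "(\<And>i. i \<in> A \<Longrightarrow> f i \<in> V) \<Longrightarrow> Lin F (sum f A) = (\<Sum>i\<in>A. Lin F (f i))"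
proof (induction A rule: infinite_finite_induct)
  case (insert x A)
  have "Lin F (f x + sum f A) = Lin F (f x) + (\<Sum>i\<in>A. Lin F (f i))"
    using lin_on_add[OF Lin_lin[of F] insert.prems[of x] V_sum[of A f]] insert.IH insert.prems by simp
  then show ?case unfolding sum.insert[OF insert.hyps] .
qed (simp_all add: Lin_zero)

lemma Lin_dl: "x \<in> M \<Longrightarrow> Lin F (dl x) = F x - F z"
  by (cases "x = z") (simp_all add: Lin_zero, simp add: Lin_def fext_eq[of "{x}"] delta_def)

lemma Lin_diff: "x \<in> V \<Longrightarrow> y \<in> V \<Longrightarrow> Lin F (x - y) = Lin F x - Lin F y"
  using lin_on_add[OF Lin_lin[of F], of "x - y" y] V_diff[of x y] by (simp add: algebra_simps)

lemma Lin_mol: "x \<in> M \<Longrightarrow> y \<in> M \<Longrightarrow> Lin F (mol x y) = fscale (1 / \<sigma> x y) (F x - F y)"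
  by (simp add: mol_def lin_on_scale[OF Lin_lin] V_diff dl_V Lin_diff Lin_dl)

text \<open>The universal property of the free \<open>p\<close>-space, for the target
  \<open>lp\<close>: a Lipschitz map extends with the same constant because the image of each
  molecule has \<open>lpn\<close> at most \<open>C\<close>.\<close>

lemma Lin_bound:
  assumes F: "\<And>x y. x \<in> M \<Longrightarrow> y \<in> M \<Longrightarrow> lpn p (F x - F y) \<le> ennreal (C * \<sigma> x y powr p)"
    and C: "C \<ge> 0" and m: "m \<in> V"
  shows "lpn p (Lin F m) \<le> ennreal (C * G m)"
proof (rule ennreal_le_epsilon)
  fix e :: real assume e: "e > 0"
  \<comment> \<open>\<open>C + 1\<close> keeps the denominator positive when
    \<open>C = 0\<close>.\<close>
  then have e2: "e / (C + 1) > 0" using C by simp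
  obtain n :: nat and a x y where 1: "\<forall>i<n. x i \<in> M \<and> y i \<in> M \<and> x i \<noteq> y i"
    "m = (\<Sum>i<n. fscale (a i) (mol (x i) (y i)))" "(\<Sum>i<n. \<bar>a i\<bar> powr p) < G m + e / (C + 1)"
    using G_approx[OF m e2] by blast
  have "Lin F m = (\<Sum>i<n. Lin F (fscale (a i) (mol (x i) (y i))))"
    unfolding 1(2) by (rule Lin_sum) (use 1(1) in \<open>auto simp: V_scale mol_V\<close>)
  also have "\<dots> = (\<Sum>i<n. fscale (a i / \<sigma> (x i) (y i)) (F (x i) - F (y i)))"
    by (rule sum.cong) (use 1(1) in \<open>auto simp: lin_on_scale[OF Lin_lin] mol_V Lin_mol\<close>)
  finally have "lpn p (Lin F m) \<le> (\<Sum>i<n. lpn p (fscale (a i / \<sigma> (x i) (y i)) (F (x i) - F (y i))))"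
    using lpn_sum by simp
  also have "\<dots> \<le> (\<Sum>i<n. ennreal (\<bar>a i\<bar> powr p * C))"
  proof (rule sum_mono)
    fix i assume "i \<in> {..<n}"
    then have i: "x i \<in> M" "y i \<in> M" "x i \<noteq> y i" using 1 by auto
    then have s: "\<sigma> (x i) (y i) > 0" by simp
    have "lpn p (fscale (a i / \<sigma> (x i) (y i)) (F (x i) - F (y i)))
      \<le> ennreal (\<bar>a i / \<sigma> (x i) (y i)\<bar> powr p) * ennreal (C * \<sigma> (x i) (y i) powr p)"
      unfolding lpn_scale by (intro mult_left_mono F i) auto
    also have "\<dots> = ennreal (\<bar>a i\<bar> powr p * C)"
      using s C by (simp add: ennreal_mult[symmetric] powr_divide)
    finally show "lpn p (fscale (a i / \<sigma> (x i) (y i)) (F (x i) - F (y i))) \<le> ennreal (\<bar>a i\<bar> powr p * C)" .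
  qed
  also have "\<dots> = ennreal ((\<Sum>i<n. \<bar>a i\<bar> powr p) * C)"
    using C by (simp add: sum_distrib_right)
  also have "\<dots> \<le> ennreal ((G m + e / (C + 1)) * C)"
    using 1(3) C by (intro ennreal_leI mult_right_mono) auto
  also have "\<dots> \<le> ennreal (C * G m + e)"
    using C e by (intro ennreal_leI) (simp add: field_simps)
  also have "\<dots> = ennreal (C * G m) + ennreal e"
    using C e by (intro ennreal_plus) auto
  finally show "lpn p (Lin F m) \<le> ennreal (C * G m) + ennreal e" .
qed

text \<open>A Lipschitz bump around one support point, vanishing at \<open>z\<close> and at the rest
  of the support, extends to a bounded functional that is nonzero at \<open>m\<close>. Its codomain
  is \<open>lp\<close> over the one-point type \<open>unit\<close>.\<close>

lemma pnorm_pos: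
  assumes m: "m \<in> V" "m \<noteq> 0"
  shows "0 < free_pnorm p M \<sigma> z m"
proof -
  obtain x where x: "m x \<noteq> 0" using m(2) by (auto simp: fun_eq_iff)
  define S where "S = insert z {w. m w \<noteq> 0} - {x}"
  have S: "finite S" "S \<subseteq> M" "z \<in> S" "x \<notin> S" and xM: "x \<in> M" using m(1) x by (auto simp: S_def V_def)
  define e where "e = Min ((\<lambda>w. \<sigma> w x) ` S)"
  have "e > 0" unfolding e_def using S xM by (subst Min_gr_iff) (auto simp: subset_iff)
  have e: "e \<le> \<sigma> w x" if "w \<in> S" for w unfolding e_def using S that by (intro Min_le) auto
  define F where "F = (\<lambda>w (_::unit). max 0 (e - \<sigma> w x))"
  have "lpn p (F v - F w) \<le> ennreal (1 * \<sigma> v w powr p)" if "v \<in> M" "w \<in> M" for v w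
  proof -
    have "\<bar>max 0 (e - \<sigma> v x) - max 0 (e - \<sigma> w x)\<bar> \<le> \<sigma> v w"
      using triangle[OF that(1,2) xM] triangle[OF that(2,1) xM] commute[of v w] by auto
    then have "\<bar>max 0 (e - \<sigma> v x) - max 0 (e - \<sigma> w x)\<bar> powr p \<le> \<sigma> v w powr p"
      using p_pos by (intro powr_mono2) auto
    then show ?thesis by (subst lpn_finite[of UNIV]) (auto simp: F_def intro!: ennreal_leI)
  qed
  from Lin_bound[OF this _ m(1)] have *: "lpn p (Lin F m) \<le> ennreal (G m)" by simp
  have Fz: "F z = 0" and FS: "F w = 0" if "w \<in> S" for w
    using e[OF S(3)] e[OF that] by (auto simp: F_def fun_eq_iff)
  have "finite {w. m w \<noteq> 0}" using m(1) by (auto simp: V_def)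
  then have "Lin F m = (\<Sum>w\<in>insert x S. fscale (m w) (F w - F z))"
    unfolding Lin_def using S by (intro fext_eq) (auto simp: S_def)
  also have "\<dots> = fscale (m x) (F x)"
    using S FS Fz[OF S(3)] by simp
  finally have "Lin F m \<noteq> 0" using x \<open>e > 0\<close> xM by (auto simp: F_def fun_eq_iff)
  then have "lpn p (Lin F m) \<noteq> 0" by simp
  then have "G m \<noteq> 0" using * by (auto simp: le_zero_eq)
  then show ?thesis using pnorm_nonneg[OF m(1)] p_pos by (auto simp: G_def less_le)
qed

sublocale pnormed p V "free_pnorm p M \<sigma> z"
proof
  fix x y assume x: "x \<in> V"
  show "0 \<le> free_pnorm p M \<sigma> z x" using x by (rule pnorm_nonneg)
  show "0 < free_pnorm p M \<sigma> z x" if "x \<noteq> 0" using x that by (rule pnorm_pos)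
  show "free_pnorm p M \<sigma> z (fscale c x) = \<bar>c\<bar> * free_pnorm p M \<sigma> z x" for c
  proof -
    have "(free_pnorm p M \<sigma> z (fscale c x) powr p) powr (1 / p)
        = ((\<bar>c\<bar> * free_pnorm p M \<sigma> z x) powr p) powr (1 / p)"
      using G_scale[OF x, of c] pnorm_nonneg[OF x] by (simp add: G_def powr_mult)
    then show ?thesis using p_pos pnorm_nonneg[OF x] pnorm_nonneg[OF V_scale[OF x, of c]]
      by (simp add: powr_powr)
  qed
  show "free_pnorm p M \<sigma> z (x + y) powr p \<le> free_pnorm p M \<sigma> z x powr p + free_pnorm p M \<sigma> z y powr p"
    if "y \<in> V"
    using G_add[OF x that] by (simp add: G_def)
qed (auto simp: V_zero V_add V_scale pnorm_uminus)

lemma space_eq: "space = free_prespace p M \<sigma> z"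
  unfolding space_def free_prespace_def V_def[symmetric] ..

end

section \<open>Pelczynski's decomposition\<close>

definition pull :: "('i \<Rightarrow> 'j) \<Rightarrow> ('j \<Rightarrow> real) \<Rightarrow> 'i \<Rightarrow> real" where
  "pull h a = (\<lambda>i. a (h i))"

definition push :: "('i \<Rightarrow> 'j) \<Rightarrow> ('i \<Rightarrow> real) \<Rightarrow> 'j \<Rightarrow> real" where
  "push h a = (\<lambda>j. if j \<in> range h then a (inv h j) else 0)"

text \<open>\<open>level0\<close> and \<open>raise\<close> split \<open>nat \<times> 'i\<close> into
  one copy of \<open>'i\<close> and one copy of itself, so that \<open>lp\<close> over this type is
  isomorphic to its sum with \<open>lp\<close> over \<open>'i\<close>.\<close>

definition level0 :: "'i \<Rightarrow> nat \<times> 'i" where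
  "level0 i = (0, i)"

definition raise :: "nat \<times> 'i \<Rightarrow> nat \<times> 'i" where
  "raise = (\<lambda>(n, i). (Suc n, i))"

definition levelwise :: "(('i \<Rightarrow> real) \<Rightarrow> 'j \<Rightarrow> real) \<Rightarrow> (nat \<times> 'i \<Rightarrow> real) \<Rightarrow> nat \<times> 'j \<Rightarrow> real" where
  "levelwise L a = (\<lambda>(n, j). L (\<lambda>i. a (n, i)) j)"

lemma inj_level0: "inj level0" and inj_raise: "inj raise"
  by (auto simp: inj_def level0_def raise_def)

lemma push_apply [simp]: "inj h \<Longrightarrow> push h a (h i) = a i"
  by (simp add: push_def)

lemma push_level0 [simp]: "push level0 a (0, i) = a i" "push level0 a (Suc n, i) = 0"
  using push_apply[OF inj_level0, of a i] by (simp_all add: level0_def) (auto simp: push_def level0_def)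

lemma push_raise [simp]: "push raise a (Suc n, i) = a (n, i)" "push raise a (0, i) = 0"
  using push_apply[OF inj_raise, of a "(n, i)"] by (simp_all add: raise_def) (auto simp: push_def raise_def)

lemma pull_level [simp]: "pull level0 a i = a (0, i)" "pull raise a (n, i) = a (Suc n, i)"
  by (simp_all add: pull_def level0_def raise_def)

lemma level_eqI:
  fixes a b :: "nat \<times> 'i \<Rightarrow> real"
  assumes "pull level0 a = pull level0 b" "pull raise a = pull raise b"
  shows "a = b"
proof
  fix t :: "nat \<times> 'i"
  obtain n i where t: "t = (n, i)" by (cases t)
  show "a t = b t"
  proof (cases n)
    case 0
    then show ?thesis using fun_cong[OF assms(1), of i] t by simp
  next
    case (Suc m)
    then show ?thesis using fun_cong[OF assms(2), of "(m, i)"] t by simp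
  qed
qed

lemma pull_add: "pull h (a + b) = pull h a + pull h b"
  and pull_diff: "pull h (a - b) = pull h a - pull h b"
  by (auto simp: pull_def)

lemma pull_push:
  "pull level0 (push level0 a) = a" "pull level0 (push raise b) = 0"
  "pull raise (push level0 a) = 0" "pull raise (push raise b) = b"
  by (auto simp: fun_eq_iff)

lemma pull_levelwise:
  "pull level0 (levelwise L a) = L (pull level0 a)" "pull raise (levelwise L a) = levelwise L (pull raise a)"
  by (auto simp: levelwise_def fun_eq_iff pull_def level0_def raise_def)

context exponent
begin

lemma lpn_pull:
  fixes a :: "'j \<Rightarrow> real"
  assumes "inj h"
  shows "lpn p (pull h a) \<le> lpn p a"
proof -
  have "lpn p (pull h a) = (\<integral>\<^sup>+ j. ennreal (\<bar>a j\<bar> powr p) \<partial>count_space (range h))"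
    unfolding lpn_def pull_def
    by (rule nn_integral_bij_count_space[OF inj_on_imp_bij_betw[OF assms]])
  also have "\<dots> \<le> lpn p a"
    unfolding lpn_def by (subst nn_integral_count_space_indicator)
      (auto intro!: nn_integral_mono simp: indicator_def)
  finally show ?thesis .
qed

lemma lpn_push:
  fixes a :: "'i \<Rightarrow> real"
  assumes "inj h"
  shows "lpn p (push h a) = lpn p a"
proof -
  have "lpn p (push h a) = (\<integral>\<^sup>+ j. ennreal (\<bar>push h a j\<bar> powr p) \<partial>count_space (range h))"
    unfolding lpn_def
    by (subst (2) nn_integral_count_space_indicator)
       (auto intro!: nn_integral_cong simp: indicator_def push_def)
  also have "\<dots> = (\<integral>\<^sup>+ i. ennreal (\<bar>push h a (h i)\<bar> powr p) \<partial>count_space UNIV)"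
    by (rule nn_integral_bij_count_space[OF inj_on_imp_bij_betw[OF assms], symmetric])
  finally show ?thesis using assms by (simp add: lpn_def)
qed

lemma blin_pull: "inj h \<Longrightarrow> blin p (pull h)"
  by (rule blinI[where C=1]) (simp_all add: lpn_pull, auto simp: pull_def)

lemma blin_push: "inj h \<Longrightarrow> blin p (push h)"
  by (rule blinI[where C=1]) (simp_all add: lpn_push, auto simp: push_def)

lemma lpn_levels: "lpn p a = (\<integral>\<^sup>+ n. lpn p (\<lambda>i. a (n, i)) \<partial>count_space UNIV)"
  unfolding lpn_def by (rule nn_integral_fst_count_space[symmetric])

lemma lp_level:
  assumes "a \<in> lp p"
  shows "(\<lambda>i. a (n, i)) \<in> lp p"
proof -
  have "inj (\<lambda>i. (n, i))" by (auto simp: inj_def)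
  from lpn_pull[OF this, of a] show ?thesis
    using assms by (auto simp: lp_def pull_def intro: le_less_trans)
qed

lemma blin_levelwise:
  assumes L: "blin p L"
  shows "blin p (levelwise L)"
proof -
  obtain C where C: "C > 0" "\<And>a. a \<in> lp p \<Longrightarrow> lpn p (L a) \<le> ennreal C * lpn p a"
    using blin_bound[OF L] by blast
  show ?thesis
  proof (rule blinI[where C=C])
    fix a b :: "nat \<times> 'a \<Rightarrow> real" assume ab: "a \<in> lp p" "b \<in> lp p"
    have "L (\<lambda>i. (a + b) (n, i)) = L (\<lambda>i. a (n, i)) + L (\<lambda>i. b (n, i))" for n
      using blin_plus[OF L lp_level[OF ab(1)] lp_level[OF ab(2)]] by (simp add: plus_fun_def)
    then show "levelwise L (a + b) = levelwise L a + levelwise L b"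
      by (auto simp: levelwise_def fun_eq_iff)
  next
    fix a :: "nat \<times> 'a \<Rightarrow> real" and c assume a: "a \<in> lp p"
    have "L (\<lambda>i. fscale c a (n, i)) = fscale c (L (\<lambda>i. a (n, i)))" for n
      using blin_fscale[OF L lp_level[OF a]] by (simp add: fscale_def)
    then show "levelwise L (fscale c a) = fscale c (levelwise L a)"
      by (auto simp: levelwise_def fun_eq_iff)
  next
    fix a :: "nat \<times> 'a \<Rightarrow> real" assume a: "a \<in> lp p"
    have "lpn p (levelwise L a) = (\<integral>\<^sup>+ n. lpn p (L (\<lambda>i. a (n, i))) \<partial>count_space UNIV)"
      by (simp add: lpn_levels levelwise_def)
    also have "\<dots> \<le> (\<integral>\<^sup>+ n. ennreal C * lpn p (\<lambda>i. a (n, i)) \<partial>count_space UNIV)"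
      by (intro nn_integral_mono C lp_level a)
    also have "\<dots> = ennreal C * lpn p a"
      by (subst nn_integral_cmult) (auto simp: lpn_levels[of a])
    finally show "lpn p (levelwise L a) \<le> ennreal C * lpn p a" .
  qed
qed

text \<open>
  Write \<open>W\<close> for the range of the projection \<open>E\<close>. Since \<open>W\<close>
  contains the complemented copy \<open>range J\<close> of a space isomorphic to its sum with
  \<open>Z = \<ell>\<^sub>p(nat \<times> 'i)\<close>, we get \<open>W \<cong> W \<oplus> Z\<close> through \<open>x \<mapsto> (x' , a)\<close>; and \<open>W \<oplus> Z \<cong> Z\<close> by sending
  \<open>(x', (a\<^sub>n))\<close> to \<open>(x' + (1-E)a\<^sub>0, E a\<^sub>0 + (1-E)a\<^sub>1, E a\<^sub>1 + (1-E)a\<^sub>2, \<dots>)\<close>.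
\<close>

lemma pelczynski:
  fixes E :: "('i \<Rightarrow> real) \<Rightarrow> 'i \<Rightarrow> real"
    and J :: "(nat \<times> nat \<times> 'i \<Rightarrow> real) \<Rightarrow> 'i \<Rightarrow> real"
    and K :: "('i \<Rightarrow> real) \<Rightarrow> nat \<times> nat \<times> 'i \<Rightarrow> real"
  assumes E: "blin p E" and J: "blin p J" and K: "blin p K"
    and EE: "\<And>a. a \<in> lp p \<Longrightarrow> E (E a) = E a"
    and EJ: "\<And>w. w \<in> lp p \<Longrightarrow> E (J w) = J w"
    and KE: "\<And>a. a \<in> lp p \<Longrightarrow> K (E a) = K a"
    and KJ: "\<And>w. w \<in> lp p \<Longrightarrow> K (J w) = w"
  obtains A :: "('i \<Rightarrow> real) \<Rightarrow> nat \<times> 'i \<Rightarrow> real" and B :: "(nat \<times> 'i \<Rightarrow> real) \<Rightarrow> 'i \<Rightarrow> real"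
  where "blin p A" "blin p B" "\<And>b. b \<in> lp p \<Longrightarrow> A (B b) = b" "\<And>a. a \<in> lp p \<Longrightarrow> B (A a) = E a"
proof -
  define D where "D = levelwise E"
  \<comment> \<open>\<open>K x\<close> lives on \<open>nat \<times> (nat \<times> 'i)\<close>. Its
    level 0 is split off as the summand \<open>Z\<close>, and \<open>X'\<close> puts the shifted
    tail in the place of \<open>K x\<close>, so that \<open>X' x\<close> stays in the range of
    \<open>E\<close>.\<close>
  define X' where "X' = (\<lambda>x. E x - J (K x) + J (pull raise (K x)))"
  define A where "A = (\<lambda>x. push level0 (X' x) + (pull level0 (K x) - D (pull level0 (K x)))
    + push raise (D (pull level0 (K x))))"
  define X where "X = (\<lambda>b. E (pull level0 b))"
  \<comment> \<open>Recovers \<open>a\<close> from \<open>b\<close>: level \<open>n\<close> of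
    \<open>b - D b\<close> is \<open>(1 - E) a_n\<close>, and \<open>E\<close> applied to level
    \<open>n + 1\<close> of \<open>b\<close> gives \<open>E a_n\<close>. On level 0 the summand
    \<open>x'\<close> drops out because \<open>E x' = x'\<close>.\<close>
  define a' where "a' = (\<lambda>b. b - D b + D (pull raise b))"
  define B where "B = (\<lambda>b. X b - J (K (X b)) + J (push level0 (a' b) + push raise (K (X b))))"
  note pp = blin_pull[OF inj_level0] blin_pull[OF inj_raise] blin_push[OF inj_level0] blin_push[OF inj_raise]
  have D: "blin p D" unfolding D_def by (rule blin_levelwise[OF E])
  note bl = E J K D pp
  have A: "blin p A"
    unfolding A_def X'_def
    by (intro blin_add blin_diff bl blin_compose[OF _ K] blin_compose[OF J] blin_compose[OF D]
        blin_compose[OF blin_push] blin_compose[OF blin_pull] inj_level0 inj_raise)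
  have X: "blin p X"
    unfolding X_def by (intro blin_compose[OF E] pp)
  have B: "blin p B"
    unfolding B_def a'_def
    by (intro blin_add blin_diff bl blin_compose[OF K] X blin_compose[OF J] blin_compose[OF D] blin_id
        blin_compose[OF blin_push] blin_compose[OF blin_pull] inj_level0 inj_raise)
  have DD: "D (D a) = D a" if "a \<in> lp p" for a
  proof
    fix t :: "nat \<times> 'i"
    show "D (D a) t = D a t"
      using EE[OF lp_level[OF that, of "fst t"]] by (cases t) (simp add: D_def levelwise_def)
  qed
  note D_pull = pull_levelwise[of E, folded D_def]
  note lpI = blin_lp[OF E] blin_lp[OF J] blin_lp[OF K] blin_lp[OF D] blin_lp[OF X]
    blin_lp[OF pp(1)] blin_lp[OF pp(2)] blin_lp[OF pp(3)] blin_lp[OF pp(4)] lp_add lp_diff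
  note lin = blin_plus[OF E] blin_minus[OF E] blin_plus[OF J] blin_minus[OF J]
    blin_plus[OF K] blin_minus[OF K] blin_plus[OF D] blin_minus[OF D]
  note zero = blin_zero[OF E lp_zero] blin_zero[OF D lp_zero]
  have BA: "B (A x) = E x" if x: "x \<in> lp p" for x
  proof -
    define w where "w = K x"
    define a where "a = pull level0 w"
    have w: "w \<in> lp p" and a: "a \<in> lp p" and Ax: "A x \<in> lp p" and X'x: "X' x \<in> lp p"
      unfolding a_def w_def X'_def by (auto intro!: lpI x blin_lp[OF A])
    have EX': "E (X' x) = X' x"
      unfolding X'_def w_def[symmetric]
      by (simp add: lin lpI x w EE EJ)
    have KX': "K (X' x) = pull raise w"
      unfolding X'_def w_def[symmetric]
      by (simp add: lin lpI x w KE KJ) (simp add: w_def)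
    have Aeq: "A x = push level0 (X' x) + (a - D a) + push raise (D a)"
      by (simp add: A_def a_def w_def)
    have h: "pull level0 (A x) = X' x + (pull level0 a - E (pull level0 a))"
      and r: "pull raise (A x) = pull raise a - D (pull raise a) + D a"
      unfolding Aeq by (simp_all add: pull_add pull_diff pull_push D_pull)
    have XA: "X (A x) = X' x"
      unfolding X_def h by (simp add: lin lpI X'x a EE EX')
    have "a' (A x) = a"
    proof (rule level_eqI)
      show "pull level0 (a' (A x)) = pull level0 a"
        unfolding a'_def by (simp add: pull_add pull_diff D_pull h r lin lpI X'x a EE EX' DD)
      show "pull raise (a' (A x)) = pull raise a"
        unfolding a'_def by (simp add: pull_add pull_diff D_pull h r lin lpI X'x a DD)
    qed
    moreover have "push level0 a + push raise (pull raise w) = w"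
      by (rule level_eqI) (simp_all add: pull_add pull_push a_def)
    ultimately have "B (A x) = X' x - J (pull raise w) + J w"
      by (simp add: B_def XA KX')
    then show ?thesis by (simp add: X'_def w_def)
  qed
  have AB: "A (B b) = b" if b: "b \<in> lp p" for b
  proof -
    define x' where "x' = X b"
    define a where "a = a' b"
    define j where "j = push level0 a + push raise (K x')"
    have x': "x' \<in> lp p" and a: "a \<in> lp p" unfolding x'_def a_def a'_def by (auto intro!: lpI b)
    then have j: "j \<in> lp p" unfolding j_def by (auto intro!: lpI)
    have Ex': "E x' = x'" unfolding x'_def X_def by (simp add: EE lpI b)
    have pj: "pull level0 j = a" "pull raise j = K x'"
      unfolding j_def by (simp_all add: pull_add pull_push)
    have Bb: "B b = x' - J (K x') + J j" by (simp add: B_def x'_def a_def j_def)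
    have KB: "K (B b) = j" unfolding Bb by (simp add: lin lpI x' j KJ)
    have "X' (B b) = E (B b) - J j + J (K x')" by (simp add: X'_def KB pj)
    also have "\<dots> = x'" unfolding Bb by (simp add: lin lpI x' j EJ Ex')
    finally have XB: "X' (B b) = x'" .
    have Aeq: "A (B b) = push level0 x' + (a - D a) + push raise (D a)"
      by (simp add: A_def XB KB pj)
    have Da: "D a = D (pull raise b)"
      unfolding a_def a'_def by (simp add: lin lpI b DD)
    show ?thesis
    proof (rule level_eqI)
      have "pull level0 (A (B b)) = x' + (pull level0 a - pull level0 (D a))"
        unfolding Aeq by (simp add: pull_add pull_diff pull_push)
      also have "\<dots> = pull level0 b"
        unfolding Da by (simp add: a_def a'_def x'_def X_def pull_add pull_diff D_pull)
      finally show "pull level0 (A (B b)) = pull level0 b" .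
      have "pull raise (A (B b)) = pull raise a - pull raise (D a) + D a"
        unfolding Aeq by (simp add: pull_add pull_diff pull_push)
      also have "\<dots> = pull raise b"
        unfolding Da by (simp add: a_def a'_def pull_add pull_diff D_pull)
      finally show "pull raise (A (B b)) = pull raise b" .
    qed
  qed
  show ?thesis by (rule that[OF A B AB BA])
qed

end

section \<open>Factorisation through lp\<close>

context exponent
begin

lemma matop_finsupp:
  assumes C: "\<And>j. lpn p (c j) \<le> ennreal C" and a: "a \<in> finsupp"
  shows "matop c a = fext c a"
proof -
  have M: "blin p (matop c)" by (rule matop_blin[OF C])
  have F: "finite {j. a j \<noteq> 0}" using a by (simp add: finsupp_def)
  have "a = restr a {j. a j \<noteq> 0}" by (auto simp: restr_def)
  also have "\<dots> = (\<Sum>j | a j \<noteq> 0. fscale (a j) (unitv j))" by (rule restr_eq_sum[OF F])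
  finally have "matop c a = matop c (\<Sum>j | a j \<noteq> 0. fscale (a j) (unitv j))" by simp
  also have "\<dots> = (\<Sum>j | a j \<noteq> 0. matop c (fscale (a j) (unitv j)))"
    by (rule blin_sum[OF M]) auto
  also have "\<dots> = (\<Sum>j | a j \<noteq> 0. fscale (a j) (c j))"
    by (intro sum.cong refl) (simp only: blin_fscale[OF M lp_unitv] matop_unitv)
  finally show ?thesis by (simp add: fext_def)
qed

end

text \<open>\<open>dl_approx\<close> expresses that the molecules with coefficients
  \<open>Lin b (dl x)\<close> sum to \<open>dl x\<close> in the completion: suitable finite pieces
  converge in \<open>lp\<close> and in the free norm at the same time.\<close>

locale approx_scheme = pfree p M \<sigma> z for p and M :: "'a set" and \<sigma> z +
  fixes b :: "'a \<Rightarrow> 'i::countable \<Rightarrow> real" and C :: real and xs ys :: "'i \<Rightarrow> 'a"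
  assumes C_pos: "C > 0"
    and pts: "xs t \<in> M" "ys t \<in> M"
    and b_bound: "x \<in> M \<Longrightarrow> y \<in> M \<Longrightarrow> lpn p (b x - b y) \<le> ennreal (C * \<sigma> x y powr p)"
    and dl_approx: "x \<in> M \<Longrightarrow> e > 0 \<Longrightarrow> \<exists>a\<in>finsupp. lpn p (Lin b (dl x) - a) \<le> ennreal e \<and>
      G (dl x - fext (\<lambda>t. mol (xs t) (ys t)) a) \<le> e"
begin

abbreviation mo :: "'i \<Rightarrow> 'a \<Rightarrow> real" where "mo t \<equiv> mol (xs t) (ys t)"

definition R :: "('i \<Rightarrow> real) \<Rightarrow> 'a \<Rightarrow> real" where "R = fext mo"

lemma R_V: "a \<in> finsupp \<Longrightarrow> R a \<in> V"
  unfolding R_def fext_def by (auto intro!: V_sum V_scale mol_V pts)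

lemma Lin_R: "a \<in> finsupp \<Longrightarrow> Lin q (R a) = fext (\<lambda>t. Lin q (mo t)) a"
  unfolding R_def fext_def
  by (subst Lin_sum) (auto simp: V_scale mol_V pts lin_on_scale[OF Lin_lin])

lemma G_R: "a \<in> finsupp \<Longrightarrow> ennreal (G (R a)) \<le> lpn p a"
  unfolding R_def fext_def finsupp_def mem_Collect_eq
  by (subst lpn_finite[of "{t. a t \<noteq> 0}"]) (auto intro!: ennreal_leI G_le_sum pts)

text \<open>The substitute for \<open>R (Lin b m) = m\<close>, since \<open>R\<close> is meant for
  finite supports only. One \<open>a\<close> serves both estimates, and the property is stable under
  linear combinations.\<close>

definition approx :: "('a \<Rightarrow> real) \<Rightarrow> bool" where
  "approx m \<longleftrightarrow> (\<forall>e>0. \<exists>a\<in>finsupp. lpn p (Lin b m - a) \<le> ennreal e \<and> G (m - R a) \<le> e)"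

lemma approx_zero: "approx 0"
proof -
  have "(0 :: 'i \<Rightarrow> real) \<in> finsupp" "R 0 = 0" by (simp_all add: finsupp_def R_def fext_def)
  then show ?thesis unfolding approx_def by (auto simp: Lin_zero intro!: bexI[of _ 0])
qed

lemma approx_add:
  assumes "m \<in> V" "m' \<in> V" "approx m" "approx m'"
  shows "approx (m + m')"
  unfolding approx_def
proof (intro allI impI)
  fix e :: real assume "e > 0"
  then have e: "e / 2 > 0" by simp
  obtain a where a: "a \<in> finsupp" "lpn p (Lin b m - a) \<le> ennreal (e / 2)" "G (m - R a) \<le> e / 2"
    using assms(3) e unfolding approx_def by blast
  obtain a' where a': "a' \<in> finsupp" "lpn p (Lin b m' - a') \<le> ennreal (e / 2)" "G (m' - R a') \<le> e / 2"
    using assms(4) e unfolding approx_def by blast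
  have "lpn p (Lin b (m + m') - (a + a')) = lpn p ((Lin b m - a) + (Lin b m' - a'))"
    using assms by (simp add: lin_on_add[OF Lin_lin] algebra_simps)
  also have "\<dots> \<le> ennreal (e / 2) + ennreal (e / 2)"
    by (rule order_trans[OF lpn_add add_mono[OF a(2) a'(2)]])
  also have "\<dots> = ennreal e" using e by (simp flip: ennreal_plus)
  finally have 1: "lpn p (Lin b (m + m') - (a + a')) \<le> ennreal e" .
  have "R (a + a') = R a + R a'" unfolding R_def by (rule lin_on_add[OF fext_lin a(1) a'(1)])
  then have "G (m + m' - R (a + a')) = G ((m - R a) + (m' - R a'))" by (simp add: algebra_simps)
  also have "\<dots> \<le> G (m - R a) + G (m' - R a')"
    by (intro G_add V_diff assms R_V a a')
  finally have 2: "G (m + m' - R (a + a')) \<le> e" using a a' by simp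
  show "\<exists>a\<in>finsupp. lpn p (Lin b (m + m') - a) \<le> ennreal e \<and> G (m + m' - R a) \<le> e"
    using 1 2 finsupp_add[OF a(1) a'(1)] by blast
qed

lemma approx_scale:
  assumes "m \<in> V" "approx m"
  shows "approx (fscale c m)"
proof (cases "c = 0")
  case False
  show ?thesis unfolding approx_def
  proof (intro allI impI)
    fix e :: real assume e0: "e > 0"
    define d where "d = e / \<bar>c\<bar> powr p"
    have d: "d > 0" "\<bar>c\<bar> powr p * d = e" using e0 False by (simp_all add: d_def)
    obtain a where a: "a \<in> finsupp" "lpn p (Lin b m - a) \<le> ennreal d" "G (m - R a) \<le> d"
      using assms(2) d(1) unfolding approx_def by blast
    have "lpn p (Lin b (fscale c m) - fscale c a) = ennreal (\<bar>c\<bar> powr p) * lpn p (Lin b m - a)"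
      using assms by (simp add: lin_on_scale[OF Lin_lin] fscale_diff[symmetric] lpn_scale)
    also have "\<dots> \<le> ennreal (\<bar>c\<bar> powr p) * ennreal d" using a by (intro mult_left_mono) auto
    also have "\<dots> = ennreal e" using d by (simp flip: ennreal_mult)
    finally have 1: "lpn p (Lin b (fscale c m) - fscale c a) \<le> ennreal e" .
    have "R (fscale c a) = fscale c (R a)" unfolding R_def by (rule lin_on_scale[OF fext_lin a(1)])
    then have "G (fscale c m - R (fscale c a)) = \<bar>c\<bar> powr p * G (m - R a)"
      using assms by (simp add: fscale_diff[symmetric] G_scale V_diff R_V a)
    also have "\<dots> \<le> \<bar>c\<bar> powr p * d" using a by (intro mult_left_mono) auto
    finally have 2: "G (fscale c m - R (fscale c a)) \<le> e" using d by simp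
    show "\<exists>a\<in>finsupp. lpn p (Lin b (fscale c m) - a) \<le> ennreal e \<and> G (fscale c m - R a) \<le> e"
      using 1 2 finsupp_scale[OF a(1)] by blast
  qed
qed (simp add: approx_zero)

lemma approx_sum: "(\<And>i. i \<in> A \<Longrightarrow> f i \<in> V \<and> approx (f i)) \<Longrightarrow> approx (sum f A)"
proof (induction A rule: infinite_finite_induct)
  case (insert x A)
  then show ?case
    unfolding sum.insert[OF insert.hyps] by (intro approx_add V_sum) auto
qed (simp_all add: approx_zero)

lemma approx_V:
  assumes m: "m \<in> V"
  shows "approx m"
proof -
  have dl: "approx (dl x)" if "x \<in> M" for x
    using dl_approx[OF that] by (simp add: approx_def R_def)
  have "m = (\<Sum>x | m x \<noteq> 0. fscale (m x) (dl x))"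
    by (rule V_expand[OF m]) (use m in \<open>auto simp: V_def\<close>)
  moreover have "approx \<dots>"
  proof (rule approx_sum)
    fix x assume "x \<in> {x. m x \<noteq> 0}"
    then have "x \<in> M" using m by (auto simp: V_def)
    then show "fscale (m x) (dl x) \<in> V \<and> approx (fscale (m x) (dl x))"
      by (intro conjI V_scale approx_scale dl_V dl)
  qed
  ultimately show "approx m" by simp
qed

text \<open>The extension to all of \<open>lp\<close> of the composition of \<open>Lin q\<close>
  with \<open>R\<close>. For \<open>q = b\<close> it is the projection \<open>E\<close>.\<close>

definition ext :: "('a \<Rightarrow> 'k \<Rightarrow> real) \<Rightarrow> ('i \<Rightarrow> real) \<Rightarrow> 'k \<Rightarrow> real" where
  "ext q = matop (\<lambda>t. Lin q (mo t))"

context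
  fixes q :: "'a \<Rightarrow> 'k \<Rightarrow> real" and D :: real
  assumes D: "D > 0" and q: "\<And>x y. x \<in> M \<Longrightarrow> y \<in> M \<Longrightarrow> lpn p (q x - q y) \<le> ennreal (D * \<sigma> x y powr p)"
begin

lemma Lin_q: "m \<in> V \<Longrightarrow> lpn p (Lin q m) \<le> ennreal (D * G m)"
  by (rule Lin_bound[OF q]) (use D in auto)

lemma ext_col: "lpn p (Lin q (mo t)) \<le> ennreal D"
proof -
  have "lpn p (Lin q (mo t)) \<le> ennreal (D * G (mo t))" by (intro Lin_q mol_V pts)
  also have "\<dots> \<le> ennreal (D * 1)" using D by (intro ennreal_leI mult_left_mono G_mol pts) auto
  finally show ?thesis by simp
qed

lemma ext_blin: "blin p (ext q)"
  unfolding ext_def by (rule matop_blin[OF ext_col])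

lemma ext_finsupp: "a \<in> finsupp \<Longrightarrow> ext q a = Lin q (R a)"
  unfolding ext_def by (simp add: matop_finsupp[of "\<lambda>t. Lin q (mo t)", OF ext_col] Lin_R)

text \<open>If \<open>a\<close> approximates \<open>Lin b m\<close> and \<open>R a\<close>
  approximates \<open>m\<close>, both up to \<open>d\<close>, the two sides differ by at most
  \<open>L * d + D * d\<close>. For \<open>q = b\<close> this says that \<open>E\<close> fixes the
  image of \<open>Lin b\<close>.\<close>

lemma ext_Lin:
  assumes m: "m \<in> V"
  shows "ext q (Lin b m) = Lin q m"
proof -
  obtain L where L: "L > 0" "\<And>a. a \<in> lp p \<Longrightarrow> lpn p (ext q a) \<le> ennreal L * lpn p a"
    using blin_bound[OF ext_blin] by blast
  have bm: "Lin b m \<in> lp p"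
    using Lin_bound[OF b_bound _ m] C_pos by (auto simp: lp_def intro: le_less_trans)
  have "lpn p (ext q (Lin b m) - Lin q m) \<le> 0"
  proof (rule ennreal_le_epsilon)
    fix e :: real assume e: "e > 0"
    define d where "d = e / (L + D)"
    have d: "d > 0" "L * d + D * d = e"
      using e L D unfolding d_def by (simp, simp add: add_divide_distrib[symmetric] distrib_right[symmetric])
    obtain a where a: "a \<in> finsupp" "lpn p (Lin b m - a) \<le> ennreal d" "G (m - R a) \<le> d"
      using approx_V[OF m] d(1) unfolding approx_def by blast
    have alp: "a \<in> lp p" using a(1) by (auto simp: finsupp_def intro: lp_finite)
    have "ext q (Lin b m) - Lin q m = ext q (Lin b m - a) - Lin q (m - R a)"
      using m a(1) bm alp by (simp add: blin_minus[OF ext_blin] Lin_diff R_V ext_finsupp)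
    then have "lpn p (ext q (Lin b m) - Lin q m) \<le> lpn p (ext q (Lin b m - a)) + lpn p (Lin q (m - R a))"
      using lpn_diff by metis
    also have "\<dots> \<le> ennreal L * ennreal d + ennreal (D * d)"
    proof (rule add_mono)
      show "lpn p (ext q (Lin b m - a)) \<le> ennreal L * ennreal d"
        by (rule order_trans[OF L(2)]) (use a bm alp in \<open>auto intro: mult_left_mono\<close>)
      show "lpn p (Lin q (m - R a)) \<le> ennreal (D * d)"
        by (rule order_trans[OF Lin_q]) (use a m D in \<open>auto intro!: V_diff R_V ennreal_leI mult_left_mono\<close>)
    qed
    also have "\<dots> = ennreal e" using L D d by (simp flip: ennreal_mult ennreal_plus)
    finally show "lpn p (ext q (Lin b m) - Lin q m) \<le> 0 + ennreal e" by simp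
  qed
  then show ?thesis by simp
qed

end

text \<open>\<open>R\<close> has norm at most one because molecules do, and
  \<open>R (Lin b m)\<close> is \<open>m\<close> up to approximation. This is the lower bound for
  the embedding \<open>Lin b\<close>.\<close>

lemma G_le_S:
  assumes m: "m \<in> V"
  shows "ennreal (G m) \<le> lpn p (Lin b m)"
proof (rule ennreal_le_epsilon)
  fix e :: real assume e: "e > 0"
  then have e2: "e / 2 > 0" by simp
  obtain a where a: "a \<in> finsupp" "lpn p (Lin b m - a) \<le> ennreal (e / 2)" "G (m - R a) \<le> e / 2"
    using approx_V[OF m] e2 unfolding approx_def by blast
  have "G m \<le> G (m - R a) + G (R a)"
    using G_add[OF V_diff[OF m R_V[OF a(1)]] R_V[OF a(1)]] by simp
  then have "ennreal (G m) \<le> ennreal (e / 2) + ennreal (G (R a))"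
    using a(3) e ennreal_leI[of "G m" "e / 2 + G (R a)"] by simp
  also have "\<dots> \<le> ennreal (e / 2) + lpn p a" by (intro add_left_mono G_R a)
  also have "\<dots> \<le> ennreal (e / 2) + (lpn p (Lin b m) + ennreal (e / 2))"
    using lpn_diff[of "Lin b m" "Lin b m - a"] a(2)
    by (intro add_left_mono) (auto intro: order_trans add_left_mono)
  also have "\<dots> = lpn p (Lin b m) + (ennreal (e / 2) + ennreal (e / 2))" by (simp add: ac_simps)
  also have "ennreal (e / 2) + ennreal (e / 2) = ennreal e" using e by (simp flip: ennreal_plus)
  finally show "ennreal (G m) \<le> lpn p (Lin b m) + ennreal e" .
qed

text \<open>The biorthogonal system is indexed by \<open>nat \<times> nat \<times> 'i\<close>
  because this is the index type of the copy of \<open>lp\<close> that \<open>pelczynski\<close>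
  asks for.\<close>

lemma isomorphic_lp:
  fixes q :: "'a \<Rightarrow> nat \<times> nat \<times> 'i \<Rightarrow> real" and u v :: "nat \<times> nat \<times> 'i \<Rightarrow> 'a" and c :: "nat \<times> nat \<times> 'i \<Rightarrow> real"
  assumes D: "D > 0" and q: "\<And>x y. x \<in> M \<Longrightarrow> y \<in> M \<Longrightarrow> lpn p (q x - q y) \<le> ennreal (D * \<sigma> x y powr p)"
    and uv: "\<And>k. u k \<in> M \<and> v k \<in> M \<and> u k \<noteq> v k"
    and biorth: "\<And>k. q (u k) - q (v k) = fscale (c k) (unitv k)"
    and c0: "c0 > 0" and c: "\<And>k. c0 * \<sigma> (u k) (v k) \<le> c k"
  shows "isomorphic (lipschitz_free_pspace p M \<sigma> z) (lp_space p)"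
proof -
  \<comment> \<open>Divided by \<open>c k\<close> rather than by the distance, so that
    \<open>Lin q (n k) = unitv k\<close> holds exactly; the hypothesis on \<open>c0\<close> keeps
    these vectors uniformly bounded.\<close>
  define n where "n = (\<lambda>k. fscale (1 / c k) (dl (u k) - dl (v k)))"
  have \<sigma>0: "\<sigma> (u k) (v k) > 0" for k using uv[of k] by simp
  then have cpos: "c k > 0" for k using c[of k] c0 mult_pos_pos[OF c0 \<sigma>0[of k]] by linarith
  have nV: "n k \<in> V" for k using uv by (simp add: n_def V_scale V_diff dl_V)
  have Gn: "G (n k) \<le> (1 / c0) powr p" for k
  proof -
    have "G (n k) \<le> \<bar>1 / c k\<bar> powr p * \<sigma> (u k) (v k) powr p"
      unfolding n_def using uv[of k]
      by (subst G_scale) (auto intro!: V_diff dl_V mult_left_mono G_dl)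
    also have "\<dots> = (\<sigma> (u k) (v k) / c k) powr p"
      using cpos[of k] by (simp add: powr_divide)
    also have "\<dots> \<le> (1 / c0) powr p"
      using c[of k] c0 cpos[of k] p_pos by (intro powr_mono2) (auto simp: field_simps)
    finally show ?thesis .
  qed
  have Qn: "Lin q (n k) = unitv k" for k
    using uv[of k] cpos[of k]
    by (simp add: n_def lin_on_scale[OF Lin_lin] V_diff dl_V Lin_diff Lin_dl biorth)
  define S where "S = Lin b"
  have S: "lpn p (S m) \<le> ennreal (C * G m)" "S m \<in> lp p" if "m \<in> V" for m
  proof -
    show *: "lpn p (S m) \<le> ennreal (C * G m)"
      unfolding S_def by (rule Lin_bound[OF b_bound]) (use C_pos that in auto)
    show "S m \<in> lp p" using * by (auto simp: lp_def intro: le_less_trans)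
  qed
  define E where "E = ext b"
  define K where "K = ext q"
  define J where "J = matop (\<lambda>k. S (n k))"
  have ES: "E (S m) = S m" if "m \<in> V" for m
    unfolding E_def S_def by (rule ext_Lin[OF C_pos b_bound that])
  have KS: "K (S m) = Lin q m" if "m \<in> V" for m
    unfolding K_def S_def by (rule ext_Lin[OF D q that])
  have E: "blin p E" unfolding E_def by (rule ext_blin[OF C_pos b_bound])
  have K: "blin p K" unfolding K_def by (rule ext_blin[OF D q])
  have J: "blin p J" unfolding J_def
  proof (rule matop_blin)
    fix k
    show "lpn p (S (n k)) \<le> ennreal (C * (1 / c0) powr p)"
      by (rule order_trans[OF S(1)[OF nV]]) (use C_pos Gn in \<open>auto intro!: ennreal_leI mult_left_mono\<close>)
  qed
  have Eu: "E (unitv t) = S (mo t)" for t by (simp add: E_def ext_def S_def)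
  have Ku: "K (unitv t) = Lin q (mo t)" for t by (simp add: K_def ext_def)
  have Ju: "J (unitv k) = S (n k)" for k by (simp add: J_def)
  have moV: "mo t \<in> V" for t by (intro mol_V pts)
  have EE: "E (E a) = E a" if "a \<in> lp p" for a
    by (rule blin_eqI[OF blin_compose[OF E E] E _ that]) (simp add: Eu ES[OF moV])
  have EJ: "E (J w) = J w" if "w \<in> lp p" for w
    by (rule blin_eqI[OF blin_compose[OF E J] J _ that]) (simp add: Ju ES[OF nV])
  have KE: "K (E a) = K a" if "a \<in> lp p" for a
    by (rule blin_eqI[OF blin_compose[OF K E] K _ that]) (simp add: Eu Ku KS[OF moV])
  have KJ: "K (J w) = w" if "w \<in> lp p" for w
    by (rule blin_eqI[OF blin_compose[OF K J] blin_id _ that]) (simp add: Ju KS[OF nV] Qn)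
  obtain A :: "('i \<Rightarrow> real) \<Rightarrow> nat \<times> 'i \<Rightarrow> real" and B where AB: "blin p A" "blin p B"
    "\<And>b. b \<in> lp p \<Longrightarrow> A (B b) = b" "\<And>a. a \<in> lp p \<Longrightarrow> B (A a) = E a"
    by (rule pelczynski[OF E J K EE EJ KE KJ]) (assumption+, rule that)
  obtain CA where CA: "CA > 0" "\<And>a. a \<in> lp p \<Longrightarrow> lpn p (A a) \<le> ennreal CA * lpn p a"
    using blin_bound[OF AB(1)] by blast
  obtain CB where CB: "CB > 0" "\<And>a. a \<in> lp p \<Longrightarrow> lpn p (B a) \<le> ennreal CB * lpn p a"
    using blin_bound[OF AB(2)] by blast
  obtain CE where CE: "CE > 0" "\<And>a. a \<in> lp p \<Longrightarrow> lpn p (E a) \<le> ennreal CE * lpn p a"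
    using blin_bound[OF E] by blast
  \<comment> \<open>The decomposition yields \<open>lp\<close> over \<open>nat \<times> 'i\<close>;
    an enumeration of this countably infinite type leads to \<open>lp\<close> over
    \<open>nat\<close>.\<close>
  define g where "g = from_nat_into (UNIV :: (nat \<times> 'i) set)"
  have "infinite (UNIV :: (nat \<times> 'i) set)" 
    by (intro infinite_super[OF subset_UNIV range_inj_infinite[of "\<lambda>n::nat. (n, undefined)"]]) (simp add: inj_def)
  then have g: "bij g" unfolding g_def by (intro bij_betw_from_nat_into) auto
  have lpn_g: "lpn p (pull g a) = lpn p a" for a
    unfolding lpn_def pull_def by (rule nn_integral_bij_count_space[OF g])
  define T where "T = (\<lambda>m. pull g (A (S m)))"
  have Gp: "free_pnorm p M \<sigma> z m powr p = G m" for m by (simp add: G_def)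
  interpret lp_embedding p V "free_pnorm p M \<sigma> z" T "CA * C" CB
  proof
    show "lin_on V T"
      unfolding lin_on_def T_def
    proof (intro conjI ballI allI)
      fix x y assume xy: "x \<in> V" "y \<in> V"
      have "S (x + y) = S x + S y" unfolding S_def by (rule lin_on_add[OF Lin_lin xy])
      then show "pull g (A (S (x + y))) = pull g (A (S x)) + pull g (A (S y))"
        using S(2) xy by (simp add: blin_plus[OF AB(1)] pull_add)
    next
      fix r x assume x: "x \<in> V"
      have "S (fscale r x) = fscale r (S x)" unfolding S_def by (rule lin_on_scale[OF Lin_lin x])
      then have "A (S (fscale r x)) = fscale r (A (S x))"
        using S(2)[OF x] by (simp add: blin_fscale[OF AB(1)])
      then show "pull g (A (S (fscale r x))) = fscale r (pull g (A (S x)))"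
        by (simp add: pull_def fscale_def)
    qed
    show "lpn p (T m) \<le> ennreal (CA * C * free_pnorm p M \<sigma> z m powr p)" if "m \<in> V" for m
    proof -
      have "lpn p (T m) \<le> ennreal CA * lpn p (S m)" unfolding T_def lpn_g by (rule CA(2)[OF S(2)[OF that]])
      also have "\<dots> \<le> ennreal CA * ennreal (C * G m)" by (intro mult_left_mono S that) auto
      finally show ?thesis using CA C_pos by (simp add: Gp ennreal_mult mult.assoc)
    qed
    show "ennreal (free_pnorm p M \<sigma> z m powr p) \<le> ennreal CB * lpn p (T m)" if m: "m \<in> V" for m
    proof -
      have "ennreal (G m) \<le> lpn p (S m)" unfolding S_def by (rule G_le_S[OF m])
      also have "S m = B (A (S m))" using AB(4) S(2)[OF m] ES[OF m] by simp
      also have "lpn p \<dots> \<le> ennreal CB * lpn p (A (S m))"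
        by (intro CB blin_lp[OF AB(1)] S m)
      finally show ?thesis by (simp add: Gp T_def lpn_g)
    qed
    show "\<exists>x\<in>V. lpn p (a - T x) < ennreal e" if a: "a \<in> lp p" and e: "e > 0" for a e
    proof -
      \<comment> \<open>The vector \<open>a\<close> corresponds to \<open>w\<close>, and
        \<open>B w\<close> is fixed by \<open>E\<close>. A finitely supported \<open>f\<close> near
        \<open>B w\<close> satisfies \<open>E f = S (R f)\<close>, so \<open>R f\<close> is the
        required element of \<open>V\<close>.\<close>
      define w where "w = pull (inv g) a"
      have gw: "pull g w = a" using g by (simp add: w_def pull_def bij_is_inj)
      have w: "w \<in> lp p" using a lpn_g[of w] gw by (simp add: lp_def)
      have Bw: "B w \<in> lp p" by (rule blin_lp[OF AB(2) w])
      have EB: "E (B w) = B w" using AB(3)[OF w] AB(4)[OF Bw] by simp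
      \<comment> \<open>The factors \<open>CA\<close> and \<open>CE\<close> compensate for the
        operators \<open>A\<close> and \<open>E\<close>; the 2 leaves \<open>e / 2\<close> at the
        end and so a strict inequality.\<close>
      define d where "d = e / (2 * CA * CE)"
      have d: "d > 0" using e CA CE by (simp add: d_def)
      obtain F where F: "finite F" "lpn p (B w - restr (B w) F) < ennreal d"
        using lp_dense[OF Bw, of "ennreal d"] d by auto
      define f where "f = restr (B w) F"
      have f: "f \<in> finsupp" "f \<in> lp p"
        using F(1) lp_restr[OF Bw] by (auto simp: f_def finsupp_def restr_def intro: finite_subset)
      have Sf: "S (R f) = E f" unfolding E_def S_def using ext_finsupp[OF C_pos b_bound f(1)] by simp
      have "w - A (S (R f)) = A (E (B w - f))"
        using AB(3)[OF w] f Bw EB Sf blin_lp[OF E f(2)]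
        by (simp add: blin_minus[OF E] blin_minus[OF AB(1)])
      moreover have "a - T (R f) = pull g (w - A (S (R f)))"
        by (simp only: pull_diff gw T_def)
      ultimately have "lpn p (a - T (R f)) = lpn p (A (E (B w - f)))"
        by (simp only: lpn_g)
      also have "\<dots> \<le> ennreal CA * (ennreal CE * lpn p (B w - f))"
        by (rule order_trans[OF CA(2) mult_left_mono[OF CE(2)]]) (auto intro!: blin_lp[OF E] Bw f)
      also have "\<dots> \<le> ennreal CA * (ennreal CE * ennreal d)"
        using F(2) by (intro mult_left_mono) (auto simp: f_def)
      also have "\<dots> = ennreal (CA * (CE * d))" using CA CE d by (simp add: ennreal_mult)
      also have "CA * (CE * d) = e / 2" using CA CE by (simp add: d_def)
      also have "ennreal (e / 2) < ennreal e" using e by (simp add: ennreal_less_iff)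
      finally show ?thesis using R_V[OF f(1)] by blast
    qed
  qed (use CA CB C_pos in auto)
  show ?thesis
    using isomorphic_lp by (simp add: lipschitz_free_pspace_def space_eq)
qed

end

section \<open>Partitions of unity in doubling spaces\<close>

text \<open>Zorn's lemma for separated subsets under inclusion: a point at distance more than
  \<open>r\<close> from all of \<open>A\<close> could be added to \<open>A\<close>.\<close>

lemma (in Metric_space) maximal_separated:
  obtains A where "A \<subseteq> M" "\<And>u v. u \<in> A \<Longrightarrow> v \<in> A \<Longrightarrow> u \<noteq> v \<Longrightarrow> d u v > r"
    "\<And>x. x \<in> M \<Longrightarrow> r \<ge> 0 \<Longrightarrow> \<exists>a\<in>A. d x a \<le> r"
proof -
  define sep where "sep = {A. A \<subseteq> M \<and> (\<forall>u\<in>A. \<forall>v\<in>A. u \<noteq> v \<longrightarrow> d u v > r)}"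
  have "\<exists>A\<in>sep. \<forall>X\<in>sep. A \<subseteq> X \<longrightarrow> X = A"
  proof (rule subset_Zorn')
    fix c assume c: "subset.chain sep c"
    have "d u v > r" if "A \<in> c" "u \<in> A" "B \<in> c" "v \<in> B" "u \<noteq> v" for u v A B
    proof -
      have "A \<subseteq> B \<or> B \<subseteq> A" "A \<in> sep" "B \<in> sep"
        using c that by (auto simp: subset.chain_def)
      then show ?thesis using that by (auto simp: sep_def)
    qed
    moreover have "\<Union> c \<subseteq> M" using c by (auto simp: subset.chain_def sep_def)
    ultimately show "\<Union> c \<in> sep" by (auto simp: sep_def)
  qed
  then obtain A where A: "A \<in> sep" "\<And>X. X \<in> sep \<Longrightarrow> A \<subseteq> X \<Longrightarrow> X = A" by blast
  have "\<exists>a\<in>A. d x a \<le> r" if x: "x \<in> M" and r: "r \<ge> 0" for x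
  proof (rule ccontr)
    assume "\<not> (\<exists>a\<in>A. d x a \<le> r)"
    then have far: "d x a > r" "d a x > r" if "a \<in> A" for a using that commute[of x a] by force+
    then have "insert x A \<in> sep" using A(1) x by (auto simp: sep_def)
    then have "x \<in> A" using A(2)[of "insert x A"] by auto
    then show False using far(1)[of x] x r by simp
  qed
  then show ?thesis using A(1) that[of A] by (auto simp: sep_def)
qed

locale doubling_space = Metric_space M d for M :: "'a set" and d +
  fixes N :: nat
  assumes doubling_N: "x \<in> M \<Longrightarrow> r > 0 \<Longrightarrow>
    \<exists>C\<subseteq>M. finite C \<and> card C \<le> N \<and> mcball x (2 * r) \<subseteq> (\<Union>c\<in>C. mcball c r)"
begin

lemma cover_power:
  assumes "x \<in> M" "r > 0"
  shows "\<exists>C\<subseteq>M. finite C \<and> card C \<le> N ^ n \<and> mcball x (2 ^ n * r) \<subseteq> (\<Union>c\<in>C. mcball c r)"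
  using assms(1)
proof (induction n arbitrary: x)
  case 0
  then show ?case by (intro exI[of _ "{x}"]) auto
next
  case (Suc n)
  obtain C where C: "C \<subseteq> M" "finite C" "card C \<le> N" "mcball x (2 * (2 ^ n * r)) \<subseteq> (\<Union>c\<in>C. mcball c (2 ^ n * r))"
    using doubling_N[OF Suc.prems, of "2 ^ n * r"] assms(2) by auto
  have "\<forall>c\<in>C. \<exists>D\<subseteq>M. finite D \<and> card D \<le> N ^ n \<and> mcball c (2 ^ n * r) \<subseteq> (\<Union>c\<in>D. mcball c r)"
    using Suc.IH C(1) by blast
  then obtain D where D: "\<And>c. c \<in> C \<Longrightarrow> D c \<subseteq> M \<and> finite (D c) \<and> card (D c) \<le> N ^ n \<and>
      mcball c (2 ^ n * r) \<subseteq> (\<Union>c\<in>D c. mcball c r)"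
    by metis
  have "card (\<Union>c\<in>C. D c) \<le> (\<Sum>c\<in>C. card (D c))" by (rule card_UN_le[OF C(2)])
  also have "\<dots> \<le> card C * N ^ n" using sum_bounded_above[of C "\<lambda>c. card (D c)" "N ^ n"] D by simp
  also have "\<dots> \<le> N ^ Suc n" using C(3) by simp
  finally have "card (\<Union>c\<in>C. D c) \<le> N ^ Suc n" .
  moreover have "mcball x (2 ^ Suc n * r) \<subseteq> (\<Union>c\<in>(\<Union>c\<in>C. D c). mcball c r)"
  proof -
    have "mcball x (2 ^ Suc n * r) \<subseteq> (\<Union>c\<in>C. mcball c (2 ^ n * r))" using C(4) by (simp add: mult.assoc)
    also have "\<dots> \<subseteq> (\<Union>c\<in>C. \<Union>c\<in>D c. mcball c r)" using D by (intro UN_mono) auto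
    finally show ?thesis by simp
  qed
  moreover have "(\<Union>c\<in>C. D c) \<subseteq> M" "finite (\<Union>c\<in>C. D c)" using C(2) D by blast+
  ultimately show ?case by blast
qed

text \<open>The ball is covered by \<open>N ^ Suc n\<close> balls of radius \<open>r / 2\<close>,
  and each of them contains at most one point of \<open>A\<close>, as two would be at distance at
  most \<open>r\<close>.\<close>

lemma separated_ball:
  assumes A: "A \<subseteq> M" "\<And>u v. u \<in> A \<Longrightarrow> v \<in> A \<Longrightarrow> u \<noteq> v \<Longrightarrow> d u v > r"
    and x: "x \<in> M" and r: "r > 0"
  shows "finite (A \<inter> mcball x (2 ^ n * r))" "card (A \<inter> mcball x (2 ^ n * r)) \<le> N ^ Suc n"
proof -
  obtain C where C: "C \<subseteq> M" "finite C" "card C \<le> N ^ Suc n"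
      "mcball x (2 ^ Suc n * (r / 2)) \<subseteq> (\<Union>c\<in>C. mcball c (r / 2))"
    using cover_power[OF x, of "r / 2" "Suc n"] r by auto
  let ?B = "A \<inter> mcball x (2 ^ n * r)"
  have "2 ^ Suc n * (r / 2) = 2 ^ n * r" by simp
  then have "?B \<subseteq> (\<Union>c\<in>C. mcball c (r / 2))" using C(4) by (metis inf_le2 order_trans)
  then have "\<forall>a\<in>?B. \<exists>c\<in>C. a \<in> mcball c (r / 2)" by blast
  then obtain f where f: "\<And>a. a \<in> ?B \<Longrightarrow> f a \<in> C \<and> a \<in> mcball (f a) (r / 2)" by metis
  have inj: "inj_on f ?B"
  proof (rule inj_onI, rule ccontr)
    fix u v assume uv: "u \<in> ?B" "v \<in> ?B" "f u = f v" "u \<noteq> v"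
    then have "d (f u) u \<le> r / 2" "d (f u) v \<le> r / 2" "f u \<in> M" "u \<in> M" "v \<in> M"
      using f[of u] f[of v] by auto
    then have "d u v \<le> r" using triangle[of u "f u" v] commute[of u "f u"] by simp
    then show False using A(2)[of u v] uv by auto
  qed
  have im: "f ` ?B \<subseteq> C" using f by auto
  show "finite ?B" using finite_imageD[OF finite_subset[OF im C(2)] inj] .
  show "card ?B \<le> N ^ Suc n" using card_inj_on_le[OF inj im C(2)] C(3) by simp
qed

lemma countable_separated:
  assumes A: "A \<subseteq> M" "\<And>u v. u \<in> A \<Longrightarrow> v \<in> A \<Longrightarrow> u \<noteq> v \<Longrightarrow> d u v > r"
    and x: "x \<in> M" and r: "r > 0"
  shows "countable A"
proof -
  have "A \<subseteq> (\<Union>n. A \<inter> mcball x (2 ^ n * r))"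
  proof
    fix a assume a: "a \<in> A"
    obtain n where "d x a / r < 2 ^ n" using real_arch_pow[of 2 "d x a / r"] by auto
    then have "d x a \<le> 2 ^ n * r" using r by (simp add: field_simps)
    then show "a \<in> (\<Union>n. A \<inter> mcball x (2 ^ n * r))" using a A(1) x by auto
  qed
  moreover have "countable (\<Union>n. A \<inter> mcball x (2 ^ n * r))"
    using separated_ball(1)[OF A x r] by (intro countable_UN) (auto intro: countable_finite)
  ultimately show ?thesis by (rule countable_subset)
qed

text \<open>The centres are enumerated by \<open>nat\<close>, with repetitions if the net is finite;
  surplus indices carry the zero function. \<open>N ^ 2\<close> bounds the net points in a ball of
  radius \<open>2 * r\<close>. The Lipschitz constant adds \<open>1 / r\<close> from a single tent
  and \<open>2 * N ^ 2 / r\<close> from the normalising sum.\<close>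

definition partition :: "real \<Rightarrow> (nat \<Rightarrow> 'a) \<Rightarrow> (nat \<Rightarrow> 'a \<Rightarrow> real) \<Rightarrow> bool" where
  "partition r u \<phi> \<longleftrightarrow> (\<forall>i. u i \<in> M) \<and>
    (\<forall>i. \<forall>x\<in>M. 0 \<le> \<phi> i x \<and> \<phi> i x \<le> 1 \<and> (\<phi> i x \<noteq> 0 \<longrightarrow> d x (u i) \<le> 2 * r)) \<and>
    (\<forall>x\<in>M. finite {i. \<phi> i x \<noteq> 0} \<and> card {i. \<phi> i x \<noteq> 0} \<le> N ^ 2 \<and> (\<Sum>i | \<phi> i x \<noteq> 0. \<phi> i x) = 1) \<and>
    (\<forall>i. \<forall>x\<in>M. \<forall>y\<in>M. \<bar>\<phi> i x - \<phi> i y\<bar> \<le> (2 * real N ^ 2 + 1) / r * d x y)"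

text \<open>Tents \<open>max 0 (2 * r - d x a)\<close> over a maximal \<open>r\<close>-separated set
  are divided by their sum \<open>\<Psi>\<close>. They reach out to \<open>2 * r\<close> although
  the net is already \<open>r\<close>-dense, which is what gives
  \<open>\<Psi> x \<ge> r\<close>.\<close>

lemma partition_of_unity:
  assumes r: "r > 0" and M: "M \<noteq> {}"
  shows "\<exists>u \<phi>. partition r u \<phi>"
proof -
  obtain A where A: "A \<subseteq> M" "\<And>u v. u \<in> A \<Longrightarrow> v \<in> A \<Longrightarrow> u \<noteq> v \<Longrightarrow> d u v > r"
    "\<And>x. x \<in> M \<Longrightarrow> \<exists>a\<in>A. d x a \<le> r"
    using maximal_separated[of r] r by (metis less_imp_le)
  obtain x0 where x0: "x0 \<in> M" using M by blast
  have A0: "A \<noteq> {}" using A(3)[OF x0] by auto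
  have cA: "countable A" by (rule countable_separated[OF A(1,2) x0 r])
  define h where "h = to_nat_on A"
  have h: "inj_on h A" unfolding h_def by (rule inj_on_to_nat_on[OF cA])
  define u where "u = from_nat_into A"
  have uA: "u i \<in> A" for i unfolding u_def by (rule from_nat_into[OF A0])
  have uh: "u (h a) = a" if "a \<in> A" for a using that cA by (simp add: u_def h_def)
  define \<psi> where "\<psi> = (\<lambda>a x. max 0 (2 * r - d x a))"
  define B where "B = (\<lambda>x. A \<inter> mcball x (2 * r))"
  have B: "finite (B x)" "card (B x) \<le> N ^ 2" if "x \<in> M" for x
    using separated_ball[OF A(1,2) that r, of 1] by (simp_all add: B_def power2_eq_square)
  define \<Psi> where "\<Psi> = (\<lambda>x. \<Sum>a\<in>B x. \<psi> a x)"
  have \<psi>0: "\<psi> a x \<ge> 0" for a x by (simp add: \<psi>_def)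
  have \<psi>B: "a \<in> B x" if "\<psi> a x \<noteq> 0" "a \<in> A" "x \<in> M" for a x
    using that A(1) by (auto simp: \<psi>_def B_def max_def split: if_splits)
  have \<Psi>: "\<Psi> x \<ge> r" if x: "x \<in> M" for x
  proof -
    obtain a where a: "a \<in> A" "d x a \<le> r" using A(3)[OF x] by blast
    then have "\<psi> a x \<ge> r" by (simp add: \<psi>_def)
    moreover have "a \<in> B x" using a r x A(1) by (auto simp: B_def)
    then have "\<psi> a x \<le> \<Psi> x" unfolding \<Psi>_def
      using B(1)[OF x] \<psi>0 by (intro member_le_sum) auto
    ultimately show ?thesis by simp
  qed
  have \<psi>_le: "\<psi> a x \<le> \<Psi> x" if "x \<in> M" "a \<in> A" for a x
  proof (cases "\<psi> a x = 0")
    case True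
    then show ?thesis using \<Psi>[OF that(1)] r by simp
  next
    case False
    then have "a \<in> B x" using \<psi>B that by auto
    then show ?thesis unfolding \<Psi>_def using B(1)[OF that(1)] \<psi>0 by (intro member_le_sum) auto
  qed
  have \<psi>_lip: "\<bar>\<psi> a x - \<psi> a y\<bar> \<le> d x y" if "x \<in> M" "y \<in> M" "a \<in> A" for a x y
    using triangle[of x y a] triangle[of y x a] commute[of x y] that A(1) by (auto simp: \<psi>_def subset_iff)
  have \<Psi>_lip: "\<bar>\<Psi> x - \<Psi> y\<bar> \<le> 2 * real N ^ 2 * d x y" if x: "x \<in> M" and y: "y \<in> M" for x y
  proof -
    \<comment> \<open>Both sums are extended by zero terms to one index set with at most
      \<open>2 * N ^ 2\<close> points, so that they can be subtracted termwise.\<close>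
    have eq: "\<Psi> w = (\<Sum>a\<in>B x \<union> B y. \<psi> a w)" if "w \<in> {x, y}" for w
      unfolding \<Psi>_def using that B(1)[OF x] B(1)[OF y] \<psi>B[of _ w] x y
      by (intro sum.mono_neutral_left) (auto simp: B_def)
    have "\<bar>\<Psi> x - \<Psi> y\<bar> \<le> (\<Sum>a\<in>B x \<union> B y. \<bar>\<psi> a x - \<psi> a y\<bar>)"
      by (simp add: eq sum_subtractf[symmetric] sum_abs)
    also have "\<dots> \<le> real (card (B x \<union> B y)) * d x y"
      by (rule sum_bounded_above) (use \<psi>_lip[OF x y] in \<open>auto simp: B_def\<close>)
    also have "\<dots> \<le> real (2 * N ^ 2) * d x y"
      using card_Un_le[of "B x" "B y"] B(2)[OF x] B(2)[OF y]
      by (intro mult_right_mono of_nat_mono) auto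
    finally show ?thesis by simp
  qed
  \<comment> \<open>Restricting to the range of \<open>h\<close> counts each net point once even
    where \<open>u\<close> repeats it.\<close>
  define \<phi> where "\<phi> = (\<lambda>i x. if i \<in> h ` A then \<psi> (u i) x / \<Psi> x else 0)"
  have \<phi>_supp: "{i. \<phi> i x \<noteq> 0} = h ` {a\<in>B x. \<psi> a x \<noteq> 0}" if x: "x \<in> M" for x
  proof -
    have "\<phi> (h a) x \<noteq> 0 \<longleftrightarrow> \<psi> a x \<noteq> 0" if "a \<in> A" for a
      using that \<Psi>[OF x] r by (simp add: \<phi>_def uh)
    moreover have "i \<in> h ` A" if "\<phi> i x \<noteq> 0" for i
      using that by (auto simp: \<phi>_def split: if_splits)
    moreover have "B x \<subseteq> A" by (simp add: B_def)
    ultimately show ?thesis using \<psi>B[OF _ _ x] by blast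
  qed
  show ?thesis
    unfolding partition_def
  proof (intro exI[of _ u] exI[of _ \<phi>] conjI allI ballI impI)
    show "u i \<in> M" for i using uA A(1) by auto
    show "0 \<le> \<phi> i x" if "x \<in> M" for i x using \<Psi>[OF that] \<psi>0 r by (auto simp: \<phi>_def)
    show "\<phi> i x \<le> 1" if "x \<in> M" for i x
      using \<Psi>[OF that] \<psi>_le[OF that] uA r by (auto simp: \<phi>_def)
    show "d x (u i) \<le> 2 * r" if "x \<in> M" "\<phi> i x \<noteq> 0" for i x
      using that by (auto simp: \<phi>_def \<psi>_def max_def split: if_splits)
    have fin: "finite {a\<in>B x. \<psi> a x \<noteq> 0}" if "x \<in> M" for x using B(1)[OF that] by simp
    show "finite {i. \<phi> i x \<noteq> 0}" if "x \<in> M" for x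
      unfolding \<phi>_supp[OF that] using fin[OF that] by simp
    show "card {i. \<phi> i x \<noteq> 0} \<le> N ^ 2" if x: "x \<in> M" for x
      unfolding \<phi>_supp[OF x]
      using card_image_le[OF fin[OF x], of h] card_mono[OF B(1)[OF x], of "{a\<in>B x. \<psi> a x \<noteq> 0}"] B(2)[OF x]
      by auto
    show "(\<Sum>i | \<phi> i x \<noteq> 0. \<phi> i x) = 1" if x: "x \<in> M" for x
    proof -
      have "inj_on h {a\<in>B x. \<psi> a x \<noteq> 0}" by (rule inj_on_subset[OF h]) (auto simp: B_def)
      then have "(\<Sum>i | \<phi> i x \<noteq> 0. \<phi> i x) = (\<Sum>a | a \<in> B x \<and> \<psi> a x \<noteq> 0. \<phi> (h a) x)"
        unfolding \<phi>_supp[OF x] by (subst sum.reindex) auto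
      also have "\<dots> = (\<Sum>a | a \<in> B x \<and> \<psi> a x \<noteq> 0. \<psi> a x / \<Psi> x)"
        by (rule sum.cong) (auto simp: \<phi>_def uh B_def)
      also have "\<dots> = (\<Sum>a\<in>B x. \<psi> a x / \<Psi> x)"
        using B(1)[OF x] by (intro sum.mono_neutral_left) auto
      also have "\<dots> = \<Psi> x / \<Psi> x"
        unfolding \<Psi>_def by (rule sum_divide_distrib[symmetric])
      also have "\<dots> = 1" using \<Psi>[OF x] r by simp
      finally show ?thesis .
    qed
    show "\<bar>\<phi> i x - \<phi> i y\<bar> \<le> (2 * real N ^ 2 + 1) / r * d x y" if x: "x \<in> M" and y: "y \<in> M" for i x y
    proof (cases "i \<in> h ` A")
      case True
      define a where "a = u i"
      have a: "a \<in> A" using uA by (simp add: a_def)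
      have pos: "\<Psi> x > 0" "\<Psi> y > 0" using \<Psi>[OF x] \<Psi>[OF y] r by auto
      \<comment> \<open>The quotient rule is arranged so that the factor
        \<open>\<psi> a y / \<Psi> y\<close> is at most 1 and each difference is divided by a single
        \<open>\<Psi> x \<ge> r\<close>.\<close>
      have "\<psi> a x / \<Psi> x - \<psi> a y / \<Psi> y = (\<psi> a x - \<psi> a y) / \<Psi> x + \<psi> a y / \<Psi> y * ((\<Psi> y - \<Psi> x) / \<Psi> x)"
        using pos by (simp add: field_simps)
      then have "\<bar>\<psi> a x / \<Psi> x - \<psi> a y / \<Psi> y\<bar> \<le> \<bar>(\<psi> a x - \<psi> a y) / \<Psi> x\<bar> + \<bar>\<psi> a y / \<Psi> y * ((\<Psi> y - \<Psi> x) / \<Psi> x)\<bar>"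
        by (simp only: abs_triangle_ineq)
      also have "\<dots> = \<bar>\<psi> a x - \<psi> a y\<bar> / \<Psi> x + \<psi> a y / \<Psi> y * (\<bar>\<Psi> x - \<Psi> y\<bar> / \<Psi> x)"
        using pos \<psi>0[of a y] by (simp add: abs_mult abs_minus_commute)
      also have "\<dots> \<le> d x y / r + 1 * (2 * real N ^ 2 * d x y / r)"
        using \<psi>_lip[OF x y a] \<Psi>_lip[OF x y] \<Psi>[OF x] \<Psi>[OF y] r \<psi>_le[OF y a] \<psi>0[of a y] pos
        by (intro add_mono mult_mono frac_le) auto
      also have "\<dots> = (2 * real N ^ 2 + 1) / r * d x y" by (simp add: add_divide_distrib distrib_right)
      finally show ?thesis using True by (simp add: \<phi>_def a_def)
    qed (use r in \<open>simp add: \<phi>_def\<close>)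
  qed
qed

end

lemma (in Metric_space) doubling_spaceE:
  assumes "doubling M d"
  obtains N where "doubling_space M d N"
proof -
  obtain N :: nat where "\<forall>x\<in>M. \<forall>r>0. \<exists>C\<subseteq>M. finite C \<and> card C \<le> N \<and> mcball x (2 * r) \<subseteq> (\<Union>c\<in>C. mcball c r)"
    using assms unfolding doubling_def by blast
  then have "doubling_space M d N" by unfold_locales blast
  then show ?thesis using that by blast
qed

section \<open>Snowflake metrics and sums over dyadic scales\<close>

lemma (in Metric_space) snowflake_metric:
  assumes "0 < \<alpha>" "\<alpha> < 1"
  shows "Metric_space M (\<lambda>x y. d x y powr \<alpha>)"
proof
  fix x y w assume *: "x \<in> M" "y \<in> M" "w \<in> M"
  have "d x w powr \<alpha> \<le> (d x y + d y w) powr \<alpha>"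
    using assms triangle[OF *] by (intro powr_mono2) auto
  also have "\<dots> \<le> d x y powr \<alpha> + d y w powr \<alpha>" using assms by (intro powr_add_le) auto
  finally show "d x w powr \<alpha> \<le> d x y powr \<alpha> + d y w powr \<alpha>" .
qed (auto simp: commute)

text \<open>The integer \<open>l\<close> with number \<open>n\<close> in the enumeration
  \<open>int_decode\<close> satisfies \<open>\<bar>l\<bar> \<ge> n / 2\<close>, which leaves a
  geometric series with ratio \<open>2 powr (- c / 2)\<close>.\<close>

lemma nn_integral_int_geometric:
  fixes c :: real
  assumes c: "c > 0"
  obtains B where "B > 0" "(\<integral>\<^sup>+ (l::int). ennreal (2 powr (- c * \<bar>of_int l\<bar>)) \<partial>count_space UNIV) \<le> ennreal B"
proof -
  define q where "q = 2 powr (- c / 2)"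
  have q: "0 < q" "q < 1" using c by (auto simp: q_def powr_less_one)
  have dec: "real n / 2 \<le> \<bar>of_int (int_decode n)\<bar>" for n
    by (auto simp: int_decode_def sum_decode_def real_of_nat_div elim!: oddE evenE)
  have "(\<integral>\<^sup>+ (l::int). ennreal (2 powr (- c * \<bar>of_int l\<bar>)) \<partial>count_space UNIV)
      = (\<integral>\<^sup>+ n. ennreal (2 powr (- c * \<bar>of_int (int_decode n)\<bar>)) \<partial>count_space UNIV)"
    by (rule nn_integral_bij_count_space[OF bij_int_decode, symmetric])
  also have "\<dots> \<le> (\<integral>\<^sup>+ n. ennreal (q ^ n) \<partial>count_space UNIV)"
  proof (intro nn_integral_mono ennreal_leI)
    fix n
    have "2 powr (- c * \<bar>of_int (int_decode n)\<bar>) \<le> 2 powr (- c * (real n / 2))"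
      using dec[of n] c by (intro powr_mono) auto
    also have "\<dots> = q ^ n"
      using q by (simp add: q_def powr_realpow[symmetric] powr_powr)
    finally show "2 powr (- c * \<bar>of_int (int_decode n)\<bar>) \<le> q ^ n" .
  qed
  also have "\<dots> = ennreal (1 / (1 - q))"
    using q by (simp add: nn_integral_count_space_nat suminf_ennreal2 suminf_geometric)
  finally show ?thesis using q by (intro that[of "1 / (1 - q)"]) auto
qed

text \<open>At scales below \<open>t\<close> the minimum is 1 and the terms decay with exponent
  \<open>\<alpha> * p\<close>; above \<open>t\<close> the quotient takes over and they decay with
  exponent \<open>(1 - \<alpha>) * p\<close>. Both exponents are positive for 0 < \<alpha> <
  1.\<close>

lemma dyadic_sum_bound:
  fixes \<alpha> p :: real
  assumes "0 < \<alpha>" "\<alpha> < 1" "0 < p"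
  shows "\<exists>B>0. \<forall>t>0. (\<integral>\<^sup>+ (k::int). ennreal (min 1 (t / 2 powr (- of_int k)) powr p * (2 powr (- of_int k)) powr (\<alpha> * p))
        \<partial>count_space UNIV) \<le> ennreal (B * t powr (\<alpha> * p))"
proof -
  \<comment> \<open>The slower of the two decay rates, at fine and at coarse scales.\<close>
  define c where "c = p * min \<alpha> (1 - \<alpha>)"
  have c: "c > 0" "c \<le> p * \<alpha>" "c \<le> p * (1 - \<alpha>)" using assms by (auto simp: c_def)
  obtain B where B: "B > 0" "(\<integral>\<^sup>+ (l::int). ennreal (2 powr (- c * \<bar>of_int l\<bar>)) \<partial>count_space UNIV) \<le> ennreal B"
    using nn_integral_int_geometric[OF c(1)] by blast
  have "(\<integral>\<^sup>+ (k::int). ennreal (min 1 (t / 2 powr (- of_int k)) powr p * (2 powr (- of_int k)) powr (\<alpha> * p)) \<partial>count_space UNIV)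
      \<le> ennreal (2 powr (\<alpha> * p) * B * t powr (\<alpha> * p))" if t: "t > 0" for t
  proof -
    define s where "s = - log 2 t"
    \<comment> \<open>The scale of \<open>t\<close>: \<open>2 powr (- k0)\<close> lies between
      \<open>t\<close> and \<open>2 * t\<close>. Centring the sum at \<open>k0\<close> costs only
      the 2 in \<open>(2 * t) powr (\<alpha> * p)\<close>.\<close>
    define k0 where "k0 = \<lfloor>s\<rfloor>"
    have ts: "t = 2 powr (- s)" using t by (simp add: s_def)
    have k0: "of_int k0 \<le> s" "s < of_int k0 + 1" by (auto simp: k0_def)
    have bij: "bij ((+) k0)" by (rule bij_plus)
    have "(\<integral>\<^sup>+ (k::int). ennreal (min 1 (t / 2 powr (- of_int k)) powr p * (2 powr (- of_int k)) powr (\<alpha> * p)) \<partial>count_space UNIV)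
      = (\<integral>\<^sup>+ (l::int). ennreal (min 1 (t / 2 powr (- of_int (k0 + l))) powr p * (2 powr (- of_int (k0 + l))) powr (\<alpha> * p)) \<partial>count_space UNIV)"
      by (rule nn_integral_bij_count_space[OF bij, symmetric])
    also have "\<dots> \<le> (\<integral>\<^sup>+ (l::int). ennreal ((2 * t) powr (\<alpha> * p)) * ennreal (2 powr (- c * \<bar>of_int l\<bar>)) \<partial>count_space UNIV)"
    proof (intro nn_integral_mono)
      fix l :: int
      have quot: "t / 2 powr (- of_int (k0 + l)) = 2 powr (of_int (k0 + l) - s)"
        unfolding ts by (simp add: powr_diff[symmetric] algebra_simps)
      have tw: "(2 * t) powr (\<alpha> * p) = 2 powr ((1 - s) * (\<alpha> * p))"
      proof -
        have "2 * t = 2 powr (1 - s)" unfolding ts by (simp add: powr_diff powr_minus field_simps)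
        then show ?thesis by (simp add: powr_powr)
      qed
      have "min 1 (t / 2 powr (- of_int (k0 + l))) powr p * (2 powr (- of_int (k0 + l))) powr (\<alpha> * p)
          \<le> (2 * t) powr (\<alpha> * p) * 2 powr (- c * \<bar>of_int l\<bar>)"
      proof (cases "l \<ge> 0")
        case True
        have "min 1 (t / 2 powr (- of_int (k0 + l))) powr p \<le> 1 powr p"
          using assms t by (intro powr_mono2) auto
        then have "min 1 (t / 2 powr (- of_int (k0 + l))) powr p * (2 powr (- of_int (k0 + l))) powr (\<alpha> * p)
            \<le> 1 * 2 powr (- of_int (k0 + l) * (\<alpha> * p))"
          unfolding powr_powr by (intro mult_right_mono) auto
        also have "\<dots> \<le> 2 powr ((1 - s) * (\<alpha> * p) - c * of_int l)"
        proof -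
          have "- of_int k0 * (\<alpha> * p) \<le> (1 - s) * (\<alpha> * p)"
            using k0 assms by (intro mult_right_mono) auto
          moreover have "c * of_int l \<le> p * \<alpha> * of_int l" using c True by (intro mult_right_mono) auto
          ultimately have "- of_int (k0 + l) * (\<alpha> * p) \<le> (1 - s) * (\<alpha> * p) - c * of_int l"
            by (simp add: algebra_simps)
          then show ?thesis by simp
        qed
        also have "\<dots> = (2 * t) powr (\<alpha> * p) * 2 powr (- c * \<bar>of_int l\<bar>)"
          using True by (simp add: tw powr_add[symmetric])
        finally show ?thesis .
      next
        case False
        have "min 1 (t / 2 powr (- of_int (k0 + l))) powr p \<le> (2 powr (of_int (k0 + l) - s)) powr p"
          unfolding quot using assms by (intro powr_mono2) auto
        then have "min 1 (t / 2 powr (- of_int (k0 + l))) powr p * (2 powr (- of_int (k0 + l))) powr (\<alpha> * p)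
            \<le> 2 powr ((of_int (k0 + l) - s) * p) * 2 powr (- of_int (k0 + l) * (\<alpha> * p))"
          unfolding powr_powr by (intro mult_right_mono) auto
        also have "\<dots> = 2 powr ((of_int (k0 + l) - s) * p - of_int (k0 + l) * (\<alpha> * p))"
          by (simp add: powr_add[symmetric] algebra_simps)
        also have "\<dots> \<le> 2 powr ((1 - s) * (\<alpha> * p) + c * of_int l)"
        proof -
          have "(of_int k0 - s) * (p * (1 - \<alpha>)) \<le> 0"
            using k0 assms by (intro mult_nonpos_nonneg) auto
          moreover have "p * (1 - \<alpha>) * of_int l \<le> c * of_int l"
            using c False by (intro mult_right_mono_neg) auto
          moreover have "0 \<le> \<alpha> * p" using assms by simp
          ultimately have "(of_int (k0 + l) - s) * p - of_int (k0 + l) * (\<alpha> * p) \<le> (1 - s) * (\<alpha> * p) + c * of_int l"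
            by (simp add: algebra_simps)
          then show ?thesis by simp
        qed
        also have "\<dots> = (2 * t) powr (\<alpha> * p) * 2 powr (- c * \<bar>of_int l\<bar>)"
          using False by (simp add: tw powr_add[symmetric])
        finally show ?thesis .
      qed
      then show "ennreal (min 1 (t / 2 powr (- of_int (k0 + l))) powr p * (2 powr (- of_int (k0 + l))) powr (\<alpha> * p))
          \<le> ennreal ((2 * t) powr (\<alpha> * p)) * ennreal (2 powr (- c * \<bar>of_int l\<bar>))"
        by (simp add: ennreal_mult[symmetric] ennreal_leI)
    qed
    also have "\<dots> = ennreal ((2 * t) powr (\<alpha> * p)) * (\<integral>\<^sup>+ (l::int). ennreal (2 powr (- c * \<bar>of_int l\<bar>)) \<partial>count_space UNIV)"
      by (rule nn_integral_cmult) auto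
    also have "\<dots> \<le> ennreal ((2 * t) powr (\<alpha> * p)) * ennreal B" using B by (intro mult_left_mono) auto
    also have "\<dots> = ennreal (2 powr (\<alpha> * p) * B * t powr (\<alpha> * p))"
      using t B by (simp add: ennreal_mult[symmetric] powr_mult mult_ac)
    finally show ?thesis .
  qed
  then show ?thesis using B(1) by (intro exI[of _ "2 powr (\<alpha> * p) * B"]) simp
qed

section \<open>The multiscale decomposition\<close>

locale snowflake = exponent p + doubling_space M d N for p and M :: "'a set" and d and N +
  fixes \<alpha> :: real and z :: 'a
  assumes \<alpha>: "0 < \<alpha>" "\<alpha> < 1" and z: "z \<in> M"
begin

definition \<sigma> :: "'a \<Rightarrow> 'a \<Rightarrow> real" where "\<sigma> x y = d x y powr \<alpha>"

sublocale F: pfree p M \<sigma> z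
proof -
  have "Metric_space M \<sigma>" unfolding \<sigma>_def by (rule snowflake_metric[OF \<alpha>])
  then show "pfree p M \<sigma> z"
    by (intro pfree.intro pfree_axioms.intro exponent_axioms z)
qed

lemma \<sigma>_powr: "\<sigma> x y powr p = d x y powr (\<alpha> * p)"
  by (simp add: \<sigma>_def powr_powr)

end

lemma sum_int_telescope:
  fixes f :: "int \<Rightarrow> 'b::ab_group_add"
  shows "(\<Sum>k\<in>{- int K..<int K}. f (k + 1) - f k) = f (int K) - f (- int K)"
proof (induction K)
  case (Suc K)
  have "{- int (Suc K)..<int (Suc K)} = insert (- int (Suc K)) (insert (int K) {- int K..<int K})" by auto
  then have "(\<Sum>k\<in>{- int (Suc K)..<int (Suc K)}. f (k + 1) - f k)
      = (f (- int (Suc K) + 1) - f (- int (Suc K))) + ((f (int K + 1) - f (int K)) + (\<Sum>k\<in>{- int K..<int K}. f (k + 1) - f k))"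
    by simp
  then show ?case unfolding Suc by (simp add: algebra_simps)
qed simp

definition scale :: "int \<Rightarrow> real" where "scale k = 2 powr (- of_int k)"

lemma scale_pos [simp]: "scale k > 0"
  by (simp add: scale_def)

lemma scale_Suc: "scale (k + 1) = scale k / 2"
  by (simp add: scale_def powr_diff powr_minus field_simps)

locale wavelet = snowflake p M d N \<alpha> z for p and M :: "'a set" and d N \<alpha> z +
  fixes u :: "int \<Rightarrow> nat \<Rightarrow> 'a" and \<phi> :: "int \<Rightarrow> nat \<Rightarrow> 'a \<Rightarrow> real"
  assumes part: "partition (scale k) (u k) (\<phi> k)"
begin

definition \<Lambda> :: real where "\<Lambda> = 2 * real N ^ 2 + 1"

lemma u: "u k i \<in> M"
  using part[of k] unfolding partition_def by blast

lemma
  assumes "x \<in> M"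
  shows \<phi>_nonneg: "0 \<le> \<phi> k i x" and \<phi>_le: "\<phi> k i x \<le> 1"
    and \<phi>_supp: "\<phi> k i x \<noteq> 0 \<Longrightarrow> d x (u k i) \<le> 2 * scale k"
    and \<phi>_fin: "finite {i. \<phi> k i x \<noteq> 0}"
    and \<phi>_card: "card {i. \<phi> k i x \<noteq> 0} \<le> N ^ 2"
    and \<phi>_sum: "(\<Sum>i | \<phi> k i x \<noteq> 0. \<phi> k i x) = 1"
  using part[of k] assms unfolding partition_def by blast+

lemma \<phi>_lip: "x \<in> M \<Longrightarrow> y \<in> M \<Longrightarrow> \<bar>\<phi> k i x - \<phi> k i y\<bar> \<le> \<Lambda> / scale k * d x y"
  using part[of k] unfolding partition_def \<Lambda>_def by blast

lemma \<Lambda>: "\<Lambda> \<ge> 1"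
  by (simp add: \<Lambda>_def)

definition I :: "int \<Rightarrow> 'a \<Rightarrow> nat set" where "I k x = {i. \<phi> k i x \<noteq> 0}"

text \<open>
  The coefficients of \<open>\<Sum>\<^sub>k (P (k+1) - P k) x\<close> with respect to molecules. The coarse scales make \<open>b x\<close> itself
  fall outside \<open>\<ell>\<^sub>p\<close>; only the differences \<open>b x - b y\<close> belong to it.
\<close>

definition b :: "'a \<Rightarrow> int \<times> nat \<times> nat \<Rightarrow> real" where
  "b x = (\<lambda>(k, i, j). \<phi> (k + 1) i x * \<phi> k j x * \<sigma> (u (k + 1) i) (u k j))"

definition left :: "int \<times> nat \<times> nat \<Rightarrow> 'a" where "left = (\<lambda>(k, i, j). u (k + 1) i)"
definition right :: "int \<times> nat \<times> nat \<Rightarrow> 'a" where "right = (\<lambda>(k, i, j). u k j)"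

lemma I_fin: "x \<in> M \<Longrightarrow> finite (I k x)" and I_card: "x \<in> M \<Longrightarrow> card (I k x) \<le> N ^ 2"
  and I_sum: "x \<in> M \<Longrightarrow> (\<Sum>i\<in>I k x. \<phi> k i x) = 1"
  unfolding I_def by (rule \<phi>_fin \<phi>_card \<phi>_sum; assumption)+

text \<open>The Lipschitz bound is the one that matters at scales coarser than \<open>d x y\<close>,
  the trivial bound 1 at finer ones.\<close>

lemma prod_diff:
  assumes x: "x \<in> M" and y: "y \<in> M"
  shows "\<bar>\<phi> (k + 1) i x * \<phi> k j x - \<phi> (k + 1) i y * \<phi> k j y\<bar> \<le> 3 * \<Lambda> * min 1 (d x y / scale k)"
proof -
  let ?a = "\<phi> (k + 1) i" and ?c = "\<phi> k j"
  have "?a x * ?c x - ?a y * ?c y = (?a x - ?a y) * ?c x + ?a y * (?c x - ?c y)" by (simp add: algebra_simps)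
  then have "\<bar>?a x * ?c x - ?a y * ?c y\<bar> \<le> \<bar>(?a x - ?a y) * ?c x\<bar> + \<bar>?a y * (?c x - ?c y)\<bar>"
    by (simp only: abs_triangle_ineq)
  also have "\<dots> \<le> \<bar>?a x - ?a y\<bar> * 1 + 1 * \<bar>?c x - ?c y\<bar>"
    unfolding abs_mult using \<phi>_nonneg \<phi>_le x y by (intro add_mono mult_mono) auto
  also have "\<dots> \<le> \<Lambda> / scale (k + 1) * d x y + \<Lambda> / scale k * d x y"
    using \<phi>_lip[OF x y] by (intro add_mono) auto
  \<comment> \<open>\<open>3 = 2 + 1\<close>: the partition at scale \<open>k + 1\<close> has twice
    the Lipschitz constant.\<close>
  also have "\<dots> = 3 * \<Lambda> * (d x y / scale k)" by (simp add: scale_Suc)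
  finally have 1: "\<bar>?a x * ?c x - ?a y * ?c y\<bar> \<le> 3 * \<Lambda> * (d x y / scale k)" .
  have "0 \<le> ?a x * ?c x" "?a x * ?c x \<le> 1" "0 \<le> ?a y * ?c y" "?a y * ?c y \<le> 1"
    using \<phi>_nonneg \<phi>_le x y by (auto intro: mult_le_one)
  then have "\<bar>?a x * ?c x - ?a y * ?c y\<bar> \<le> 1" by linarith
  also have "1 \<le> 3 * \<Lambda> * 1" using \<Lambda> by simp
  finally show ?thesis using 1 by (simp add: min_def)
qed

lemma dist_net:
  assumes x: "x \<in> M" and i: "i \<in> I (k + 1) x" and j: "j \<in> I k x"
  shows "\<sigma> (u (k + 1) i) (u k j) \<le> (3 * scale k) powr \<alpha>"
proof -
  \<comment> \<open>The radius \<open>2 * scale (k + 1)\<close> equals \<open>scale k\<close>, so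
    the two radii add up to \<open>3 * scale k\<close>.\<close>
  have "d x (u (k + 1) i) \<le> scale k" "d x (u k j) \<le> 2 * scale k"
    using \<phi>_supp[OF x, of "k + 1" i] \<phi>_supp[OF x, of k j] i j by (auto simp: I_def scale_Suc)
  then have "d (u (k + 1) i) (u k j) \<le> 3 * scale k"
    using triangle''[OF u[of "k + 1" i] x u[of k j]] by simp
  then show ?thesis unfolding \<sigma>_def using \<alpha> by (intro powr_mono2) auto
qed

text \<open>Each of \<open>x\<close> and \<open>y\<close> activates at most \<open>N^2 * N^2\<close>
  pairs of indices; on these the coefficient is bounded by \<open>prod_diff\<close> and
  \<open>dist_net\<close>.\<close>

lemma b_level:
  assumes x: "x \<in> M" and y: "y \<in> M"
  shows "lpn p (\<lambda>t. (b x - b y) (k, t))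
    \<le> ennreal (2 * real N ^ 4 * (3 * \<Lambda> * 3 powr \<alpha>) powr p) *
      ennreal (min 1 (d x y / scale k) powr p * scale k powr (\<alpha> * p))"
proof -
  define A where "A = I (k + 1) x \<times> I k x \<union> I (k + 1) y \<times> I k y"
  define m where "m = min 1 (d x y / scale k)"
  have m: "m \<ge> 0" by (simp add: m_def divide_nonneg_pos)
  have A: "finite A" using I_fin x y by (simp add: A_def)
  have c: "card (I (k + 1) w \<times> I k w) \<le> N ^ 4" if "w \<in> M" for w
    using mult_le_mono[OF I_card[OF that] I_card[OF that], of "k + 1" k]
    by (simp add: card_cartesian_product flip: power_add)
  have cA: "card A \<le> 2 * N ^ 4"
    using card_Un_le[of "I (k + 1) x \<times> I k x" "I (k + 1) y \<times> I k y"] c[OF x] c[OF y]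
    by (simp add: A_def)
  have "\<bar>(b x - b y) (k, t)\<bar> powr p \<le> (3 * \<Lambda> * m * (3 * scale k) powr \<alpha>) powr p" if t: "t \<in> A" for t
  proof -
    obtain i j where ij: "t = (i, j)" by (cases t)
    have s: "\<sigma> (u (k + 1) i) (u k j) \<le> (3 * scale k) powr \<alpha>" "0 \<le> \<sigma> (u (k + 1) i) (u k j)"
      using t ij dist_net[OF x, of i k j] dist_net[OF y, of i k j] by (auto simp: A_def)
    have "(b x - b y) (k, t) = (\<phi> (k + 1) i x * \<phi> k j x - \<phi> (k + 1) i y * \<phi> k j y) * \<sigma> (u (k + 1) i) (u k j)"
      by (simp add: b_def ij algebra_simps)
    then have "\<bar>(b x - b y) (k, t)\<bar> = \<bar>\<phi> (k + 1) i x * \<phi> k j x - \<phi> (k + 1) i y * \<phi> k j y\<bar> * \<sigma> (u (k + 1) i) (u k j)"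
      using s(2) by (simp add: abs_mult)
    also have "\<dots> \<le> 3 * \<Lambda> * m * (3 * scale k) powr \<alpha>"
      using prod_diff[OF x y, of k i j] s \<Lambda> m unfolding m_def[symmetric] by (intro mult_mono) auto
    finally show ?thesis using p_pos by (intro powr_mono2) auto
  qed
  note bd = this
  have "lpn p (\<lambda>t. (b x - b y) (k, t)) = ennreal (\<Sum>t\<in>A. \<bar>(b x - b y) (k, t)\<bar> powr p)"
    by (rule lpn_finite[OF A]) (auto simp: A_def b_def I_def)
  also have "\<dots> \<le> ennreal (real (card A) * (3 * \<Lambda> * m * (3 * scale k) powr \<alpha>) powr p)"
    by (intro ennreal_leI sum_bounded_above bd)
  also have "\<dots> \<le> ennreal (real (2 * N ^ 4) * (3 * \<Lambda> * m * (3 * scale k) powr \<alpha>) powr p)"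
    using cA by (intro ennreal_leI mult_right_mono of_nat_mono) auto
  also have "(3 * \<Lambda> * m * (3 * scale k) powr \<alpha>) powr p
      = (3 * \<Lambda> * 3 powr \<alpha>) powr p * (m powr p * scale k powr (\<alpha> * p))"
    using \<Lambda> m by (simp add: powr_mult powr_powr less_imp_le mult_ac)
  finally show ?thesis by (simp add: m_def ennreal_mult[symmetric] mult_ac)
qed

lemma b_bound: "\<exists>C>0. \<forall>x\<in>M. \<forall>y\<in>M. lpn p (b x - b y) \<le> ennreal (C * \<sigma> x y powr p)"
proof -
  obtain B where B: "B > 0" "\<And>t. t > 0 \<Longrightarrow>
      (\<integral>\<^sup>+ (k::int). ennreal (min 1 (t / scale k) powr p * scale k powr (\<alpha> * p)) \<partial>count_space UNIV)
        \<le> ennreal (B * t powr (\<alpha> * p))"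
    using dyadic_sum_bound[OF \<alpha> p_pos] unfolding scale_def by blast
  define D where "D = 2 * real N ^ 4 * (3 * \<Lambda> * 3 powr \<alpha>) powr p"
  have D: "D \<ge> 0" by (simp add: D_def)
  \<comment> \<open>\<open>D\<close> is only known to be nonnegative; \<open>D + 1\<close> makes the
    constant positive.\<close>
  have "lpn p (b x - b y) \<le> ennreal ((D + 1) * B * \<sigma> x y powr p)" if x: "x \<in> M" and y: "y \<in> M" for x y
  proof (cases "x = y")
    case False
    then have t: "d x y > 0" using x y by simp
    have "lpn p (b x - b y) = (\<integral>\<^sup>+ k. lpn p (\<lambda>t. (b x - b y) (k, t)) \<partial>count_space UNIV)"
      unfolding lpn_def by (rule nn_integral_fst_count_space[symmetric])
    also have "\<dots> \<le> (\<integral>\<^sup>+ k. ennreal D * ennreal (min 1 (d x y / scale k) powr p * scale k powr (\<alpha> * p)) \<partial>count_space UNIV)"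
      unfolding D_def by (intro nn_integral_mono b_level x y)
    also have "\<dots> = ennreal D * (\<integral>\<^sup>+ k. ennreal (min 1 (d x y / scale k) powr p * scale k powr (\<alpha> * p)) \<partial>count_space UNIV)"
      by (rule nn_integral_cmult) auto
    also have "\<dots> \<le> ennreal D * ennreal (B * d x y powr (\<alpha> * p))"
      by (intro mult_left_mono B t) auto
    also have "\<dots> = ennreal (D * (B * \<sigma> x y powr p))" using D B by (simp add: ennreal_mult \<sigma>_powr)
    also have "\<dots> \<le> ennreal ((D + 1) * B * \<sigma> x y powr p)"
      using B D by (intro ennreal_leI) (simp add: algebra_simps)
    finally show ?thesis .
  qed simp
  then show ?thesis using B D by (intro exI[of _ "(D + 1) * B"]) simp
qed

section \<open>Averages over the nets and the telescoping sum\<close>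

definition P :: "int \<Rightarrow> 'a \<Rightarrow> 'a \<Rightarrow> real" where
  "P k x = (\<Sum>i\<in>I k x. fscale (\<phi> k i x) (F.dl (u k i)))"

lemma P_V: "P k x \<in> F.V"
  unfolding P_def by (intro F.V_sum F.V_scale F.dl_V u)

text \<open>The distance inside \<open>b\<close> cancels the normalisation of the molecule. As both
  partitions sum to 1 at \<open>x\<close>, the double sum of differences of point masses then
  separates into two averages.\<close>

lemma P_Suc:
  assumes x: "x \<in> M"
  shows "(\<Sum>i\<in>I (k + 1) x. \<Sum>j\<in>I k x. fscale (b x (k, i, j)) (F.mol (u (k + 1) i) (u k j))) = P (k + 1) x - P k x"
proof -
  have "fscale (b x (k, i, j)) (F.mol (u (k + 1) i) (u k j))
      = fscale (\<phi> (k + 1) i x * \<phi> k j x) (F.dl (u (k + 1) i) - F.dl (u k j))" for i j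
    unfolding F.scale_mol[OF u u, symmetric] by (simp add: b_def)
  then have "(\<Sum>i\<in>I (k + 1) x. \<Sum>j\<in>I k x. fscale (b x (k, i, j)) (F.mol (u (k + 1) i) (u k j))) w
      = (\<Sum>i\<in>I (k + 1) x. \<Sum>j\<in>I k x. \<phi> k j x * (\<phi> (k + 1) i x * F.dl (u (k + 1) i) w))
        - (\<Sum>i\<in>I (k + 1) x. \<Sum>j\<in>I k x. \<phi> (k + 1) i x * (\<phi> k j x * F.dl (u k j) w))" for w
    by (simp add: sum_fun_apply sum_subtractf[symmetric] algebra_simps)
  also have "\<dots> w = (P (k + 1) x - P k x) w" for w
    by (simp add: sum_distrib_left[symmetric] sum_distrib_right[symmetric] I_sum[OF x] P_def sum_fun_apply)
  finally show ?thesis by (simp only: fun_eq_iff) blast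
qed

definition band :: "nat \<Rightarrow> (int \<times> nat \<times> nat) set" where
  "band K = {- int K..<int K} \<times> UNIV"

lemma restr_band_supp:
  "{t. restr (b x) (band K) t \<noteq> 0} \<subseteq> (SIGMA k:{- int K..<int K}. I (k + 1) x \<times> I k x)"
  by (auto simp: restr_def band_def b_def I_def)

lemma restr_band_finsupp: "x \<in> M \<Longrightarrow> restr (b x) (band K) \<in> finsupp"
  unfolding finsupp_def mem_Collect_eq by (rule finite_subset[OF restr_band_supp]) (auto intro!: I_fin)

lemma fext_band:
  assumes x: "x \<in> M"
  shows "fext (\<lambda>t. F.mol (left t) (right t)) (restr (b x) (band K)) = P (int K) x - P (- int K) x"
proof -
  have "fext (\<lambda>t. F.mol (left t) (right t)) (restr (b x) (band K))
      = (\<Sum>t\<in>(SIGMA k:{- int K..<int K}. I (k + 1) x \<times> I k x). fscale (restr (b x) (band K) t) (F.mol (left t) (right t)))"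
    by (rule fext_eq[OF _ restr_band_supp]) (auto intro!: I_fin x)
  also have "\<dots> = (\<Sum>k\<in>{- int K..<int K}. \<Sum>t\<in>I (k + 1) x \<times> I k x. fscale (restr (b x) (band K) (k, t)) (F.mol (left (k, t)) (right (k, t))))"
    by (subst sum.Sigma) (auto intro!: I_fin x simp: case_prod_beta)
  also have "\<dots> = (\<Sum>k\<in>{- int K..<int K}. P (k + 1) x - P k x)"
  proof (rule sum.cong[OF refl])
    fix k assume "k \<in> {- int K..<int K}"
    then have "restr (b x) (band K) (k, t) = b x (k, t)" for t by (auto simp: restr_def band_def)
    then show "(\<Sum>t\<in>I (k + 1) x \<times> I k x. fscale (restr (b x) (band K) (k, t)) (F.mol (left (k, t)) (right (k, t)))) = P (k + 1) x - P k x"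
      unfolding P_Suc[OF x, symmetric] by (simp add: sum.cartesian_product left_def right_def case_prod_beta)
  qed
  also have "\<dots> = P (int K) x - P (- int K) x"
    by (rule sum_int_telescope)
  finally show ?thesis .
qed

text \<open>The weights sum to 1, so \<open>F.dl x\<close> can be distributed over them; what
  remains are differences across a distance of at most \<open>2 * scale k\<close>.\<close>

lemma G_fine:
  assumes x: "x \<in> M"
  shows "F.G (F.dl x - P k x) \<le> real N ^ 2 * (2 * scale k) powr (\<alpha> * p)"
proof -
  have "F.dl x = (\<Sum>i\<in>I k x. fscale (\<phi> k i x) (F.dl x))"
    by (simp add: fun_eq_iff sum_fun_apply sum_distrib_right[symmetric] I_sum[OF x])
  then have eq: "F.dl x - P k x = (\<Sum>i\<in>I k x. fscale (\<phi> k i x) (F.dl x - F.dl (u k i)))"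
    unfolding P_def by (simp add: fscale_diff sum_subtractf)
  have "F.G (F.dl x - P k x) \<le> (\<Sum>i\<in>I k x. F.G (fscale (\<phi> k i x) (F.dl x - F.dl (u k i))))"
    unfolding eq by (rule F.G_sum) (intro F.V_scale F.V_diff F.dl_V x u)
  also have "\<dots> \<le> (\<Sum>i\<in>I k x. (2 * scale k) powr (\<alpha> * p))"
  proof (rule sum_mono)
    fix i assume i: "i \<in> I k x"
    have "F.G (fscale (\<phi> k i x) (F.dl x - F.dl (u k i))) = \<bar>\<phi> k i x\<bar> powr p * F.G (F.dl x - F.dl (u k i))"
      by (rule F.G_scale[OF F.V_diff[OF F.dl_V[OF x] F.dl_V[OF u]]])
    also have "\<dots> \<le> 1 * d x (u k i) powr (\<alpha> * p)"
      using \<phi>_nonneg[OF x, of k i] \<phi>_le[OF x, of k i] F.G_dl[OF x u, of k i] p_pos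
      by (intro mult_mono) (auto simp: \<sigma>_powr powr_le1)
    also have "\<dots> \<le> (2 * scale k) powr (\<alpha> * p)"
      using \<phi>_supp[OF x, of k i] i \<alpha> p_pos by (auto simp: I_def intro!: powr_mono2)
    finally show "F.G (fscale (\<phi> k i x) (F.dl x - F.dl (u k i))) \<le> (2 * scale k) powr (\<alpha> * p)" .
  qed
  also have "\<dots> = real (card (I k x)) * (2 * scale k) powr (\<alpha> * p)" by simp
  also have "\<dots> \<le> real (N ^ 2) * (2 * scale k) powr (\<alpha> * p)"
    by (intro mult_right_mono of_nat_mono I_card x) auto
  finally show ?thesis by simp
qed

text \<open>An average \<open>P k x\<close> need not be small at coarse scales, but its difference
  from \<open>P k z\<close> is: the weights differ by order \<open>d x z / scale k\<close>, point
  masses are apart by order \<open>scale k powr \<alpha>\<close>, and \<alpha> < 1 makes the product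
  decay.\<close>

lemma G_coarse:
  assumes x: "x \<in> M" and k: "d x z \<le> scale k"
  shows "F.G (P k x - P k z) \<le> 2 * real N ^ 2 * (\<Lambda> * d x z * 3 powr \<alpha>) powr p * scale k powr (- ((1 - \<alpha>) * p))"
proof -
  define A where "A = I k x \<union> I k z"
  have A: "finite A" using I_fin x z by (simp add: A_def)
  have Pw: "P k w = (\<Sum>i\<in>A. fscale (\<phi> k i w) (F.dl (u k i)))" if "w \<in> {x, z}" for w
    unfolding P_def using that A by (intro sum.mono_neutral_left) (auto simp: A_def I_def)
  \<comment> \<open>Subtracting \<open>F.dl z = 0\<close> turns every point mass into a difference
    over a distance of at most \<open>3 * scale k\<close>.\<close>
  have eq: "P k x - P k z = (\<Sum>i\<in>A. fscale (\<phi> k i x - \<phi> k i z) (F.dl (u k i) - F.dl z))"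
    by (simp add: Pw fun_eq_iff sum_fun_apply sum_subtractf[symmetric] algebra_simps)
  have "F.G (P k x - P k z) \<le> (\<Sum>i\<in>A. F.G (fscale (\<phi> k i x - \<phi> k i z) (F.dl (u k i) - F.dl z)))"
    unfolding eq by (rule F.G_sum) (intro F.V_scale F.V_diff F.dl_V z u)
  also have "\<dots> \<le> (\<Sum>i\<in>A. (\<Lambda> / scale k * d x z) powr p * (3 * scale k) powr (\<alpha> * p))"
  proof (rule sum_mono)
    fix i assume i: "i \<in> A"
    have "d (u k i) z \<le> 3 * scale k"
    proof (cases "i \<in> I k x")
      case True
      then show ?thesis using triangle''[OF u[of k i] x z] \<phi>_supp[OF x, of k i] k by (auto simp: I_def)
    next
      case False
      then have "d z (u k i) \<le> 2 * scale k" using i \<phi>_supp[OF z, of k i] by (auto simp: A_def I_def)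
      then show ?thesis using scale_pos[of k] commute[of z "u k i"] by linarith
    qed
    then have *: "d (u k i) z powr (\<alpha> * p) \<le> (3 * scale k) powr (\<alpha> * p)"
      using \<alpha> p_pos by (intro powr_mono2) auto
    have "F.G (fscale (\<phi> k i x - \<phi> k i z) (F.dl (u k i) - F.dl z)) = \<bar>\<phi> k i x - \<phi> k i z\<bar> powr p * F.G (F.dl (u k i) - F.dl z)"
      by (rule F.G_scale[OF F.V_diff[OF F.dl_V[OF u] F.dl_V[OF z]]])
    also have "\<dots> \<le> (\<Lambda> / scale k * d x z) powr p * (3 * scale k) powr (\<alpha> * p)"
      using F.G_dl[OF u z, of k i] * \<phi>_lip[OF x z, of k i] p_pos
      by (intro mult_mono powr_mono2) (auto simp: \<sigma>_powr)
    finally show "F.G (fscale (\<phi> k i x - \<phi> k i z) (F.dl (u k i) - F.dl z)) \<le> (\<Lambda> / scale k * d x z) powr p * (3 * scale k) powr (\<alpha> * p)" .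
  qed
  also have "\<dots> = real (card A) * ((\<Lambda> / scale k * d x z) powr p * (3 * scale k) powr (\<alpha> * p))" by simp
  also have "\<dots> \<le> real (2 * N ^ 2) * ((\<Lambda> / scale k * d x z) powr p * (3 * scale k) powr (\<alpha> * p))"
    using card_Un_le[of "I k x" "I k z"] I_card[OF x, of k] I_card[OF z, of k]
    by (intro mult_right_mono of_nat_mono) (auto simp: A_def)
  also have "(\<Lambda> / scale k * d x z) powr p * (3 * scale k) powr (\<alpha> * p)
      = (\<Lambda> * d x z * 3 powr \<alpha>) powr p * scale k powr (- ((1 - \<alpha>) * p))"
  proof -
    have "(\<Lambda> / scale k * d x z) powr p * (3 * scale k) powr (\<alpha> * p)
        = (\<Lambda> * d x z * 3 powr \<alpha>) powr p * (scale k powr (- p) * scale k powr (\<alpha> * p))"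
      using \<Lambda> by (simp add: powr_mult powr_divide powr_powr powr_minus less_imp_le field_simps)
    also have "scale k powr (- p) * scale k powr (\<alpha> * p) = scale k powr (- ((1 - \<alpha>) * p))"
      by (simp add: powr_add[symmetric] algebra_simps)
    finally show ?thesis .
  qed
  finally show ?thesis by (simp only: of_nat_mult of_nat_power of_nat_numeral mult.assoc)
qed

lemma fine_limit: "(\<lambda>K. c * (2 * scale (int K)) powr (\<alpha> * p)) \<longlonglongrightarrow> 0"
proof -
  define q where "q = 2 powr (- (\<alpha> * p))"
  have q: "0 < q" "q < 1" using \<alpha> p_pos by (auto simp: q_def powr_less_one)
  have "(2 * scale (int K)) powr (\<alpha> * p) = 2 powr (\<alpha> * p) * q ^ K" for K
    using q by (simp add: powr_mult scale_def less_imp_le q_def powr_realpow[symmetric] powr_powr mult_ac)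
  moreover have "(\<lambda>K. c * (2 powr (\<alpha> * p) * q ^ K)) \<longlonglongrightarrow> c * (2 powr (\<alpha> * p) * 0)"
    using q by (intro tendsto_intros LIMSEQ_realpow_zero) auto
  ultimately show ?thesis by simp
qed

lemma coarse_limit: "(\<lambda>K. c * scale (- int K) powr (- ((1 - \<alpha>) * p))) \<longlonglongrightarrow> 0"
proof -
  define q where "q = 2 powr (- ((1 - \<alpha>) * p))"
  have q: "0 < q" "q < 1" using \<alpha> p_pos by (auto simp: q_def powr_less_one)
  have "scale (- int K) powr (- ((1 - \<alpha>) * p)) = q ^ K" for K
    using q by (simp add: scale_def q_def powr_realpow[symmetric] powr_powr mult_ac)
  moreover have "(\<lambda>K. c * q ^ K) \<longlonglongrightarrow> c * 0"
    using q by (intro tendsto_intros LIMSEQ_realpow_zero) auto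
  ultimately show ?thesis by simp
qed

text \<open>\<open>a\<close> is the part of \<open>b x - b z\<close> on the scales from
  \<open>- K\<close> to \<open>K - 1\<close>. Its molecules telescope, and the error consists of two
  fine terms, at \<open>x\<close> and at \<open>z\<close>, and one coarse term.\<close>

lemma dl_approx:
  assumes x: "x \<in> M" and e: "e > 0"
  shows "\<exists>a\<in>finsupp. lpn p (F.Lin b (F.dl x) - a) \<le> ennreal e \<and>
      F.G (F.dl x - fext (\<lambda>t. F.mol (left t) (right t)) a) \<le> e"
proof -
  define w where "w = b x - b z"
  obtain C where "C > 0" "\<And>x y. x \<in> M \<Longrightarrow> y \<in> M \<Longrightarrow> lpn p (b x - b y) \<le> ennreal (C * \<sigma> x y powr p)"
    using b_bound by blast
  then have "lpn p w \<le> ennreal (C * \<sigma> x z powr p)" using x z unfolding w_def by blast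
  then have w: "w \<in> lp p" unfolding lp_def by (auto intro: le_less_trans)
  have "eventually (\<lambda>K. t \<in> band K) sequentially" for t
  proof -
    obtain k i where t: "t = (k, i)" by (cases t)
    show ?thesis unfolding t band_def
      by (rule eventually_sequentiallyI[of "nat \<bar>k\<bar> + 1"]) auto
  qed
  from lpn_restr_tendsto[OF w this] have "(\<lambda>K. lpn p (w - restr w (band K))) \<longlonglongrightarrow> 0" .
  then have E1: "eventually (\<lambda>K. lpn p (w - restr w (band K)) < ennreal e) sequentially"
    using e by (intro order_tendstoD) auto
  define f where "f = (\<lambda>K. real N ^ 2 * (2 * scale (int K)) powr (\<alpha> * p))"
  define g where "g = (\<lambda>K. 2 * real N ^ 2 * (\<Lambda> * d x z * 3 powr \<alpha>) powr p * scale (- int K) powr (- ((1 - \<alpha>) * p)))"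
  have "f \<longlonglongrightarrow> 0" "g \<longlonglongrightarrow> 0" unfolding f_def g_def by (rule fine_limit coarse_limit)+
  then have E2: "eventually (\<lambda>K. f K < e / 3) sequentially" "eventually (\<lambda>K. g K < e / 3) sequentially"
    using e by (auto intro!: order_tendstoD)
  have E3: "eventually (\<lambda>K. d x z \<le> scale (- int K)) sequentially"
  proof -
    obtain n where n: "d x z < 2 ^ n" using real_arch_pow[of 2 "d x z"] by auto
    show ?thesis
    proof (rule eventually_sequentiallyI[of n])
      fix K assume "n \<le> K"
      then have "(2::real) ^ n \<le> 2 ^ K" by (intro power_increasing) auto
      moreover have "scale (- int K) = 2 ^ K" by (simp add: scale_def powr_realpow)
      ultimately show "d x z \<le> scale (- int K)" using n by linarith
    qed
  qed
  from E1 E2 E3 have "eventually (\<lambda>K. lpn p (w - restr w (band K)) < ennreal e \<and> f K < e / 3 \<and> g K < e / 3 \<and> d x z \<le> scale (- int K)) sequentially"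
    by (intro eventually_conj)
  then obtain K where K: "lpn p (w - restr w (band K)) < ennreal e" "f K < e / 3" "g K < e / 3" "d x z \<le> scale (- int K)"
    using eventually_happens'[OF sequentially_bot] by blast
  define a where "a = restr w (band K)"
  \<comment> \<open>Although \<open>b x\<close> and \<open>b z\<close> need not be in
    \<open>lp\<close>, each has finite support on a band, so the telescoping can be done separately
    for the two points.\<close>
  have a_eq: "a = restr (b x) (band K) + fscale (- 1) (restr (b z) (band K))"
    by (auto simp: a_def w_def restr_def fun_eq_iff)
  have a: "a \<in> finsupp"
    unfolding a_eq by (intro finsupp_add finsupp_scale restr_band_finsupp x z)
  have "fext (\<lambda>t. F.mol (left t) (right t)) a = (P (int K) x - P (- int K) x) + fscale (- 1) (P (int K) z - P (- int K) z)"
    unfolding a_eq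
    by (simp add: lin_on_add[OF fext_lin] lin_on_scale[OF fext_lin] finsupp_scale restr_band_finsupp x z fext_band)
  also have "fscale (- 1) (P (int K) z - P (- int K) z) = - (P (int K) z - P (- int K) z)"
    by (simp add: fscale_def fun_eq_iff)
  finally have fx: "fext (\<lambda>t. F.mol (left t) (right t)) a = (P (int K) x - P (- int K) x) - (P (int K) z - P (- int K) z)"
    by (simp only: diff_conv_add_uminus)
  have eq: "F.dl x - fext (\<lambda>t. F.mol (left t) (right t)) a
      = ((F.dl x - P (int K) x) - (F.dl z - P (int K) z)) + (P (- int K) x - P (- int K) z)"
    unfolding fx by (simp add: fun_eq_iff)
  have "F.G (F.dl x - fext (\<lambda>t. F.mol (left t) (right t)) a) \<le> F.G ((F.dl x - P (int K) x) - (F.dl z - P (int K) z)) + F.G (P (- int K) x - P (- int K) z)"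
    unfolding eq by (intro F.G_add F.V_diff F.dl_V P_V x z)
  also have "\<dots> \<le> (F.G (F.dl x - P (int K) x) + F.G (F.dl z - P (int K) z)) + F.G (P (- int K) x - P (- int K) z)"
    by (intro add_right_mono F.G_diff F.V_diff F.dl_V P_V x z)
  also have "\<dots> \<le> (f K + f K) + g K"
    unfolding f_def g_def by (intro add_mono G_fine G_coarse x z K)
  also have "\<dots> \<le> e" using K by simp
  finally have "F.G (F.dl x - fext (\<lambda>t. F.mol (left t) (right t)) a) \<le> e" .
  moreover have "lpn p (F.Lin b (F.dl x) - a) \<le> ennreal e"
    using K(1) by (simp add: F.Lin_dl[OF x] w_def[symmetric] a_def)
  ultimately show ?thesis using a by blast
qed

lemma approx_scheme: "\<exists>C. approx_scheme p M \<sigma> z b C left right"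
proof -
  obtain C where C: "C > 0" "\<And>x y. x \<in> M \<Longrightarrow> y \<in> M \<Longrightarrow> lpn p (b x - b y) \<le> ennreal (C * \<sigma> x y powr p)"
    using b_bound by blast
  have "approx_scheme p M \<sigma> z b C left right"
    by unfold_locales (use C dl_approx in \<open>auto simp: left_def right_def u\<close>)
  then show ?thesis by blast
qed

end

lemma (in snowflake) wavelet_exists: "\<exists>u \<phi>. wavelet p M d N \<alpha> z u \<phi>"
proof -
  have "M \<noteq> {}" using z by blast
  then have "\<forall>k. \<exists>u \<phi>. partition (scale k) u \<phi>"
    using partition_of_unity[OF scale_pos] by blast
  then obtain u \<phi> where "\<And>k. partition (scale k) (u k) (\<phi> k)" by metis
  then have "wavelet p M d N \<alpha> z u \<phi>" by unfold_locales
  then show ?thesis by blast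
qed

section \<open>Bumps along a lacunary sequence\<close>

text \<open>The two directions serve unbounded spaces, with growing distances, and bounded ones,
  with shrinking distances.\<close>

lemma lacunary_of_step:
  fixes f :: "nat \<Rightarrow> real"
  assumes pos: "\<And>n. f n > 0" and step: "(\<forall>n. 4 * f n \<le> f (Suc n)) \<or> (\<forall>n. 4 * f (Suc n) \<le> f n)"
    and "m \<noteq> n"
  shows "4 * f m \<le> f n \<or> 4 * f n \<le> f m"
proof -
  have lt: "4 * f m \<le> f n \<or> 4 * f n \<le> f m" if "m < n" for m n
    using step
  proof
    assume s: "\<forall>n. 4 * f n \<le> f (Suc n)"
    from that have "4 * f m \<le> f n"
    proof (induction n)
      case (Suc n)
      show ?case
      proof (cases "m = n")
        case False
        then have "4 * f m \<le> f n" using Suc by simp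
        also have "f n \<le> f (Suc n)" using s pos[of n] by (smt (verit))
        finally show ?thesis .
      qed (use s in auto)
    qed simp
    then show ?thesis ..
  next
    assume s: "\<forall>n. 4 * f (Suc n) \<le> f n"
    from that have "4 * f n \<le> f m"
    proof (induction n)
      case (Suc n)
      show ?case
      proof (cases "m = n")
        case False
        then have "4 * f n \<le> f m" using Suc by simp
        moreover have "f (Suc n) \<le> f n" using s pos[of "Suc n"] by (smt (verit))
        ultimately show ?thesis by simp
      qed (use s in auto)
    qed simp
    then show ?thesis ..
  qed
  show ?thesis using lt[of m n] lt[of n m] \<open>m \<noteq> n\<close> by (cases "m < n") auto
qed

context doubling_space
begin

lemma bounded_imp_totally_bounded:
  assumes z: "z \<in> M" and B: "\<And>x. x \<in> M \<Longrightarrow> d z x \<le> B"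
  shows "mtotally_bounded M"
  unfolding mtotally_bounded_def
proof (intro allI impI)
  fix e :: real assume e: "e > 0"
  obtain n where "2 * B / e < 2 ^ n" using real_arch_pow[of 2 "2 * B / e"] by auto
  then have n: "B \<le> 2 ^ n * (e / 2)" using e by (simp add: field_simps)
  obtain C where C: "C \<subseteq> M" "finite C" "mcball z (2 ^ n * (e / 2)) \<subseteq> (\<Union>c\<in>C. mcball c (e / 2))"
    using cover_power[OF z, of "e / 2" n] e by auto
  have "M \<subseteq> (\<Union>c\<in>C. mball c e)"
  proof
    fix x assume x: "x \<in> M"
    then have "x \<in> mcball z (2 ^ n * (e / 2))" using B[OF x] n z by simp
    then obtain c where "c \<in> C" "x \<in> mcball c (e / 2)" using C(3) by blast
    then show "x \<in> (\<Union>c\<in>C. mball c e)" using e by (intro UN_I[of c]) auto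
  qed
  then show "\<exists>K. finite K \<and> K \<subseteq> M \<and> M \<subseteq> (\<Union>x\<in>K. mball x e)" using C by blast
qed

text \<open>
  In the unbounded case \<open>\<delta>\<close> is the distance to \<open>z\<close>; otherwise it is the distance to the (possibly
  ideal) limit point of an injective Cauchy sequence.
\<close>

lemma lacunary_sequence:
  assumes inf: "infinite M" and z: "z \<in> M"
  shows "\<exists>\<delta> w. (\<forall>x\<in>M. \<forall>y\<in>M. \<bar>\<delta> x - \<delta> y\<bar> \<le> d x y \<and> d x y \<le> \<delta> x + \<delta> y) \<and>
    (\<forall>n::nat. w n \<in> M \<and> 0 < \<delta> (w n)) \<and>
    (\<forall>m n. m \<noteq> n \<longrightarrow> 4 * \<delta> (w m) \<le> \<delta> (w n) \<or> 4 * \<delta> (w n) \<le> \<delta> (w m))"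
proof (cases "\<exists>B. \<forall>x\<in>M. d z x \<le> B")
  case False
  have big: "\<exists>y. (y \<in> M \<and> 0 < d z y) \<and> r \<le> d z y" for r
  proof -
    obtain y where "y \<in> M" "max r 1 < d z y" using False by (meson not_le)
    then show ?thesis by (intro exI[of _ y]) auto
  qed
  have "\<exists>w. \<forall>n::nat. (w n \<in> M \<and> 0 < d z (w n)) \<and> 4 * d z (w n) \<le> d z (w (Suc n))"
    by (rule dependent_nat_choice) (use big[of 0] big in blast)+
  then obtain w where w: "\<And>n::nat. w n \<in> M \<and> 0 < d z (w n)" "\<And>n. 4 * d z (w n) \<le> d z (w (Suc n))" by blast
  have "\<bar>d z x - d z y\<bar> \<le> d x y \<and> d x y \<le> d z x + d z y" if "x \<in> M" "y \<in> M" for x y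
    using triangle[OF z that] triangle[OF z that(2,1)] triangle''[OF that(1) z that(2)] commute[of x y] by auto
  then show ?thesis
    using w lacunary_of_step[of "\<lambda>n. d z (w n)"] by (intro exI[of _ "d z"] exI[of _ w]) blast
next
  case True
  then have tb: "mtotally_bounded M" using bounded_imp_totally_bounded[OF z] by blast
  obtain f :: "nat \<Rightarrow> 'a" where f: "inj f" "range f \<subseteq> M" using infinite_countable_subset[OF inf] by blast
  obtain r where r: "strict_mono r" "MCauchy (f \<circ> r)"
    using tb f(2) unfolding mtotally_bounded_sequentially by blast
  define c where "c = f \<circ> r"
  have c: "inj c" unfolding c_def using f(1) r(1) by (intro inj_compose strict_mono_imp_inj_on)
  have cM: "c n \<in> M" for n using f(2) by (auto simp: c_def)
  have cC: "\<exists>K. \<forall>m\<ge>K. \<forall>n\<ge>K. d (c m) (c n) < e" if "e > 0" for e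
  proof -
    have "\<exists>K. \<forall>m n. K \<le> m \<longrightarrow> K \<le> n \<longrightarrow> d (c m) (c n) < e"
      using r(2) that by (simp add: MCauchy_def c_def)
    then show ?thesis by simp
  qed
  have "\<exists>l. (\<lambda>n. d x (c n)) \<longlonglongrightarrow> l" if x: "x \<in> M" for x
  proof -
    have "Cauchy (\<lambda>n. d x (c n))"
    proof (rule CauchyI)
      fix e :: real assume "e > 0"
      then obtain K where K: "\<forall>m\<ge>K. \<forall>n\<ge>K. d (c m) (c n) < e" using cC by blast
      have "\<bar>d x (c m) - d x (c n)\<bar> \<le> d (c m) (c n)" for m n
        using triangle[OF x cM[of m] cM[of n]] triangle[OF x cM[of n] cM[of m]] commute[of "c m" "c n"] by auto
      then show "\<exists>K. \<forall>m\<ge>K. \<forall>n\<ge>K. norm (d x (c m) - d x (c n)) < e"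
        using K by (metis le_less_trans real_norm_def)
    qed
    then show ?thesis by (simp add: Cauchy_convergent_iff convergent_def)
  qed
  then obtain \<delta> where \<delta>: "\<And>x. x \<in> M \<Longrightarrow> (\<lambda>n. d x (c n)) \<longlonglongrightarrow> \<delta> x" by metis
  have ineq: "\<bar>\<delta> x - \<delta> y\<bar> \<le> d x y \<and> d x y \<le> \<delta> x + \<delta> y" if x: "x \<in> M" and y: "y \<in> M" for x y
  proof
    have "(\<lambda>n. \<bar>d x (c n) - d y (c n)\<bar>) \<longlonglongrightarrow> \<bar>\<delta> x - \<delta> y\<bar>"
      by (intro tendsto_intros \<delta> x y)
    then show "\<bar>\<delta> x - \<delta> y\<bar> \<le> d x y"
    proof (rule LIMSEQ_le_const2, intro exI[of _ 0] allI impI)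
      fix n
      show "\<bar>d x (c n) - d y (c n)\<bar> \<le> d x y"
        using triangle[OF x y cM[of n]] triangle[OF y x cM[of n]] commute[of x y] by auto
    qed
    have "(\<lambda>n. d x (c n) + d y (c n)) \<longlonglongrightarrow> \<delta> x + \<delta> y"
      by (intro tendsto_intros \<delta> x y)
    then show "d x y \<le> \<delta> x + \<delta> y"
    proof (rule LIMSEQ_le_const, intro exI[of _ 0] allI impI)
      fix n
      show "d x y \<le> d x (c n) + d y (c n)" using triangle'[OF x cM[of n] y] by simp
    qed
  qed
  have \<delta>0: "\<delta> x \<ge> 0" if "x \<in> M" for x
    using \<delta>[OF that] by (rule LIMSEQ_le_const) auto
  have small: "\<exists>y. (y \<in> M \<and> 0 < \<delta> y) \<and> \<delta> y \<le> e" if e: "e > 0" for e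
  proof -
    obtain K where K: "\<forall>m\<ge>K. \<forall>n\<ge>K. d (c m) (c n) < e" using cC[OF e] by blast
    have le: "\<delta> (c m) \<le> e" if "m \<ge> K" for m
      using \<delta>[OF cM] by (rule LIMSEQ_le_const2) (use K that in \<open>auto intro: less_imp_le\<close>)
    \<comment> \<open>Consecutive points are distinct and their \<delta>-values add up to at least
      their distance, so one of the values is positive even if the limit itself occurs in the
      sequence.\<close>
    have "c K \<noteq> c (Suc K)" using c by (auto dest: injD)
    then have "0 < d (c K) (c (Suc K))" using cM by simp
    then have "0 < \<delta> (c K) \<or> 0 < \<delta> (c (Suc K))" using ineq[OF cM[of K] cM[of "Suc K"]] by linarith
    then show ?thesis using le[of K] le[of "Suc K"] cM by auto
  qed
  have "\<exists>w. \<forall>n::nat. (w n \<in> M \<and> 0 < \<delta> (w n)) \<and> 4 * \<delta> (w (Suc n)) \<le> \<delta> (w n)"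
  proof (rule dependent_nat_choice)
    show "\<exists>y. y \<in> M \<and> 0 < \<delta> y" using small[of 1] by auto
    fix x n assume "x \<in> M \<and> 0 < \<delta> x"
    then show "\<exists>y. (y \<in> M \<and> 0 < \<delta> y) \<and> 4 * \<delta> y \<le> \<delta> x" using small[of "\<delta> x / 4"] by auto
  qed
  then obtain w where w: "\<And>n::nat. w n \<in> M \<and> 0 < \<delta> (w n)" "\<And>n. 4 * \<delta> (w (Suc n)) \<le> \<delta> (w n)" by blast
  have "4 * \<delta> (w m) \<le> \<delta> (w n) \<or> 4 * \<delta> (w n) \<le> \<delta> (w m)" if "m \<noteq> n" for m n
    using lacunary_of_step[of "\<lambda>n. \<delta> (w n)" m n] w that by blast
  then show ?thesis
    using w ineq by (intro exI[of _ \<delta>] exI[of _ w]) blast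
qed

end

text \<open>Bump \<open>k\<close> is a function of \<delta> and lives where \<delta> is within
  \<open>t k / 2\<close> of \<open>t k\<close>; ratios of at least 4 make these intervals disjoint.
  Built from an \<alpha>-th power of a 1-Lipschitz function, it is 1-Lipschitz for \<sigma>. At most
  one bump is nonzero at each of \<open>x\<close> and \<open>y\<close>, whence the constant
  2.\<close>

lemma (in snowflake) bumps:
  assumes inf: "infinite M"
  shows "\<exists>(q :: 'a \<Rightarrow> nat \<Rightarrow> real) u v c c0. (\<forall>x\<in>M. \<forall>y\<in>M. lpn p (q x - q y) \<le> ennreal (2 * \<sigma> x y powr p)) \<and>
    (\<forall>k. u k \<in> M \<and> v k \<in> M \<and> u k \<noteq> v k \<and> q (u k) - q (v k) = fscale (c k) (unitv k) \<and>
      c0 * \<sigma> (u k) (v k) \<le> c k) \<and> c0 > (0::real)"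
proof -
  obtain \<delta> w where \<delta>: "\<And>x y. x \<in> M \<Longrightarrow> y \<in> M \<Longrightarrow> \<bar>\<delta> x - \<delta> y\<bar> \<le> d x y \<and> d x y \<le> \<delta> x + \<delta> y"
    and w: "\<And>n::nat. w n \<in> M \<and> 0 < \<delta> (w n)"
    and lac: "\<And>m n. m \<noteq> n \<Longrightarrow> 4 * \<delta> (w m) \<le> \<delta> (w n) \<or> 4 * \<delta> (w n) \<le> \<delta> (w m)"
    using lacunary_sequence[OF inf z] by blast
  \<comment> \<open>The sequence is cut into pairs: the member with the larger \<delta>-value,
    \<open>hi\<close>, carries the bump, and the bumps vanish at its partner \<open>lo\<close>,
    which is at distance at most \<open>2 * t k\<close>.\<close>
  define hi where "hi = (\<lambda>k. if \<delta> (w (2 * k)) \<le> \<delta> (w (2 * k + 1)) then 2 * k + 1 else 2 * k)"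
  define lo where "lo = (\<lambda>k. if \<delta> (w (2 * k)) \<le> \<delta> (w (2 * k + 1)) then 2 * k else 2 * k + 1)"
  have div2: "hi k div 2 = k" "lo k div 2 = k" "hi k \<noteq> lo k" for k by (simp_all add: hi_def lo_def)
  have hi_inj: "hi j \<noteq> hi k" if "j \<noteq> k" for j k using that div2(1) by metis
  have hilo: "hi j \<noteq> lo k" for j k using div2 by metis
  define t where "t = (\<lambda>k. \<delta> (w (hi k)))"
  have t: "t k > 0" for k using w by (simp add: t_def)
  have lo_le: "\<delta> (w (lo k)) \<le> t k" for k by (auto simp: t_def hi_def lo_def)
  define q where "q = (\<lambda>x k. max 0 ((t k / 2) powr \<alpha> - \<bar>\<delta> x - t k\<bar> powr \<alpha>))"
  have supp: "\<bar>\<delta> x - t k\<bar> < t k / 2" if "q x k \<noteq> 0" for x k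
  proof (rule ccontr)
    assume "\<not> \<bar>\<delta> x - t k\<bar> < t k / 2"
    then have "(t k / 2) powr \<alpha> \<le> \<bar>\<delta> x - t k\<bar> powr \<alpha>" using t[of k] \<alpha> by (intro powr_mono2) auto
    then show False using that by (simp add: q_def)
  qed
  have far: "q (w n) k = 0" if "n \<noteq> hi k" for n k
  proof (rule ccontr)
    assume "q (w n) k \<noteq> 0"
    from supp[OF this] show False using lac[OF that] t[of k] unfolding t_def by linarith
  qed
  have one: "j = k" if "q x j \<noteq> 0" "q x k \<noteq> 0" for x j k
  proof (rule ccontr)
    assume "j \<noteq> k"
    then show False
      using lac[OF hi_inj, of j k] supp[OF that(1)] supp[OF that(2)] t[of j] t[of k] unfolding t_def by linarith
  qed
  have lip: "\<bar>q x k - q y k\<bar> \<le> \<sigma> x y" if "x \<in> M" "y \<in> M" for x y k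
  proof -
    have "\<bar>q x k - q y k\<bar> \<le> \<bar>\<bar>\<delta> x - t k\<bar> powr \<alpha> - \<bar>\<delta> y - t k\<bar> powr \<alpha>\<bar>"
      unfolding q_def by linarith
    also have "\<dots> \<le> \<bar>\<bar>\<delta> x - t k\<bar> - \<bar>\<delta> y - t k\<bar>\<bar> powr \<alpha>" using \<alpha> by (intro abs_diff_powr_le) auto
    also have "\<dots> \<le> d x y powr \<alpha>" using \<delta>[OF that] \<alpha> by (intro powr_mono2) auto
    finally show ?thesis by (simp add: \<sigma>_def)
  qed
  have L: "lpn p (q x - q y) \<le> ennreal (2 * \<sigma> x y powr p)" if x: "x \<in> M" and y: "y \<in> M" for x y
  proof -
    have sub: "card {k. q x k \<noteq> 0} \<le> 1 \<and> finite {k. q x k \<noteq> 0}" for x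
    proof (cases "\<exists>k. q x k \<noteq> 0")
      case True
      then obtain k where "q x k \<noteq> 0" by blast
      then have "{k. q x k \<noteq> 0} = {k}" using one by blast
      then show ?thesis by simp
    qed simp
    define A where "A = {k. q x k \<noteq> 0} \<union> {k. q y k \<noteq> 0}"
    have A: "finite A" "card A \<le> 2"
      using sub[of x] sub[of y] card_Un_le[of "{k. q x k \<noteq> 0}" "{k. q y k \<noteq> 0}"] by (auto simp: A_def)
    have "lpn p (q x - q y) = ennreal (\<Sum>k\<in>A. \<bar>(q x - q y) k\<bar> powr p)"
      by (rule lpn_finite[OF A(1)]) (auto simp: A_def)
    also have "\<dots> \<le> ennreal (real (card A) * \<sigma> x y powr p)"
      using lip[OF x y] p_pos by (intro ennreal_leI sum_bounded_above powr_mono2) auto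
    also have "\<dots> \<le> ennreal (2 * \<sigma> x y powr p)"
      using A(2) by (intro ennreal_leI mult_right_mono) auto
    finally show ?thesis .
  qed
  show ?thesis
  proof (rule exI[of _ q], rule exI[of _ "\<lambda>k. w (hi k)"], rule exI[of _ "\<lambda>k. w (lo k)"],
      rule exI[of _ "\<lambda>k. (t k / 2) powr \<alpha>"], rule exI[of _ "4 powr (- \<alpha>)"], intro conjI ballI allI)
    show "4 powr (- \<alpha>) > (0::real)" by simp
    show "lpn p (q x - q y) \<le> ennreal (2 * \<sigma> x y powr p)" if "x \<in> M" "y \<in> M" for x y
      using that by (rule L)
    show "w (hi k) \<in> M" "w (lo k) \<in> M" for k using w by auto
    show "w (hi k) \<noteq> w (lo k)" for k
      using lac[OF hilo[of k k]] w[of "hi k"] by auto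
    show "q (w (hi k)) - q (w (lo k)) = fscale ((t k / 2) powr \<alpha>) (unitv k)" for k
    proof -
      have "q (w (hi k)) k = (t k / 2) powr \<alpha>" by (simp add: q_def t_def)
      moreover have "q (w (hi k)) j = 0" if "j \<noteq> k" for j using far[OF hi_inj, of k j] that by auto
      moreover have "q (w (lo k)) j = 0" for j using far[OF hilo[symmetric]] .
      ultimately show ?thesis
        by (auto simp: fun_eq_iff unitv_def)
    qed
    \<comment> \<open>The distance is at most \<open>2 * t k\<close>, four times the base
      \<open>t k / 2\<close> of the bump height; hence the constant
      \<open>4 powr (- \<alpha>)\<close>.\<close>
    show "4 powr (- \<alpha>) * \<sigma> (w (hi k)) (w (lo k)) \<le> (t k / 2) powr \<alpha>" for k
    proof -
      have "d (w (hi k)) (w (lo k)) \<le> 2 * t k"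
        using \<delta>[of "w (hi k)" "w (lo k)"] w lo_le[of k] by (fastforce simp: t_def)
      then have "\<sigma> (w (hi k)) (w (lo k)) \<le> (4 * (t k / 2)) powr \<alpha>"
        unfolding \<sigma>_def using \<alpha> by (intro powr_mono2) auto
      also have "\<dots> = 4 powr \<alpha> * (t k / 2) powr \<alpha>" using t[of k] by (subst powr_mult) auto
      finally show ?thesis
        by (simp add: powr_minus field_simps)
    qed
  qed
qed

theorem theoremA:
  fixes M :: "'a set" and \<rho> :: "'a \<Rightarrow> 'a \<Rightarrow> real" and \<alpha> p :: real and z :: 'a
  assumes "Metric_space M \<rho>" and "infinite M" and "doubling M \<rho>"
    and "0 < \<alpha>" and "\<alpha> < 1" and "0 < p" and "p \<le> 1" and "z \<in> M"
  shows "isomorphic (lipschitz_free_pspace p M (\<lambda>x y. \<rho> x y powr \<alpha>) z) (lp_space p)"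
proof -
  obtain N where "doubling_space M \<rho> N"
    using Metric_space.doubling_spaceE[OF assms(1,3)] by blast
  then interpret snowflake p M \<rho> N \<alpha> z
    using assms by (intro snowflake.intro exponent.intro snowflake_axioms.intro)
  obtain u \<phi> where "wavelet p M \<rho> N \<alpha> z u \<phi>" using wavelet_exists by blast
  then interpret wavelet p M \<rho> N \<alpha> z u \<phi> .
  obtain C where "approx_scheme p M \<sigma> z b C left right" using approx_scheme by blast
  then interpret A: approx_scheme p M \<sigma> z b C left right .
  obtain q :: "'a \<Rightarrow> nat \<Rightarrow> real" and g h c c0
    where q: "\<And>x y. x \<in> M \<Longrightarrow> y \<in> M \<Longrightarrow> lpn p (q x - q y) \<le> ennreal (2 * \<sigma> x y powr p)"
      and gh: "\<And>k. g k \<in> M \<and> h k \<in> M \<and> g k \<noteq> h k \<and> q (g k) - q (h k) = fscale (c k) (unitv k) \<and>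
        c0 * \<sigma> (g k) (h k) \<le> c k" and c0: "c0 > (0::real)"
    using bumps[OF assms(2)] by blast
  \<comment> \<open>The bumps are indexed by \<open>nat\<close>, the decomposition by a countable
    product type. An injection selects a subfamily of bumps, and \<open>pull n\<close> discards the
    remaining coordinates.\<close>
  define n where "n = (to_nat :: nat \<times> nat \<times> int \<times> nat \<times> nat \<Rightarrow> nat)"
  have n: "inj n" by (simp add: n_def)
  have "isomorphic (lipschitz_free_pspace p M \<sigma> z) (lp_space p)"
  proof (rule A.isomorphic_lp[where D=2 and q="\<lambda>x. pull n (q x)" and u="g \<circ> n" and v="h \<circ> n" and c="c \<circ> n"])
    show "lpn p (pull n (q x) - pull n (q y)) \<le> ennreal (2 * \<sigma> x y powr p)" if "x \<in> M" "y \<in> M" for x y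
      using order_trans[OF lpn_pull[OF n] q[OF that]] by (simp only: pull_diff)
    show "pull n (q ((g \<circ> n) k)) - pull n (q ((h \<circ> n) k)) = fscale ((c \<circ> n) k) (unitv k)" for k
    proof -
      have "pull n (q (g (n k)) - q (h (n k))) = fscale (c (n k)) (unitv k)"
        using gh[of "n k"] n by (auto simp: pull_def unitv_def fun_eq_iff inj_eq)
      then show ?thesis by (simp only: pull_diff o_apply)
    qed
  qed (use gh c0 in auto)
  then show ?thesis unfolding \<sigma>_def[abs_def] .
qed

end
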